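(* Let $K$ be an algebraically closed field, let $A$ be a finite-dimensional $K$-algebra, possibly with additional structure (i.e. a finite-dimensional $K$-multialgebra), and let $r\in\mathbb{N}$. Let $G$ be the identity connected component of the $K$-algebraic group $\mathrm{Aut}_K(A)$, and suppose that the action of $G(K)$ on the maximal subalgebras of $A$ has finitely many orbits, represented by $A_1,\dots,A_t$. For $i\in\{1,\dots,t\}$, let $X_i$ be the Zariski closure of $\bigcup_{g\in G(K)}g(A_i)^r$ in $V_r$. Then: (i) The irreducible components of $Z_r$ are the maximal members (with respect to inclusion) of the family $X_1,\dots,X_t$. (ii) $\dim Z_r\leq \dim G+\max\{r\dim A_i-\dim \mathrm{Stab}_G(A_i) : i\in\{1,\dots,t\}\}$, and equality holds if the maximum is attained at an index $i$ for which $A_i$ can be generated by $r$ elements.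
   Context: A $K$-multialgebra is a $K$-vector space $A$ equipped with $K$-multilinear operations $\{\mu_i:A^{n_i}\to A\}_{i\in I}$ (e.g. a product, an involution, or a unit element encoded as an operation with $0$ arguments). A subalgebra is a subspace closed under all the operations; the subalgebra generated by a subset is the smallest subalgebra containing it; a maximal subalgebra is a maximal proper subalgebra. $\mathrm{Aut}_K(A)$ is the $K$-algebraic group of multialgebra automorphisms of $A$. $V_r$ is the $K$-affine space underlying $A^r$, and $Z_r$ is the closed subscheme of $V_r$ such that for every field extension $L/K$, $Z_r(L)$ is the set of $r$-tuples in $A_L^r$ (where $A_L=A\otimes_KL$) which do not generate the $L$-multialgebra $A_L$. As $K$ is algebraically closed, $Z_r$ and $V_r$ are identified with their sets of $K$-points with the Zariski topology. $G(K)$ acts on subspaces of $A$ by $A_i\mapsto g(A_i)$. *)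

theory Defs
  imports "HOL-Analysis.Analysis" "HOL-Computational_Algebra.Computational_Algebra"
begin

definition irreducible_space :: "'x topology \<Rightarrow> bool" where
  "irreducible_space T \<longleftrightarrow> topspace T \<noteq> {} \<and>
     (\<forall>E F. closedin T E \<and> closedin T F \<and> E \<union> F = topspace T
        \<longrightarrow> E = topspace T \<or> F = topspace T)"

definition irreduciblein :: "'x topology \<Rightarrow> 'x set \<Rightarrow> bool" where
  "irreduciblein T S \<longleftrightarrow> S \<subseteq> topspace T \<and> irreducible_space (subtopology T S)"

definition irreducible_components :: "'x topology \<Rightarrow> 'x set set" where
  "irreducible_components T =
     {S. irreduciblein T S \<and> (\<forall>S'. irreduciblein T S' \<and> S \<subseteq> S' \<longrightarrow> S' = S)}"

text \<open>
  The values are extended reals so that the empty space gets dimension \<open>- \<infinity>\<close> (the supremum of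
  the empty set).
\<close>

definition krull_dim :: "'x topology \<Rightarrow> ereal" where
  "krull_dim T = Sup {ereal (real n) | n. \<exists>C :: nat \<Rightarrow> 'x set.
     (\<forall>k\<le>n. closedin T (C k) \<and> irreduciblein T (C k)) \<and> (\<forall>k<n. C k \<subset> C (Suc k))}"

inductive_set polynomial_functions :: "('x \<Rightarrow> 'k::comm_ring_1) set \<Rightarrow> ('x \<Rightarrow> 'k) set"
  for C :: "('x \<Rightarrow> 'k) set" where
  const: "(\<lambda>_. c) \<in> polynomial_functions C"
| coord: "f \<in> C \<Longrightarrow> f \<in> polynomial_functions C"
| add: "\<lbrakk>p \<in> polynomial_functions C; q \<in> polynomial_functions C\<rbrakk>
        \<Longrightarrow> (\<lambda>x. p x + q x) \<in> polynomial_functions C"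
| mult: "\<lbrakk>p \<in> polynomial_functions C; q \<in> polynomial_functions C\<rbrakk>
        \<Longrightarrow> (\<lambda>x. p x * q x) \<in> polynomial_functions C"

definition zero_locus :: "'x set \<Rightarrow> ('x \<Rightarrow> 'k::zero) set \<Rightarrow> 'x set" where
  "zero_locus X P = {x \<in> X. \<forall>p\<in>P. p x = 0}"

definition zariski_topology :: "'x set \<Rightarrow> ('x \<Rightarrow> 'k::idom) set \<Rightarrow> 'x topology" where
  "zariski_topology X C =
     topology (\<lambda>U. \<exists>P \<subseteq> polynomial_functions C. U = X - zero_locus X P)"

lemma istopology_zariski:
  fixes C :: "('x \<Rightarrow> 'k::idom) set"
  shows "istopology (\<lambda>U. \<exists>P \<subseteq> polynomial_functions C. U = X - zero_locus X P)"
  unfolding istopology_def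
proof (intro conjI allI impI)
  fix U V
  assume "\<exists>P\<subseteq>polynomial_functions C. U = X - zero_locus X P"
    and "\<exists>P\<subseteq>polynomial_functions C. V = X - zero_locus X P"
  then obtain P Q where PQ: "P \<subseteq> polynomial_functions C" "U = X - zero_locus X P"
    "Q \<subseteq> polynomial_functions C" "V = X - zero_locus X Q" by blast
  let ?R = "{(\<lambda>x. p x * q x) | p q. p \<in> P \<and> q \<in> Q}"
  have "?R \<subseteq> polynomial_functions C"
    using PQ by (auto intro!: polynomial_functions.mult)
  moreover have "U \<inter> V = X - zero_locus X ?R"
    unfolding PQ zero_locus_def by fastforce
  ultimately show "\<exists>P\<subseteq>polynomial_functions C. U \<inter> V = X - zero_locus X P" by blast
next
  fix \<K>
  assume "\<forall>K\<in>\<K>. \<exists>P\<subseteq>polynomial_functions C. K = X - zero_locus X P"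
  then obtain P where P: "\<And>K. K \<in> \<K> \<Longrightarrow> P K \<subseteq> polynomial_functions C \<and> K = X - zero_locus X (P K)"
    by metis
  have "\<Union>\<K> = (\<Union>K\<in>\<K>. X - zero_locus X (P K))"
    using P by auto
  also have "\<dots> = X - zero_locus X (\<Union>K\<in>\<K>. P K)"
    by (auto simp: zero_locus_def)
  finally show "\<exists>P\<subseteq>polynomial_functions C. \<Union>\<K> = X - zero_locus X P"
    using P by (intro exI[of _ "\<Union>K\<in>\<K>. P K"]) blast
qed

lemma openin_zariski:
  "openin (zariski_topology X C) U \<longleftrightarrow>
     (\<exists>P \<subseteq> polynomial_functions C. U = X - zero_locus X P)"
  by (simp add: zariski_topology_def istopology_zariski topology_inverse')

lemma topspace_zariski [simp]: "topspace (zariski_topology X C) = X"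
proof
  show "topspace (zariski_topology X C) \<subseteq> X"
    by (auto simp: topspace_def openin_zariski)
  have "openin (zariski_topology X C) X"
    unfolding openin_zariski
    by (intro exI[of _ "{\<lambda>_. 1}"]) (auto simp: zero_locus_def polynomial_functions.const)
  then show "X \<subseteq> topspace (zariski_topology X C)"
    by (rule openin_subset)
qed

lemma closedin_zariski:
  "closedin (zariski_topology X C) F \<longleftrightarrow>
     (\<exists>P \<subseteq> polynomial_functions C. F = zero_locus X P)"
proof -
  have "zero_locus X P \<subseteq> X" for P :: "('a \<Rightarrow> 'b) set"
    by (auto simp: zero_locus_def)
  then show ?thesis
    unfolding closedin_def openin_zariski topspace_zariski by (metis double_diff order_refl)
qed

text \<open>
  The underlying space is the whole type \<open>'a\<close>. For \<open>i \<in> opindex A\<close>, the operation \<open>oper A i\<close> has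
  \<open>arity A i\<close> arguments; \<open>n\<close>-tuples are extensional functions on \<open>{..<n}\<close>, so that a 0-ary
  operation is an element of \<open>'a\<close>.
\<close>

record ('k, 'a, 'i) multialg =
  smult :: "'k \<Rightarrow> 'a \<Rightarrow> 'a"
  opindex :: "'i set"
  arity :: "'i \<Rightarrow> nat"
  oper :: "'i \<Rightarrow> (nat \<Rightarrow> 'a) \<Rightarrow> 'a"

abbreviation tuples :: "nat \<Rightarrow> 'a set \<Rightarrow> (nat \<Rightarrow> 'a) set" where
  "tuples n S \<equiv> {..<n} \<rightarrow>\<^sub>E S"

definition multialgebra :: "('k::field, 'a::ab_group_add, 'i) multialg \<Rightarrow> bool" where
  "multialgebra A \<longleftrightarrow> vector_space (smult A) \<and>
     (\<forall>i\<in>opindex A. \<forall>x\<in>tuples (arity A i) UNIV. \<forall>j<arity A i.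
        Vector_Spaces.linear (smult A) (smult A) (\<lambda>a. oper A i (x(j := a))))"

definition fin_dim :: "('k::field, 'a::ab_group_add, 'i) multialg \<Rightarrow> bool" where
  "fin_dim A \<longleftrightarrow> (\<exists>B. finite B \<and> module.span (smult A) B = UNIV)"

definition subalgebra :: "('k::field, 'a::ab_group_add, 'i) multialg \<Rightarrow> 'a set \<Rightarrow> bool" where
  "subalgebra A S \<longleftrightarrow> module.subspace (smult A) S \<and>
     (\<forall>i\<in>opindex A. \<forall>x\<in>tuples (arity A i) S. oper A i x \<in> S)"

definition generated :: "('k::field, 'a::ab_group_add, 'i) multialg \<Rightarrow> 'a set \<Rightarrow> 'a set" where
  "generated A X = subalgebra A hull X"

definition maximal_subalgebra ::
    "('k::field, 'a::ab_group_add, 'i) multialg \<Rightarrow> 'a set \<Rightarrow> bool" where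
  "maximal_subalgebra A M \<longleftrightarrow> subalgebra A M \<and> M \<noteq> UNIV \<and>
     (\<forall>N. subalgebra A N \<and> N \<noteq> UNIV \<and> M \<subseteq> N \<longrightarrow> N = M)"

definition generated_by :: "('k::field, 'a::ab_group_add, 'i) multialg \<Rightarrow> nat \<Rightarrow> 'a set \<Rightarrow> bool" where
  "generated_by A r S \<longleftrightarrow> (\<exists>x\<in>tuples r S. generated A (x ` {..<r}) = S)"

definition linear_functionals ::
    "('k::field, 'a::ab_group_add, 'i) multialg \<Rightarrow> ('a \<Rightarrow> 'k) set" where
  "linear_functionals A = {\<phi>. Vector_Spaces.linear (smult A) (*) \<phi>}"

text \<open>
  Over an algebraically closed field, the schemes \<open>V\<^sub>r\<close>, \<open>Z\<^sub>r\<close> and the algebraic groups below are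
  represented by their sets of rational points with the Zariski topology; irreducible components,
  identity component and dimension are topological and are not affected.
\<close>

definition V :: "('k::field, 'a::ab_group_add, 'i) multialg \<Rightarrow> nat \<Rightarrow> (nat \<Rightarrow> 'a) topology" where
  "V A r = zariski_topology (tuples r UNIV)
             {(\<lambda>x. \<phi> (x j)) | \<phi> j. \<phi> \<in> linear_functionals A \<and> j < r}"

definition Z :: "('k::field, 'a::ab_group_add, 'i) multialg \<Rightarrow> nat \<Rightarrow> (nat \<Rightarrow> 'a) topology" where
  "Z A r = subtopology (V A r) {x \<in> tuples r UNIV. generated A (x ` {..<r}) \<noteq> UNIV}"

definition automorphisms ::
    "('k::field, 'a::ab_group_add, 'i) multialg \<Rightarrow> ('a \<Rightarrow> 'a) set" where
  "automorphisms A = {g. Vector_Spaces.linear (smult A) (smult A) g \<and> bij g \<and>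
     (\<forall>i\<in>opindex A. \<forall>x\<in>tuples (arity A i) UNIV.
        g (oper A i x) = oper A i (compose {..<arity A i} g x))}"

text \<open>
  The coordinate functions are the matrix coefficients, which span the dual of the space of
  endomorphisms. Inverting the determinant does not change the induced topology on the general
  linear group.
\<close>

definition End_space :: "('k::field, 'a::ab_group_add, 'i) multialg \<Rightarrow> ('a \<Rightarrow> 'a) topology" where
  "End_space A = zariski_topology {f. Vector_Spaces.linear (smult A) (smult A) f}
                   {(\<lambda>f. \<phi> (f a)) | \<phi> a. \<phi> \<in> linear_functionals A}"

definition Aut0 :: "('k::field, 'a::ab_group_add, 'i) multialg \<Rightarrow> ('a \<Rightarrow> 'a) set" where
  "Aut0 A = connected_component_of_set (subtopology (End_space A) (automorphisms A)) id"

definition orbit :: "('a \<Rightarrow> 'a) set \<Rightarrow> 'a set \<Rightarrow> 'a set set" where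
  "orbit G S = (\<lambda>g. g ` S) ` G"

definition stab :: "('a \<Rightarrow> 'a) set \<Rightarrow> 'a set \<Rightarrow> ('a \<Rightarrow> 'a) set" where
  "stab G S = {g \<in> G. g ` S = S}"

definition group_dim ::
    "('k::field, 'a::ab_group_add, 'i) multialg \<Rightarrow> ('a \<Rightarrow> 'a) set \<Rightarrow> ereal" where
  "group_dim A H = krull_dim (subtopology (End_space A) H)"

end

theory Submission
  imports Defs
begin

text \<open>
  The tuples which do not generate \<open>A\<close> are those lying in some \<open>N\<^sup>r\<close> with \<open>N\<close> a maximal subalgebra, so
  the non-generating locus is the union of the sets \<open>g (A\<^sub>i)\<^sup>r\<close>. It is closed, because generating is
  an open condition, and hence it is the union of the \<open>X\<^sub>i\<close>. Each \<open>X\<^sub>i\<close> is irreducible since \<open>G\<close> is.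

  The dimension of a locally closed set \<open>W\<close> is the largest \<open>m\<close> for which some polynomial map
  \<open>W \<rightarrow> K\<^sup>m\<close> has dense image. Put \<open>T = {(g, y). y \<in> (g A\<^sub>i)\<^sup>r}\<close>. Since \<open>T\<close> is the image of
  \<open>G \<times> A\<^sub>i\<^sup>r\<close> under the injective map \<open>(g, x) \<mapsto> (g, g x)\<close>, it has dimension \<open>dim G + r dim A\<^sub>i\<close>. The stabilizer
  of \<open>A\<^sub>i\<close> acts freely on the fibres of the projection \<open>T \<rightarrow> X\<^sub>i\<close>, which gives the inequality. When \<open>y\<close> generates
  \<open>g A\<^sub>i\<close>, the fibre over \<open>y\<close> is a single coset of the stabilizer, which gives equality as soon as
  such \<open>y\<close> exist, because they then form a nonempty open set.
\<close>

subsection \<open>Polynomial functions\<close>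

text \<open>Coordinate rings of point sets and function fields are never formed. A function is an
  element of \<open>PF C\<close> on a whole type, two functions count as equal when they agree on
  the point set considered, and irreducibility of that set is what permits cancellation. All linear
  algebra over a function field is therefore done with denominators cleared.

  The characterization of dimension rests on two opposite facts: a properly larger irreducible set
  carries one more independent function, and a dominant map attains every value off a proper closed
  set of its target, so that generic level sets can be cut down one function at a time. The second
  fact also supplies the generic fibres needed for the equality.

  The quotient of \<open>G\<close> by the stabilizer is avoided as well. For the inequality, a
  relation between functions of \<open>y\<close> and functions of \<open>g\<close> is split into a
  sum of products and tested along the stabilizer. For the equality, too many independent functions
  of \<open>g\<close> would take generic joint values, although on each of finitely many cosets they
  satisfy a nontrivial relation.\<close>

abbreviation PF :: "('x \<Rightarrow> 'k::comm_ring_1) set \<Rightarrow> ('x \<Rightarrow> 'k) set" where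
  "PF \<equiv> polynomial_functions"

lemmas pf_const = polynomial_functions.const
lemmas pf_coord = polynomial_functions.coord
lemmas pf_add = polynomial_functions.add
lemmas pf_mult = polynomial_functions.mult

lemma pf_compose:
  assumes "p \<in> PF C" "\<And>f. f \<in> C \<Longrightarrow> (\<lambda>w. f (h w)) \<in> PF D"
  shows "(\<lambda>w. p (h w)) \<in> PF D"
  using assms by (induction p) (auto intro: pf_const pf_add pf_mult)

lemma pf_hull: "p \<in> PF D \<Longrightarrow> D \<subseteq> PF C \<Longrightarrow> p \<in> PF C"
  using pf_compose[of p D "\<lambda>x. x" C] by auto

lemma pf_mono: "p \<in> PF D \<Longrightarrow> D \<subseteq> C \<Longrightarrow> p \<in> PF C"
  by (rule pf_hull) (auto intro: pf_coord)

lemma pf_uminus: "p \<in> PF C \<Longrightarrow> (\<lambda>x. - p x) \<in> PF C"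
  using pf_mult[OF pf_const[of "-1"], of p C] by simp

lemma pf_diff: "p \<in> PF C \<Longrightarrow> q \<in> PF C \<Longrightarrow> (\<lambda>x. p x - q x) \<in> PF C"
  using pf_add[OF _ pf_uminus, of p C q] by simp

lemma pf_sum: "(\<And>i. i \<in> I \<Longrightarrow> p i \<in> PF C) \<Longrightarrow> (\<lambda>x. \<Sum>i\<in>I. p i x) \<in> PF C"
  by (induction I rule: infinite_finite_induct) (auto intro: pf_const pf_add)

lemma pf_prod: "(\<And>i. i \<in> I \<Longrightarrow> p i \<in> PF C) \<Longrightarrow> (\<lambda>x. \<Prod>i\<in>I. p i x) \<in> PF C"
  by (induction I rule: infinite_finite_induct) (auto intro: pf_const pf_mult)

lemma pf_power: "p \<in> PF C \<Longrightarrow> (\<lambda>x. p x ^ n) \<in> PF C"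
  by (induction n) (auto intro: pf_const pf_mult)

lemmas pf_intros = pf_const pf_add pf_mult pf_uminus pf_diff pf_sum pf_prod pf_power

text \<open>Coordinates are functions on a whole type, but identities such as the expansion of
  \<open>f v\<close> in matrix coefficients hold only on the ambient set. Replacing generators by
  polynomials is therefore only possible up to agreement on \<open>Om\<close>.\<close>

lemma pf_cong_on:
  assumes "p \<in> PF C" "\<And>f. f \<in> C \<Longrightarrow> \<exists>g\<in>PF D. \<forall>x\<in>Om. f x = g x"
  shows "\<exists>q\<in>PF D. \<forall>x\<in>Om. p x = q x"
  using assms(1)
proof induction
  case (const c) then show ?case by (intro bexI[of _ "\<lambda>_. c"]) (auto intro: pf_const)
next
  case (coord f) then show ?case using assms(2) by blast
next
  case (add p q)
  then obtain p' q' where "p' \<in> PF D" "\<forall>x\<in>Om. p x = p' x" "q' \<in> PF D" "\<forall>x\<in>Om. q x = q' x"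
    by blast
  then show ?case by (intro bexI[of _ "\<lambda>x. p' x + q' x"]) (auto intro: pf_add)
next
  case (mult p q)
  then obtain p' q' where "p' \<in> PF D" "\<forall>x\<in>Om. p x = p' x" "q' \<in> PF D" "\<forall>x\<in>Om. q x = q' x"
    by blast
  then show ?case by (intro bexI[of _ "\<lambda>x. p' x * q' x"]) (auto intro: pf_mult)
qed

text \<open>This permits passing from all linear functionals to the finitely many coordinates of a
  basis.\<close>

lemma zariski_topology_cong:
  fixes C D :: "('x \<Rightarrow> 'k::idom) set"
  assumes "\<And>f. f \<in> C \<Longrightarrow> \<exists>g\<in>PF D. \<forall>x\<in>Om. f x = g x"
    and "\<And>f. f \<in> D \<Longrightarrow> \<exists>g\<in>PF C. \<forall>x\<in>Om. f x = g x"
  shows "zariski_topology Om C = zariski_topology Om D"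
proof -
  have *: "\<exists>Q\<subseteq>PF D. zero_locus Om P = zero_locus Om Q"
    if "P \<subseteq> PF C" and C: "\<And>f. f \<in> C \<Longrightarrow> \<exists>g\<in>PF D. \<forall>x\<in>Om. f x = g x"
    for P and C D :: "('x \<Rightarrow> 'k) set"
  proof -
    have "\<forall>p\<in>P. \<exists>q\<in>PF D. \<forall>x\<in>Om. p x = q x"
      using pf_cong_on[of _ C D Om] C that(1) by blast
    then obtain F where F: "\<And>p. p \<in> P \<Longrightarrow> F p \<in> PF D \<and> (\<forall>x\<in>Om. p x = F p x)"
      by metis
    then show ?thesis by (intro exI[of _ "F ` P"]) (auto simp: zero_locus_def)
  qed
  have "openin (zariski_topology Om C) U \<longleftrightarrow> openin (zariski_topology Om D) U" for U
    unfolding openin_zariski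
  proof (rule iffI; elim exE conjE)
    fix P assume "P \<subseteq> PF C" "U = Om - zero_locus Om P"
    with *[of P C D] assms(1) show "\<exists>P\<subseteq>PF D. U = Om - zero_locus Om P" by metis
  next
    fix P assume "P \<subseteq> PF D" "U = Om - zero_locus Om P"
    with *[of P D C] assms(2) show "\<exists>P\<subseteq>PF C. U = Om - zero_locus Om P" by metis
  qed
  then show ?thesis by (simp add: topology_eq)
qed

text \<open>
  A polynomial in \<open>t\<close> with coefficients in \<open>PF C\<close> is a family of univariate polynomials
  indexed by the points; this makes the arithmetic of such expressions that of \<open>'k poly\<close>.
\<close>

definition polyfam :: "('x \<Rightarrow> 'k::comm_ring_1) set \<Rightarrow> ('x \<Rightarrow> 'k poly) \<Rightarrow> bool" where
  "polyfam C P \<longleftrightarrow> (\<forall>i. (\<lambda>x. coeff (P x) i) \<in> PF C) \<and> (\<exists>n. \<forall>x. degree (P x) \<le> n)"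

lemma polyfamI: "(\<And>i. (\<lambda>x. coeff (P x) i) \<in> PF C) \<Longrightarrow> (\<And>x. degree (P x) \<le> n) \<Longrightarrow> polyfam C P"
  by (auto simp: polyfam_def)

lemma polyfam_degree:
  assumes "polyfam C P" obtains n where "\<And>x. degree (P x) \<le> n"
  using assms by (auto simp: polyfam_def)

lemma polyfam_coeff: "polyfam C P \<Longrightarrow> (\<lambda>x. coeff (P x) i) \<in> PF C"
  by (simp add: polyfam_def)

lemma polyfam_add:
  assumes "polyfam C P" "polyfam C Q"
  shows "polyfam C (\<lambda>x. P x + Q x)"
proof -
  obtain m n where "\<And>x. degree (P x) \<le> m" "\<And>x. degree (Q x) \<le> n"
    using assms by (metis polyfam_degree)
  then have "degree (P x + Q x) \<le> max m n" for x
    by (intro degree_add_le) (auto simp: le_max_iff_disj)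
  then show ?thesis using assms by (intro polyfamI) (auto intro!: pf_add polyfam_coeff)
qed

lemma polyfam_mult:
  assumes "polyfam C P" "polyfam C Q"
  shows "polyfam C (\<lambda>x. P x * Q x)"
proof -
  obtain m n where "\<And>x. degree (P x) \<le> m" "\<And>x. degree (Q x) \<le> n"
    using assms by (metis polyfam_degree)
  then have "degree (P x * Q x) \<le> m + n" for x
    using degree_mult_le[of "P x" "Q x"] by (meson add_mono le_trans)
  then show ?thesis using assms
    by (intro polyfamI) (auto simp: coeff_mult intro!: pf_sum pf_mult polyfam_coeff)
qed

lemma polyfam_monom:
  assumes "p \<in> PF C"
  shows "polyfam C (\<lambda>x. monom (p x) n)"
proof (rule polyfamI[of _ _ n])
  show "(\<lambda>x. coeff (monom (p x) n) i) \<in> PF C" for i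
    by (cases "i = n") (auto simp: assms pf_const)
qed (rule degree_monom_le)

lemma polyfam_const: "p \<in> PF C \<Longrightarrow> polyfam C (\<lambda>x. [:p x:])"
  using polyfam_monom[of p C 0] by (simp add: monom_0)

lemma polyfam_sum: "(\<And>i. i \<in> I \<Longrightarrow> polyfam C (P i)) \<Longrightarrow> polyfam C (\<lambda>x. \<Sum>i\<in>I. P i x)"
proof (induction I rule: infinite_finite_induct)
  case (insert i I)
  then show ?case by (simp add: polyfam_add)
qed (auto intro!: polyfamI[of _ _ 0] pf_const)

lemma poly_bounded: "degree (p :: 'k::comm_ring_1 poly) \<le> n \<Longrightarrow> poly p x = (\<Sum>i\<le>n. coeff p i * x ^ i)"
  using arg_cong[OF poly_as_sum_of_monoms'[of p n], of "\<lambda>p. poly p x"]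
  by (simp add: poly_sum poly_monom)

text \<open>Singling out one generator turns relations in several functions into univariate ones.
  The polynomial \<open>P\<close> is not unique, since \<open>t\<close> may satisfy relations over
  \<open>C\<close>.\<close>

lemma pf_insert:
  assumes "p \<in> PF (insert t C)"
  obtains P where "polyfam C P" "\<And>x. p x = poly (P x) (t x)"
proof -
  have "\<exists>P. polyfam C P \<and> (\<forall>x. p x = poly (P x) (t x))"
    using assms
  proof induction
    case (const c)
    show ?case
      by (rule exI[of _ "\<lambda>_. [:c:]"]) (auto intro!: polyfam_const pf_const)
  next
    case (coord f)
    show ?case
    proof (cases "f = t")
      case True
      then show ?thesis using polyfam_monom[OF pf_const[of 1], of C 1]
        by (intro exI[of _ "\<lambda>_. monom 1 1"]) (auto simp: poly_monom)
    next
      case False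
      then show ?thesis using coord
        by (intro exI[of _ "\<lambda>x. [:f x:]"]) (auto intro!: polyfam_const pf_coord)
    qed
  next
    case (add p q)
    then obtain P Q where "polyfam C P" "\<forall>x. p x = poly (P x) (t x)"
      "polyfam C Q" "\<forall>x. q x = poly (Q x) (t x)" by blast
    then show ?case by (intro exI[of _ "\<lambda>x. P x + Q x"]) (simp add: polyfam_add)
  next
    case (mult p q)
    then obtain P Q where "polyfam C P" "\<forall>x. p x = poly (P x) (t x)"
      "polyfam C Q" "\<forall>x. q x = poly (Q x) (t x)" by blast
    then show ?case by (intro exI[of _ "\<lambda>x. P x * Q x"]) (simp add: polyfam_mult)
  qed
  then show thesis using that by blast
qed

lemma polyfam_poly:
  assumes "polyfam C P" "t \<in> PF D" "C \<subseteq> PF D"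
  shows "(\<lambda>x. poly (P x) (t x)) \<in> PF D"
proof -
  obtain n where n: "\<And>x. degree (P x) \<le> n" using assms by (auto simp: polyfam_def)
  have "(\<lambda>x. poly (P x) (t x)) = (\<lambda>x. \<Sum>i\<le>n. coeff (P x) i * t x ^ i)"
    using n by (intro ext poly_bounded)
  also have "\<dots> \<in> PF D"
    using assms by (auto intro!: pf_intros pf_hull[OF polyfam_coeff])
  finally show ?thesis .
qed

text \<open>Points of affine \<open>m\<close>-space are arbitrary sequences. Polynomials in
  \<open>vars m\<close> ignore the entries from \<open>m\<close> on (\<open>pf_vars_cong\<close>),
  so tuples of fixed length can be dispensed with.\<close>

definition vars :: "nat \<Rightarrow> ((nat \<Rightarrow> 'k) \<Rightarrow> 'k) set" where
  "vars m = (\<lambda>i x. x i) ` {..<m}"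

lemma vars_Suc: "vars (Suc m) = insert (\<lambda>x. x m) (vars m)"
  by (auto simp: vars_def lessThan_Suc)

lemma pf_vars_compose:
  assumes "P \<in> PF (vars m)" "\<And>i. i < m \<Longrightarrow> f i \<in> PF C"
  shows "(\<lambda>w. P (\<lambda>i. f i w)) \<in> PF C"
  by (rule pf_compose[OF assms(1)]) (auto simp: vars_def assms(2))

lemma pf_vars_var: "i < m \<Longrightarrow> (\<lambda>x. x i) \<in> PF (vars m)"
  by (auto simp: vars_def intro: pf_coord)

lemma pf_vars_mono: "P \<in> PF (vars m) \<Longrightarrow> m \<le> n \<Longrightarrow> P \<in> PF (vars n)"
  by (erule pf_mono) (auto simp: vars_def)

lemma pf_vars_cong:
  assumes "P \<in> PF (vars m)" "\<And>i. i < m \<Longrightarrow> x i = y i"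
  shows "P x = P y"
  using assms by induction (auto simp: vars_def)

text \<open>The polynomial \<open>P\<close> is separated from the functions substituted into it, so
  that it can also be evaluated at points outside the image of \<open>f\<close>.\<close>

lemma pf_lift:
  assumes "p \<in> PF (f ` {..<m})"
  obtains P where "P \<in> PF (vars m)" "\<And>w. p w = P (\<lambda>i. f i w)"
proof -
  have "\<exists>P\<in>PF (vars m). \<forall>w. p w = P (\<lambda>i. f i w)"
    using assms
  proof induction
    case (const c)
    show ?case by (rule bexI[of _ "\<lambda>_. c"]) (auto intro: pf_const)
  next
    case (coord g)
    then show ?case by (auto intro: pf_vars_var intro!: bexI)
  next
    case (add p q)
    then obtain P Q where "P \<in> PF (vars m)" "Q \<in> PF (vars m)"
      "\<forall>w. p w = P (\<lambda>i. f i w)" "\<forall>w. q w = Q (\<lambda>i. f i w)" by blast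
    then show ?case by (intro bexI[of _ "\<lambda>x. P x + Q x"]) (auto intro: pf_add)
  next
    case (mult p q)
    then obtain P Q where "P \<in> PF (vars m)" "Q \<in> PF (vars m)"
      "\<forall>w. p w = P (\<lambda>i. f i w)" "\<forall>w. q w = Q (\<lambda>i. f i w)" by blast
    then show ?case by (intro bexI[of _ "\<lambda>x. P x * Q x"]) (auto intro: pf_mult)
  qed
  then show thesis using that by blast
qed

section \<open>Nonvanishing of polynomials over an infinite field\<close>

lemma infinite_alg_closed: "infinite (UNIV :: 'k::alg_closed_field set)"
proof
  assume fin: "finite (UNIV :: 'k set)"
  let ?p = "(\<Prod>a\<in>(UNIV::'k set). [:-a, 1:]) + 1"
  have deg: "degree (\<Prod>a\<in>(UNIV::'k set). [:-a, 1:]) = card (UNIV :: 'k set)"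
    by (subst degree_prod_eq_sum_degree) auto
  have "card (UNIV :: 'k set) > 0" using fin by (simp add: card_gt_0_iff)
  then have "degree ?p > 0" using deg by (simp add: degree_add_eq_left)
  then obtain x where "poly ?p x = 0" using alg_closed_imp_poly_has_root by blast
  moreover have "poly (\<Prod>a\<in>(UNIV::'k set). [:-a, 1:]) x = 0"
    using fin by (auto simp: poly_prod)
  ultimately show False by simp
qed

lemma pf_on_line:
  fixes p :: "(nat \<Rightarrow> 'k::comm_ring_1) \<Rightarrow> 'k"
  assumes "p \<in> PF (vars m)"
  shows "\<exists>P. \<forall>s. p (\<lambda>i. a i + s * b i) = poly P s"
  using assms
proof induction
  case (const c) show ?case by (rule exI[of _ "[:c:]"]) auto
next
  case (coord f)
  then obtain i where "f = (\<lambda>x. x i)" by (auto simp: vars_def)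
  then show ?case by (intro exI[of _ "[:a i, b i:]"]) auto
next
  case (add p q) then show ?case by (metis poly_add)
next
  case (mult p q) then show ?case by (metis poly_mult)
qed

text \<open>On the line through \<open>a\<close> and \<open>b\<close> both functions become nonzero
  univariate polynomials, which have only finitely many roots in an infinite field.\<close>

lemma pf_vars_domain:
  fixes p q :: "(nat \<Rightarrow> 'k::alg_closed_field) \<Rightarrow> 'k"
  assumes "p \<in> PF (vars m)" "q \<in> PF (vars m)" "p a \<noteq> 0" "q b \<noteq> 0"
  shows "\<exists>x. p x \<noteq> 0 \<and> q x \<noteq> 0"
proof -
  let ?l = "\<lambda>s i. a i + s * (b i - a i)"
  obtain P where P: "\<And>s. p (?l s) = poly P s" using pf_on_line[OF assms(1), of a "\<lambda>i. b i - a i"] by blast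
  obtain Q where Q: "\<And>s. q (?l s) = poly Q s" using pf_on_line[OF assms(2), of a "\<lambda>i. b i - a i"] by blast
  have "P \<noteq> 0" using assms(3) P[of 0] by auto
  moreover have "Q \<noteq> 0" using assms(4) Q[of 1] by auto
  ultimately have "finite {s. poly (P * Q) s = 0}" by (intro poly_roots_finite) auto
  then obtain s where "poly (P * Q) s \<noteq> 0"
    using infinite_alg_closed by (metis (mono_tags, lifting) UNIV_I finite_subset mem_Collect_eq subsetI)
  then have "p (?l s) \<noteq> 0 \<and> q (?l s) \<noteq> 0" using P Q by simp
  then show ?thesis by blast
qed

lemma pf_vars_prod_nonzero:
  fixes p :: "'i \<Rightarrow> (nat \<Rightarrow> 'k::alg_closed_field) \<Rightarrow> 'k"
  assumes "finite I" "\<And>i. i \<in> I \<Longrightarrow> p i \<in> PF (vars m)" "\<And>i. i \<in> I \<Longrightarrow> \<exists>a. p i a \<noteq> 0"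
  shows "\<exists>x. \<forall>i\<in>I. p i x \<noteq> 0"
  using assms
proof (induction I)
  case (insert i I)
  then obtain x where x: "\<forall>j\<in>I. p j x \<noteq> 0" by auto
  obtain a where a: "p i a \<noteq> 0" using insert.prems(2)[of i] by auto
  have "(\<lambda>x. \<Prod>j\<in>I. p j x) \<in> PF (vars m)" using insert by (intro pf_prod) auto
  moreover have "(\<Prod>j\<in>I. p j x) \<noteq> 0" using x insert by auto
  ultimately obtain y where "p i y \<noteq> 0 \<and> (\<Prod>j\<in>I. p j y) \<noteq> 0"
    using pf_vars_domain[of "p i" m "\<lambda>x. \<Prod>j\<in>I. p j x" a x] insert a by auto
  then show ?case using insert.hyps by (auto simp: prod_zero_iff)
qed simp

subsection \<open>Algebraic dependence on an irreducible set\<close>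

text \<open>The functions in \<open>PF C\<close> vanishing on \<open>W\<close> form a prime ideal;
  this is the algebraic form of irreducibility.\<close>

definition irr :: "('x \<Rightarrow> 'k::idom) set \<Rightarrow> 'x set \<Rightarrow> bool" where
  "irr C W \<longleftrightarrow> W \<noteq> {} \<and> (\<forall>p\<in>PF C. \<forall>q\<in>PF C. (\<forall>w\<in>W. p w * q w = 0) \<longrightarrow>
     (\<forall>w\<in>W. p w = 0) \<or> (\<forall>w\<in>W. q w = 0))"

text \<open>Nonzero as an element of the coordinate ring of \<open>W\<close>, which on an
  irreducible set means cancellable.\<close>

definition nz :: "'x set \<Rightarrow> ('x \<Rightarrow> 'k::zero) \<Rightarrow> bool" where
  "nz W f \<longleftrightarrow> (\<exists>w\<in>W. f w \<noteq> 0)"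

lemma irr_nz_mult: "irr C W \<Longrightarrow> p \<in> PF C \<Longrightarrow> q \<in> PF C \<Longrightarrow> nz W p \<Longrightarrow> nz W q \<Longrightarrow> nz W (\<lambda>x. p x * q x)"
  unfolding irr_def nz_def by blast

lemma irr_cancel: "irr C W \<Longrightarrow> p \<in> PF C \<Longrightarrow> q \<in> PF C \<Longrightarrow> nz W p \<Longrightarrow> (\<And>w. w \<in> W \<Longrightarrow> p w * q w = 0)
   \<Longrightarrow> w \<in> W \<Longrightarrow> q w = 0"
  unfolding irr_def nz_def by blast

lemma irr_hull: "irr C W \<Longrightarrow> S \<subseteq> PF C \<Longrightarrow> irr S W"
  unfolding irr_def using pf_hull by blast

lemma irr_nonempty: "irr C W \<Longrightarrow> W \<noteq> {}"
  by (simp add: irr_def)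

lemma nz_one: "irr C W \<Longrightarrow> nz W (\<lambda>_. 1 :: 'k::idom)"
  by (auto simp: irr_def nz_def)

lemma irr_nz_power: "irr C W \<Longrightarrow> p \<in> PF C \<Longrightarrow> nz W p \<Longrightarrow> nz W (\<lambda>x. p x ^ n)"
  by (induction n) (auto intro: irr_nz_mult pf_power nz_one)

text \<open>Fraction-free Gaussian elimination, with unknowns indexed by \<open>I\<close> and equations by \<open>J\<close>.\<close>

lemma linear_system_dependent:
  fixes a :: "'i \<Rightarrow> 'j \<Rightarrow> 'x \<Rightarrow> 'k::idom"
  assumes "irr S W" "finite J" "finite I" "card J < card I"
    "\<And>i j. i \<in> I \<Longrightarrow> j \<in> J \<Longrightarrow> a i j \<in> PF S"
  shows "\<exists>r. (\<forall>i\<in>I. r i \<in> PF S) \<and> (\<exists>i\<in>I. nz W (r i)) \<and>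
    (\<forall>j\<in>J. \<forall>w\<in>W. (\<Sum>i\<in>I. r i w * a i j w) = 0)"
  using assms(2-)
proof (induction J arbitrary: I a rule: finite_induct)
  case empty
  then have "I \<noteq> {}" by auto
  then show ?case using nz_one[OF assms(1)]
    by (intro exI[of _ "\<lambda>_ _. 1"]) (auto intro: pf_const)
next
  case (insert k J)
  show ?case
  proof (cases "\<exists>p\<in>I. nz W (a p k)")
    case False
    have "card J < card I" using insert by simp
    then obtain r where r: "\<forall>i\<in>I. r i \<in> PF S" "\<exists>i\<in>I. nz W (r i)"
      "\<forall>j\<in>J. \<forall>w\<in>W. (\<Sum>i\<in>I. r i w * a i j w) = 0"
      using insert.IH[of I a] insert.prems by auto
    moreover have "(\<Sum>i\<in>I. r i w * a i k w) = 0" if "w \<in> W" for w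
      using False that by (intro sum.neutral) (auto simp: nz_def)
    ultimately show ?thesis by auto
  next
    case True
    then obtain p where p: "p \<in> I" "nz W (a p k)" by blast
    let ?I = "I - {p}"
    let ?b = "\<lambda>i j w. a p k w * a i j w - a i k w * a p j w"
    have "card J < card ?I" using insert p by auto
    moreover have "?b i j \<in> PF S" if "i \<in> ?I" "j \<in> J" for i j
      using that insert.prems p by (auto intro!: pf_intros)
    ultimately obtain r where r: "\<forall>i\<in>?I. r i \<in> PF S" "\<exists>i\<in>?I. nz W (r i)"
      "\<forall>j\<in>J. \<forall>w\<in>W. (\<Sum>i\<in>?I. r i w * ?b i j w) = 0"
      using insert.IH[of ?I ?b] insert.prems(1) by auto
    \<comment> \<open>Back substitution without division: a solution of the reduced system is
      multiplied by the pivot \<open>a p k\<close>, and the value for the unknown \<open>p\<close>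
      is read off from equation \<open>k\<close>.\<close>
    define r' where "r' = (\<lambda>i. if i = p then (\<lambda>w. - (\<Sum>i\<in>?I. r i w * a i k w))
       else (\<lambda>w. a p k w * r i w))"
    have s: "(\<Sum>i\<in>I. r' i w * a i j w) = (\<Sum>i\<in>?I. r i w * ?b i j w)" for j w
      using insert.prems(1) p(1)
      by (subst sum.remove[of _ p])
         (auto simp: r'_def algebra_simps sum_distrib_left sum_distrib_right sum_subtractf)
    have "r' i \<in> PF S" if "i \<in> I" for i
      using that r(1) insert.prems p by (auto simp: r'_def intro!: pf_intros)
    moreover have "\<exists>i\<in>I. nz W (r' i)"
    proof -
      obtain i where i: "i \<in> ?I" "nz W (r i)" using r by blast
      then have "nz W (\<lambda>w. a p k w * r i w)"
        using irr_nz_mult[OF assms(1)] p r(1) insert.prems by auto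
      then show ?thesis using i by (intro bexI[of _ i]) (auto simp: r'_def)
    qed
    moreover have "(\<Sum>i\<in>I. r' i w * a i j w) = 0" if "j \<in> insert k J" "w \<in> W" for j w
      unfolding s using r(3) that by (auto simp: algebra_simps)
    ultimately show ?thesis by blast
  qed
qed

text \<open>Algebraic over the fraction field of \<open>PF S\<close> on \<open>W\<close>, with
  denominators cleared. The polynomial has to be nonzero only at one point of \<open>W\<close>,
  since this makes it nonzero over the coordinate ring.\<close>

definition alg :: "'x set \<Rightarrow> ('x \<Rightarrow> 'k::idom) set \<Rightarrow> ('x \<Rightarrow> 'k) \<Rightarrow> bool" where
  "alg W S g \<longleftrightarrow> (\<exists>P. polyfam S P \<and> (\<exists>w\<in>W. P w \<noteq> 0) \<and> (\<forall>w\<in>W. poly (P w) (g w) = 0))"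

text \<open>Here \<open>n\<close> is the degree over the coordinate ring of \<open>W\<close>; at
  points where the leading coefficient vanishes, the degree is smaller.\<close>

lemma polyfam_leading:
  assumes "polyfam S P" "\<exists>w\<in>W. P w \<noteq> 0"
  obtains n where "nz W (\<lambda>w. coeff (P w) n)" "\<And>w. w \<in> W \<Longrightarrow> degree (P w) \<le> n"
proof -
  obtain b where b: "\<And>x. degree (P x) \<le> b" using assms by (auto simp: polyfam_def)
  let ?Q = "\<lambda>n. nz W (\<lambda>w. coeff (P w) n)"
  have bd: "n \<le> b" if "?Q n" for n
    using that b unfolding nz_def by (meson le_degree le_trans)
  have ex: "\<exists>n. ?Q n" using assms(2) by (auto simp: nz_def poly_eq_iff)
  then have "?Q (Greatest ?Q)" using bd by (auto intro!: GreatestI_ex_nat[of ?Q b])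
  moreover have "degree (P w) \<le> Greatest ?Q" if "w \<in> W" for w
  proof (rule degree_le, intro allI impI)
    fix i assume "Greatest ?Q < i"
    then have "\<not> ?Q i" using bd Greatest_le_nat[of ?Q i b] by auto
    then show "coeff (P w) i = 0" using that by (auto simp: nz_def)
  qed
  ultimately show thesis using that by blast
qed

text \<open>Membership in the span of the \<open>e j\<close> over the fraction field of \<open>PF S\<close>, restricted to \<open>W\<close>.\<close>

definition tspan :: "'x set \<Rightarrow> ('x \<Rightarrow> 'k::idom) set \<Rightarrow> 'j set \<Rightarrow> ('j \<Rightarrow> 'x \<Rightarrow> 'k) \<Rightarrow> ('x \<Rightarrow> 'k) \<Rightarrow> bool" where
  "tspan W S J e u \<longleftrightarrow> (\<exists>r\<in>PF S. nz W r \<and> (\<exists>a. (\<forall>j\<in>J. a j \<in> PF S) \<and>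
      (\<forall>w\<in>W. r w * u w = (\<Sum>j\<in>J. a j w * e j w))))"

lemma tspan_base:
  assumes "irr S W" "finite J" "j \<in> J"
  shows "tspan W S J e (e j)"
  unfolding tspan_def
proof (intro bexI[of _ "\<lambda>_. 1"] conjI exI[of _ "\<lambda>i _. if i = j then 1 else 0"] ballI)
  show "1 * e j w = (\<Sum>ja\<in>J. (if ja = j then 1 else 0) * e ja w)" for w
    using assms by (subst sum.remove[of _ j]) auto
qed (auto intro: pf_const nz_one[OF assms(1)])

lemma tspan_add:
  assumes "irr S W" "tspan W S J e u" "tspan W S J e v"
  shows "tspan W S J e (\<lambda>x. u x + v x)"
proof -
  obtain r a where r: "r \<in> PF S" "nz W r" "\<forall>j\<in>J. a j \<in> PF S"
    "\<forall>w\<in>W. r w * u w = (\<Sum>j\<in>J. a j w * e j w)" using assms(2) unfolding tspan_def by blast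
  obtain s b where s: "s \<in> PF S" "nz W s" "\<forall>j\<in>J. b j \<in> PF S"
    "\<forall>w\<in>W. s w * v w = (\<Sum>j\<in>J. b j w * e j w)" using assms(3) unfolding tspan_def by blast
  show ?thesis unfolding tspan_def
  proof (intro bexI[of _ "\<lambda>x. r x * s x"] conjI exI[of _ "\<lambda>j w. s w * a j w + r w * b j w"] ballI)
    show "r w * s w * (u w + v w) = (\<Sum>j\<in>J. (s w * a j w + r w * b j w) * e j w)" if "w \<in> W" for w
    proof -
      have "r w * s w * (u w + v w) = s w * (r w * u w) + r w * (s w * v w)" by (simp add: algebra_simps)
      also have "\<dots> = (\<Sum>j\<in>J. (s w * a j w + r w * b j w) * e j w)"
        using that r s by (simp add: sum_distrib_left sum.distrib algebra_simps)
      finally show ?thesis .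
    qed
  qed (use r s in \<open>auto intro!: pf_intros irr_nz_mult[OF assms(1)]\<close>)
qed

lemma tspan_scale:
  assumes "tspan W S J e u" "p \<in> PF S"
  shows "tspan W S J e (\<lambda>x. p x * u x)"
proof -
  obtain r a where r: "r \<in> PF S" "nz W r" "\<forall>j\<in>J. a j \<in> PF S"
    "\<forall>w\<in>W. r w * u w = (\<Sum>j\<in>J. a j w * e j w)" using assms unfolding tspan_def by blast
  show ?thesis unfolding tspan_def
  proof (intro bexI[of _ r] conjI exI[of _ "\<lambda>j w. p w * a j w"] ballI)
    show "r w * (p w * u w) = (\<Sum>j\<in>J. p w * a j w * e j w)" if "w \<in> W" for w
    proof -
      have "r w * (p w * u w) = p w * (r w * u w)" by simp
      then show ?thesis using that r by (simp add: sum_distrib_left mult.assoc)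
    qed
  qed (use r assms in \<open>auto intro!: pf_intros\<close>)
qed

lemma tspan_zero: "irr S W \<Longrightarrow> tspan W S J e (\<lambda>_. 0)"
  unfolding tspan_def
  by (intro bexI[of _ "\<lambda>_. 1"] conjI exI[of _ "\<lambda>_ _. 0"]) (auto intro: pf_const nz_one)

lemma tspan_sum:
  assumes "irr S W" "\<And>i. i \<in> I \<Longrightarrow> tspan W S J e (u i)"
  shows "tspan W S J e (\<lambda>x. \<Sum>i\<in>I. u i x)"
  using assms(2) by (induction I rule: infinite_finite_induct)
    (auto intro: tspan_zero[OF assms(1)] tspan_add[OF assms(1)])

lemma tspan_cong: "tspan W S J e u \<Longrightarrow> (\<And>w. w \<in> W \<Longrightarrow> u w = v w) \<Longrightarrow> tspan W S J e v"
  unfolding tspan_def by simp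

lemma tspan_divide:
  assumes "irr S W" "r \<in> PF S" "nz W r" "tspan W S J e (\<lambda>x. r x * u x)"
  shows "tspan W S J e u"
proof -
  obtain s a where s: "s \<in> PF S" "nz W s" "\<forall>j\<in>J. a j \<in> PF S"
    "\<forall>w\<in>W. s w * (r w * u w) = (\<Sum>j\<in>J. a j w * e j w)" using assms unfolding tspan_def by blast
  show ?thesis unfolding tspan_def
    by (intro bexI[of _ "\<lambda>x. s x * r x"] conjI exI[of _ a] ballI)
       (use s assms in \<open>auto intro!: pf_intros irr_nz_mult[OF assms(1)] simp: mult.assoc\<close>)
qed

lemma choice2: "\<forall>x. \<exists>y z. Q x y z \<Longrightarrow> \<exists>f g. \<forall>x. Q x (f x) (g x)"
  by metis

text \<open>With both spans equal, stability of a finite spanning family under multiplication by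
  \<open>g\<close> passes to its whole span, which controls all powers of \<open>g\<close> by
  induction.\<close>

lemma tspan_map:
  assumes "irr S W" "tspan W S J e u" "\<And>j. j \<in> J \<Longrightarrow> tspan W S I f (\<lambda>x. e j x * g x)"
  shows "tspan W S I f (\<lambda>x. u x * g x)"
proof -
  obtain r a where r: "r \<in> PF S" "nz W r" "\<forall>j\<in>J. a j \<in> PF S"
    "\<forall>w\<in>W. r w * u w = (\<Sum>j\<in>J. a j w * e j w)" using assms(2) unfolding tspan_def by blast
  have "tspan W S I f (\<lambda>x. \<Sum>j\<in>J. a j x * (e j x * g x))"
    using r assms by (intro tspan_sum tspan_scale[of _ _ _ _ "\<lambda>x. e _ x * g x"]) auto
  then have "tspan W S I f (\<lambda>x. r x * (u x * g x))"
  proof (rule tspan_cong)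
    fix w assume w: "w \<in> W"
    have "(\<Sum>j\<in>J. a j w * (e j w * g w)) = (\<Sum>j\<in>J. a j w * e j w) * g w"
      by (simp add: sum_distrib_right mult.assoc)
    then show "(\<Sum>j\<in>J. a j w * (e j w * g w)) = r w * (u w * g w)"
      using r(4) w by (metis mult.assoc)
  qed
  then show ?thesis using tspan_divide[OF assms(1) r(1,2), of I f "\<lambda>x. u x * g x"] by blast
qed

text \<open>The indices \<open>0, ..., card J\<close> are one more than the spanning functions, so
  their coefficients give a homogeneous system with more unknowns than equations. The denominators
  \<open>s i\<close> are absorbed into the solution.\<close>

lemma tspan_dependent:
  fixes u :: "nat \<Rightarrow> 'x \<Rightarrow> 'k::idom"
  assumes "irr S W" "finite J" "\<And>i. i \<le> card J \<Longrightarrow> tspan W S J e (u i)"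
  shows "\<exists>r. (\<forall>i\<le>card J. r i \<in> PF S) \<and> (\<exists>i\<le>card J. nz W (r i)) \<and>
     (\<forall>w\<in>W. (\<Sum>i\<le>card J. r i w * u i w) = 0)"
proof -
  have "\<forall>i. \<exists>s a. i \<le> card J \<longrightarrow> s \<in> PF S \<and> nz W s \<and> (\<forall>j\<in>J. a j \<in> PF S) \<and>
      (\<forall>w\<in>W. s w * u i w = (\<Sum>j\<in>J. a j w * e j w))"
    using assms(3) unfolding tspan_def by blast
  then obtain s a where sa: "\<forall>i. i \<le> card J \<longrightarrow> s i \<in> PF S \<and> nz W (s i) \<and> (\<forall>j\<in>J. a i j \<in> PF S) \<and>
      (\<forall>w\<in>W. s i w * u i w = (\<Sum>j\<in>J. a i j w * e j w))"
    using choice2[of "\<lambda>i s a. i \<le> card J \<longrightarrow> s \<in> PF S \<and> nz W s \<and> (\<forall>j\<in>J. a j \<in> PF S) \<and>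
      (\<forall>w\<in>W. s w * u i w = (\<Sum>j\<in>J. a j w * e j w))"] by blast
  obtain r where r: "\<forall>i\<in>{..card J}. r i \<in> PF S" "\<exists>i\<in>{..card J}. nz W (r i)"
    "\<forall>j\<in>J. \<forall>w\<in>W. (\<Sum>i\<in>{..card J}. r i w * a i j w) = 0"
    using linear_system_dependent[OF assms(1,2), of "{..card J}" a] sa by auto
  show ?thesis
  proof (intro exI[of _ "\<lambda>i w. r i w * s i w"] conjI ballI)
    show "\<forall>i\<le>card J. (\<lambda>w. r i w * s i w) \<in> PF S" using r sa by (auto intro: pf_mult)
    show "\<exists>i\<le>card J. nz W (\<lambda>w. r i w * s i w)"
      using r(1,2) sa irr_nz_mult[OF assms(1)] by (metis atMost_iff)
    fix w assume w: "w \<in> W"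
    have "(\<Sum>i\<le>card J. r i w * s i w * u i w) = (\<Sum>i\<le>card J. \<Sum>j\<in>J. r i w * a i j w * e j w)"
      using sa w by (intro sum.cong) (auto simp: sum_distrib_left mult.assoc)
    also have "\<dots> = (\<Sum>j\<in>J. (\<Sum>i\<le>card J. r i w * a i j w) * e j w)"
      by (subst sum.swap) (simp add: sum_distrib_right)
    also have "\<dots> = 0" using r(3) w by auto
    finally show "(\<Sum>i\<le>card J. r i w * s i w * u i w) = 0" .
  qed
qed

text \<open>A linear dependence among the powers of \<open>g\<close> is a polynomial relation for
  \<open>g\<close>.\<close>

lemma alg_of_powers_tspan:
  assumes "irr S W" "finite J" "\<And>i. tspan W S J e (\<lambda>x. g x ^ i)"
  shows "alg W S g"
proof -
  obtain r where r: "\<forall>i\<le>card J. r i \<in> PF S" "\<exists>i\<le>card J. nz W (r i)"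
     "\<forall>w\<in>W. (\<Sum>i\<le>card J. r i w * g w ^ i) = 0"
    using tspan_dependent[OF assms(1,2), of e "\<lambda>i x. g x ^ i"] assms(3) by blast
  let ?P = "\<lambda>x. \<Sum>i\<le>card J. monom (r i x) i"
  have c: "coeff (?P x) i = (if i \<le> card J then r i x else 0)" for x i
    by (auto simp: coeff_sum)
  have "polyfam S ?P" using r by (intro polyfam_sum polyfam_monom) auto
  moreover have "\<exists>w\<in>W. ?P w \<noteq> 0"
    using r(2) c unfolding nz_def by (metis coeff_0)
  moreover have "poly (?P w) (g w) = 0" if "w \<in> W" for w
    using r(3) that by (simp add: poly_sum poly_monom)
  ultimately show ?thesis unfolding alg_def by blast
qed

lemma alg_leading:
  assumes "alg W S c"
  obtains n P where "polyfam S P" "nz W (\<lambda>w. coeff (P w) n)" "n > 0"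
    "\<And>w. w \<in> W \<Longrightarrow> degree (P w) \<le> n" "\<And>w. w \<in> W \<Longrightarrow> poly (P w) (c w) = 0"
    "\<And>w. w \<in> W \<Longrightarrow> coeff (P w) n * c w ^ n = (\<Sum>i<n. - coeff (P w) i * c w ^ i)"
proof -
  obtain P where P: "polyfam S P" "\<exists>w\<in>W. P w \<noteq> 0" "\<forall>w\<in>W. poly (P w) (c w) = 0"
    using assms unfolding alg_def by blast
  obtain n where n: "nz W (\<lambda>w. coeff (P w) n)" "\<And>w. w \<in> W \<Longrightarrow> degree (P w) \<le> n"
    using polyfam_leading[OF P(1,2)] by blast
  have eq: "(\<Sum>i\<le>n. coeff (P w) i * c w ^ i) = 0" if "w \<in> W" for w
    using P(3) that poly_bounded[OF n(2)[OF that], of "c w"] by simp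
  have "n > 0"
  proof (rule ccontr)
    assume "\<not> n > 0" then have "n = 0" by simp
    then show False using n(1) eq by (auto simp: nz_def)
  qed
  moreover have "coeff (P w) n * c w ^ n = (\<Sum>i<n. - coeff (P w) i * c w ^ i)" if "w \<in> W" for w
    using eq[OF that] by (simp add: lessThan_Suc_atMost[symmetric] sum_negf eq_neg_iff_add_eq_0 add.commute)
  ultimately show thesis using that[of P n] P n by blast
qed

text \<open>Adjoining an algebraic function gives a finite extension: the relation of degree
  \<open>n\<close> rewrites \<open>c ^ n\<close>, up to a denominator, through lower powers.\<close>

lemma alg_tspan_powers:
  assumes irr: "irr S W" and c: "alg W S c"
  obtains n where "\<And>p. p \<in> PF (insert c S) \<Longrightarrow> tspan W S {..<n::nat} (\<lambda>i x. c x ^ i) p"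
proof -
  obtain n P where P: "polyfam S P" "nz W (\<lambda>w. coeff (P w) n)" "n > 0"
    "\<And>w. w \<in> W \<Longrightarrow> degree (P w) \<le> n" "\<And>w. w \<in> W \<Longrightarrow> poly (P w) (c w) = 0"
    "\<And>w. w \<in> W \<Longrightarrow> coeff (P w) n * c w ^ n = (\<Sum>i<n. - coeff (P w) i * c w ^ i)"
    by (rule alg_leading[OF c]) (rule that, assumption+)
  let ?T = "tspan W S {..<n} (\<lambda>i x. c x ^ i)"
  have top: "?T (\<lambda>x. c x ^ n)"
  proof (rule tspan_divide[OF irr _ P(2)])
    show "(\<lambda>w. coeff (P w) n) \<in> PF S" using P(1) by (rule polyfam_coeff)
    have "?T (\<lambda>w. \<Sum>i<n. - coeff (P w) i * c w ^ i)"
      using P(1) by (intro tspan_sum irr tspan_scale tspan_base[OF irr, of "{..<n}" _ "\<lambda>i x. c x ^ i"])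
        (auto intro!: pf_uminus polyfam_coeff)
    then show "?T (\<lambda>x. coeff (P x) n * c x ^ n)"
      by (rule tspan_cong) (simp add: P(6))
  qed
  have pw: "?T (\<lambda>x. c x ^ N)" for N
  proof (induction N)
    case 0
    show ?case using tspan_base[OF irr, of "{..<n}" 0 "\<lambda>i x. c x ^ i"] P(3) by simp
  next
    case (Suc N)
    have "?T (\<lambda>x. c x ^ i * c x)" if "i < n" for i
      using top tspan_base[OF irr, of "{..<n}" "Suc i" "\<lambda>i x. c x ^ i"] that
      by (cases "Suc i = n") (auto simp: mult.commute)
    then have "?T (\<lambda>x. c x ^ N * c x)" by (intro tspan_map[OF irr Suc]) auto
    then show ?case by (simp add: mult.commute)
  qed
  have "?T p" if p: "p \<in> PF (insert c S)" for p
  proof -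
    obtain Q where Q: "polyfam S Q" "\<And>x. p x = poly (Q x) (c x)" by (rule pf_insert[OF p]) (rule that, assumption+)
    obtain b where b: "\<And>x. degree (Q x) \<le> b" using Q by (auto simp: polyfam_def)
    have "p = (\<lambda>x. \<Sum>i\<le>b. coeff (Q x) i * c x ^ i)"
      using Q(2) b by (auto simp: poly_bounded)
    moreover have "?T \<dots>" using Q(1) by (intro tspan_sum irr tspan_scale pw) (rule polyfam_coeff)
    ultimately show ?thesis by simp
  qed
  then show thesis using that by blast
qed

text \<open>In a relation for \<open>p\<close> the lowest nonzero coefficient is divisible by
  \<open>p\<close> once powers of \<open>p\<close> have been cancelled, and that coefficient lies in
  \<open>PF S\<close>. This replaces inverting an algebraic element.\<close>

lemma alg_multiple:
  assumes irr: "irr (insert c S) W" and c: "alg W S c" and p: "p \<in> PF (insert c S)" "nz W p"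
  obtains q r where "q \<in> PF (insert c S)" "r \<in> PF S" "nz W r" "\<And>w. w \<in> W \<Longrightarrow> q w * p w = r w"
proof -
  have irrS: "irr S W" using irr by (rule irr_hull) (auto intro: pf_coord)
  obtain n where n: "\<And>p. p \<in> PF (insert c S) \<Longrightarrow> tspan W S {..<n} (\<lambda>i x. c x ^ i) p"
    by (rule alg_tspan_powers[OF irrS c]) (rule that, assumption+)
  have "alg W S p"
    using alg_of_powers_tspan[OF irrS, of "{..<n}" "\<lambda>i x. c x ^ i" p] n p pf_power by blast
  then obtain P where P: "polyfam S P" "\<exists>w\<in>W. P w \<noteq> 0" "\<forall>w\<in>W. poly (P w) (p w) = 0"
    unfolding alg_def by blast
  \<comment> \<open>The coefficients below \<open>k\<close> vanish on all of \<open>W\<close>, so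
    the relation is \<open>p ^ k\<close> times a relation whose constant term is nonzero on
    \<open>W\<close>.\<close>
  define k where "k = (LEAST k. nz W (\<lambda>w. coeff (P w) k))"
  have "\<exists>k. nz W (\<lambda>w. coeff (P w) k)" using P(2) by (auto simp: nz_def poly_eq_iff)
  then have k: "nz W (\<lambda>w. coeff (P w) k)" unfolding k_def by (rule LeastI_ex)
  have k0: "coeff (P w) i = 0" if "w \<in> W" "i < k" for w i
    using not_less_Least[of i] that unfolding k_def nz_def by blast
  define Q where "Q = (\<lambda>x. poly_shift (Suc k) (P x))"
  have fQ: "polyfam S Q"
  proof -
    obtain b where b: "\<And>x. degree (P x) \<le> b" using polyfam_degree[OF P(1)] by metis
    have "degree (Q x) \<le> b" for x
    proof (rule degree_le, intro allI impI)
      fix i assume "b < i"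
      then have "degree (P x) < i + Suc k" using b[of x] by simp
      then show "coeff (Q x) i = 0" by (simp add: Q_def coeff_poly_shift coeff_eq_0)
    qed
    then show ?thesis using P(1) by (intro polyfamI) (auto simp: Q_def coeff_poly_shift intro: polyfam_coeff)
  qed
  have dec: "poly (P w) y = y ^ k * (coeff (P w) k + y * poly (Q w) y)" if "w \<in> W" for w y
  proof -
    have "P w = monom 1 k * (pCons (coeff (P w) k) (Q w))"
      by (rule poly_eqI)
        (auto simp: coeff_monom_mult coeff_pCons Q_def coeff_poly_shift k0[OF that] split: nat.split)
    then show ?thesis by (metis poly_monom poly_mult poly_pCons mult_1)
  qed
  let ?q = "\<lambda>x. - poly (Q x) (p x)"
  have q: "?q \<in> PF (insert c S)"
    by (intro pf_uminus polyfam_poly[OF fQ p(1)]) (auto intro: pf_coord)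
  have z: "coeff (P w) k + p w * poly (Q w) (p w) = 0" if w: "w \<in> W" for w
  proof (rule irr_cancel[OF irr _ _ irr_nz_power[OF irr p] _ w])
    show "(\<lambda>x. p x ^ k) \<in> PF (insert c S)" using p(1) by (rule pf_power)
    show "(\<lambda>w. coeff (P w) k + p w * poly (Q w) (p w)) \<in> PF (insert c S)"
      using pf_uminus[OF q] by (auto intro!: pf_add pf_mult p pf_mono[OF polyfam_coeff[OF P(1)]])
    show "p w ^ k * (coeff (P w) k + p w * poly (Q w) (p w)) = 0" if "w \<in> W" for w
      using dec[OF that] P(3) that by metis
  qed
  show thesis
  proof (rule that[OF q polyfam_coeff[OF P(1), of k] k])
    show "?q w * p w = coeff (P w) k" if "w \<in> W" for w
      using z[OF that] by (simp add: add_eq_0_iff mult.commute)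
  qed
qed

text \<open>As in a tower of finite extensions, the products \<open>c ^ i * g ^ j\<close> span. The
  leading coefficient of the relation for \<open>g\<close> involves \<open>c\<close>;
  \<open>alg_multiple\<close> turns it into an admissible denominator in
  \<open>PF S\<close>.\<close>

lemma alg_trans:
  assumes irr: "irr (insert g (insert c S)) W" and c: "alg W S c" and g: "alg W (insert c S) g"
  shows "alg W S g"
proof -
  have irrc: "irr (insert c S) W" using irr by (rule irr_hull) (auto intro: pf_coord)
  have irrS: "irr S W" using irr by (rule irr_hull) (auto intro: pf_coord)
  obtain n where n: "\<And>p. p \<in> PF (insert c S) \<Longrightarrow> tspan W S {..<n} (\<lambda>i x. c x ^ i) p"
    by (rule alg_tspan_powers[OF irrS c]) (rule that, assumption+)
  obtain m P where P: "polyfam (insert c S) P" "nz W (\<lambda>w. coeff (P w) m)" "m > 0"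
    "\<And>w. w \<in> W \<Longrightarrow> degree (P w) \<le> m" "\<And>w. w \<in> W \<Longrightarrow> poly (P w) (g w) = 0"
    "\<And>w. w \<in> W \<Longrightarrow> coeff (P w) m * g w ^ m = (\<Sum>i<m. - coeff (P w) i * g w ^ i)"
    by (rule alg_leading[OF g]) (rule that, assumption+)
  obtain q r where qr: "q \<in> PF (insert c S)" "r \<in> PF S" "nz W r"
    "\<And>w. w \<in> W \<Longrightarrow> q w * coeff (P w) m = r w"
    by (rule alg_multiple[OF irrc c polyfam_coeff[OF P(1)] P(2)]) (rule that, assumption+)
  let ?J = "{..<n} \<times> {..<m}"
  let ?e = "\<lambda>(i, j) x. c x ^ i * g x ^ j"
  let ?T = "tspan W S ?J ?e"
  have low: "?T (\<lambda>x. p x * g x ^ j)" if "p \<in> PF (insert c S)" "j < m" for p j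
    using tspan_base[OF irrS, of ?J "(_, j)" ?e] that(2)
    by (intro tspan_map[OF irrS n[OF that(1)]]) auto
  have top: "?T (\<lambda>x. p x * g x ^ m)" if p: "p \<in> PF (insert c S)" for p
  proof (rule tspan_divide[OF irrS qr(2,3)])
    have "?T (\<lambda>x. \<Sum>i<m. (p x * q x * - coeff (P x) i) * g x ^ i)"
      by (intro tspan_sum irrS low) (auto intro!: pf_intros p qr polyfam_coeff[OF P(1)])
    then show "?T (\<lambda>x. r x * (p x * g x ^ m))"
    proof (rule tspan_cong)
      fix w assume w: "w \<in> W"
      have "r w * (p w * g w ^ m) = p w * q w * (coeff (P w) m * g w ^ m)"
        using qr(4)[OF w, symmetric] by simp
      then show "(\<Sum>i<m. (p w * q w * - coeff (P w) i) * g w ^ i) = r w * (p w * g w ^ m)"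
        by (simp only: P(6)[OF w]) (simp add: sum_distrib_left mult.assoc)
    qed
  qed
  have "?T (\<lambda>x. g x ^ N)" for N
  proof (induction N)
    case 0
    show ?case using low[OF pf_const[of 1] P(3)] by simp
  next
    case (Suc N)
    have "?T (\<lambda>x. ?e j x * g x)" if jJ: "j \<in> ?J" for j
    proof -
      obtain i k where j: "j = (i, k)" "i < n" "k < m" using jJ by auto
      have "(\<lambda>x. c x ^ i) \<in> PF (insert c S)" by (auto intro: pf_power pf_coord)
      then have "?T (\<lambda>x. c x ^ i * g x ^ Suc k)"
        using low[of "\<lambda>x. c x ^ i" "Suc k"] top[of "\<lambda>x. c x ^ i"] j
        by (cases "Suc k = m") auto
      then show ?thesis by (simp add: j algebra_simps)
    qed
    from tspan_map[OF irrS Suc this] show ?case by (simp add: mult.commute)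
  qed
  then show ?thesis by (intro alg_of_powers_tspan[OF irrS, of ?J ?e]) auto
qed

lemma polyfam_hull: "polyfam S P \<Longrightarrow> S \<subseteq> PF S' \<Longrightarrow> polyfam S' P"
  unfolding polyfam_def using pf_hull by blast

lemma alg_hull: "alg W S g \<Longrightarrow> S \<subseteq> PF S' \<Longrightarrow> alg W S' g"
  unfolding alg_def using polyfam_hull by blast

lemma alg_mono: "alg W S g \<Longrightarrow> S \<subseteq> S' \<Longrightarrow> alg W S' g"
  by (erule alg_hull) (auto intro: pf_coord)

lemma alg_self:
  assumes "W \<noteq> {}" "g \<in> PF S"
  shows "alg W S g"
  unfolding alg_def
proof (intro exI[of _ "\<lambda>x. [:- g x:] + monom 1 1"] conjI ballI)
  show "polyfam S (\<lambda>x. [:- g x:] + monom 1 1)"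
    using assms by (intro polyfam_add polyfam_const polyfam_monom pf_uminus pf_const)
  show "\<exists>w\<in>W. [:- g w:] + monom 1 1 \<noteq> 0"
    using assms by (auto simp: monom_altdef)
qed (auto simp: poly_monom)

text \<open>A relation for \<open>f\<close> over \<open>b\<close> and \<open>S\<close> is a
  polynomial in both \<open>f\<close> and \<open>b\<close>, and can be read as a relation for
  \<open>b\<close>.\<close>

lemma alg_exchange:
  assumes W: "alg W (insert b S) f" "\<not> alg W S f"
  shows "alg W (insert f S) b"
proof -
  obtain P w0 where P: "polyfam (insert b S) P" "w0 \<in> W" "P w0 \<noteq> 0" "\<forall>w\<in>W. poly (P w) (f w) = 0"
    using W(1) unfolding alg_def by blast
  obtain n where n: "\<And>x. degree (P x) \<le> n" using polyfam_degree[OF P(1)] by blast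
  have "\<forall>i. \<exists>A. polyfam S A \<and> (\<forall>x. coeff (P x) i = poly (A x) (b x))"
  proof
    fix i show "\<exists>A. polyfam S A \<and> (\<forall>x. coeff (P x) i = poly (A x) (b x))"
      by (rule pf_insert[OF polyfam_coeff[OF P(1), of i]]) blast
  qed
  then obtain A where A: "\<And>i. polyfam S (A i)" "\<And>i x. coeff (P x) i = poly (A i x) (b x)"
    by metis
  obtain i0 where i0: "coeff (P w0) i0 \<noteq> 0" using P(3) by (auto simp: poly_eq_iff)
  then have i0n: "i0 \<le> n" using n by (meson le_degree le_trans)
  obtain l where l: "coeff (A i0 w0) l \<noteq> 0" using i0 A(2) by (metis leading_coeff_0_iff poly_0)
  \<comment> \<open>\<open>Q\<close> is the relation reordered by powers of \<open>b\<close>, and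
    \<open>R\<close> is its coefficient of \<open>b ^ l\<close> as a polynomial in \<open>f\<close>.
    Since some coefficient of \<open>R\<close> is nonzero and \<open>f\<close> is not algebraic over
    \<open>S\<close>, \<open>R\<close> does not vanish identically at \<open>f\<close>; hence
    \<open>Q\<close> is not zero.\<close>
  define Q where "Q = (\<lambda>x. \<Sum>i\<le>n. [:f x ^ i:] * A i x)"
  define R where "R = (\<lambda>x. \<Sum>i\<le>n. monom (coeff (A i x) l) i)"
  have "polyfam (insert f S) Q" unfolding Q_def
    by (intro polyfam_sum polyfam_mult polyfam_const pf_power polyfam_hull[OF A(1)])
       (auto intro: pf_coord)
  moreover have "poly (Q w) (b w) = 0" if "w \<in> W" for w
  proof -
    have "poly (Q w) (b w) = (\<Sum>i\<le>n. coeff (P w) i * f w ^ i)"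
      by (simp add: Q_def poly_sum A(2) mult.commute)
    then show ?thesis using P(4) that poly_bounded[OF n, of w "f w"] by simp
  qed
  moreover have "\<exists>w\<in>W. Q w \<noteq> 0"
  proof -
    have "polyfam S R" unfolding R_def by (intro polyfam_sum polyfam_monom polyfam_coeff A)
    moreover have "coeff (R w0) i0 \<noteq> 0" using i0n l by (simp add: R_def coeff_sum)
    then have "R w0 \<noteq> 0" by auto
    ultimately obtain w where w: "w \<in> W" "poly (R w) (f w) \<noteq> 0"
      using W(2) P(2) unfolding alg_def by blast
    have "poly (R w) (f w) = coeff (Q w) l"
      by (simp add: R_def Q_def poly_sum poly_monom coeff_sum mult.commute)
    then show ?thesis using w by (intro bexI[of _ w]) auto
  qed
  ultimately show ?thesis unfolding alg_def by blast
qed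

lemma alg_trans': "irr C W \<Longrightarrow> S \<subseteq> PF C \<Longrightarrow> c \<in> PF C \<Longrightarrow> g \<in> PF C \<Longrightarrow> alg W S c
    \<Longrightarrow> alg W (insert c S) g \<Longrightarrow> alg W S g"
  by (rule alg_trans[of g c S W]) (auto intro: irr_hull)

lemma alg_trans_finite:
  assumes "irr C W" "finite T" "T \<subseteq> PF C" "B \<subseteq> PF C" "g \<in> PF C"
    "\<And>t. t \<in> T \<Longrightarrow> alg W B t" "alg W (T \<union> B) g"
  shows "alg W B g"
  using assms(2,3,6,7)
proof (induction T rule: finite_induct)
  case (insert t T)
  have "alg W (T \<union> B) g"
  proof (rule alg_trans'[OF assms(1)])
    show "alg W (T \<union> B) t" using insert.prems(2)[of t] by (auto intro: alg_mono)
    show "alg W (insert t (T \<union> B)) g" using insert.prems(3) by simp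
  qed (use insert.prems assms in auto)
  then show ?case using insert by auto
qed simp

subsection \<open>Dominant families\<close>

text \<open>
  The map \<open>W \<rightarrow> K\<^sup>m\<close> with components \<open>f 0, \<dots>, f (m - 1)\<close> has dense image; over an infinite field this
  means that the components are algebraically independent on \<open>W\<close>.
\<close>

definition dominant :: "'x set \<Rightarrow> nat \<Rightarrow> (nat \<Rightarrow> 'x \<Rightarrow> 'k::idom) \<Rightarrow> bool" where
  "dominant W m f \<longleftrightarrow> (\<forall>P\<in>PF (vars m). (\<forall>w\<in>W. P (\<lambda>i. f i w) = 0) \<longrightarrow> (\<forall>x. P x = 0))"

lemma dominantD: "dominant W m f \<Longrightarrow> P \<in> PF (vars m) \<Longrightarrow> (\<And>w. w \<in> W \<Longrightarrow> P (\<lambda>i. f i w) = 0) \<Longrightarrow> P x = 0"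
  unfolding dominant_def by blast

lemma dominant_le: "dominant W m f \<Longrightarrow> n \<le> m \<Longrightarrow> dominant W n f"
  unfolding dominant_def using pf_vars_mono by blast

lemma dominant_cong:
  assumes "dominant W m f" "\<And>i w. i < m \<Longrightarrow> w \<in> W \<Longrightarrow> f i w = g i w"
  shows "dominant W m g"
  unfolding dominant_def
proof (intro ballI impI allI)
  fix P x assume P: "P \<in> PF (vars m)" "\<forall>w\<in>W. P (\<lambda>i. g i w) = 0"
  show "P x = 0"
  proof (rule dominantD[OF assms(1) P(1)])
    fix w assume "w \<in> W"
    then have "P (\<lambda>i. f i w) = P (\<lambda>i. g i w)" by (intro pf_vars_cong[OF P(1)] assms(2))
    then show "P (\<lambda>i. f i w) = 0" using P(2) \<open>w \<in> W\<close> by simp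
  qed
qed

lemma dominant_subset: "dominant W m f \<Longrightarrow> W \<subseteq> W' \<Longrightarrow> dominant W' m f"
  unfolding dominant_def by blast

lemma polyfam_vars_compose:
  assumes "polyfam (vars m) Q" "\<And>i. i < m \<Longrightarrow> f i \<in> PF C"
  shows "polyfam C (\<lambda>w. Q (\<lambda>i. f i w))"
proof -
  obtain n where "\<And>x. degree (Q x) \<le> n" using polyfam_degree[OF assms(1)] by blast
  then show ?thesis
    by (intro polyfamI[of _ _ n] pf_vars_compose[OF polyfam_coeff[OF assms(1)] assms(2)])
qed

lemma polyfam_vars_cong:
  assumes "polyfam (vars m) Q" "\<And>i. i < m \<Longrightarrow> x i = y i"
  shows "Q x = Q y"
  by (rule poly_eqI) (rule pf_vars_cong[OF polyfam_coeff[OF assms(1)] assms(2)])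

lemma polyfam_lift:
  assumes "polyfam (f ` {..<m}) P"
  obtains Q where "polyfam (vars m) Q" "\<And>w. P w = Q (\<lambda>i. f i w)"
proof -
  obtain n where n: "\<And>x. degree (P x) \<le> n" using polyfam_degree[OF assms(1)] by blast
  have "\<forall>i. \<exists>A. A \<in> PF (vars m) \<and> (\<forall>w. coeff (P w) i = A (\<lambda>i. f i w))"
  proof
    fix i show "\<exists>A. A \<in> PF (vars m) \<and> (\<forall>w. coeff (P w) i = A (\<lambda>i. f i w))"
      by (rule pf_lift[OF polyfam_coeff[OF assms, of i]]) blast
  qed
  then obtain A where A: "\<And>i. A i \<in> PF (vars m)" "\<And>i w. coeff (P w) i = A i (\<lambda>i. f i w)"
    by metis
  show thesis
  proof
    show "polyfam (vars m) (\<lambda>x. \<Sum>i\<le>n. monom (A i x) i)"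
      by (intro polyfam_sum polyfam_monom A)
    show "P w = (\<Sum>i\<le>n. monom (A i (\<lambda>i. f i w)) i)" for w
      using poly_as_sum_of_monoms'[OF n, of w] by (simp add: A(2))
  qed
qed

text \<open>Order a relation by powers of the last function: since that function is not algebraic,
  all coefficients vanish on \<open>W\<close>, and dominance of the others makes them zero
  polynomials.\<close>

lemma dominant_Suc:
  assumes "dominant W m f" "\<not> alg W (f ` {..<m}) (f m)"
  shows "dominant W (Suc m) f"
  unfolding dominant_def
proof (intro ballI impI allI)
  fix P x assume P: "P \<in> PF (vars (Suc m))" "\<forall>w\<in>W. P (\<lambda>i. f i w) = 0"
  obtain Q where Q: "polyfam (vars m) Q" "\<And>x. P x = poly (Q x) (x m)"
    by (rule pf_insert[OF P(1)[unfolded vars_Suc]]) (rule that, assumption+)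
  have "polyfam (f ` {..<m}) (\<lambda>w. Q (\<lambda>i. f i w))"
    by (rule polyfam_vars_compose[OF Q(1)]) (auto intro: pf_coord)
  then have z: "Q (\<lambda>i. f i w) = 0" if "w \<in> W" for w
    using assms(2) P(2)[unfolded Q(2)] that unfolding alg_def by blast
  have "Q x = 0"
    by (rule poly_eqI) (use dominantD[OF assms(1) polyfam_coeff[OF Q(1)]] z in auto)
  then show "P x = 0" by (simp add: Q(2))
qed

lemma poly_zero_all:
  assumes "\<And>s. poly (p :: 'k::alg_closed_field poly) s = 0"
  shows "p = 0"
  using infinite_alg_closed poly_roots_finite[of p] assms by auto

lemma dominant_not_alg:
  fixes f :: "nat \<Rightarrow> 'x \<Rightarrow> 'k::alg_closed_field"
  assumes "dominant W m f" "j < m"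
  shows "\<not> alg W (f ` {..<j}) (f j)"
proof
  assume "alg W (f ` {..<j}) (f j)"
  then obtain P w0 where P: "polyfam (f ` {..<j}) P" "w0 \<in> W" "P w0 \<noteq> 0"
    "\<And>w. w \<in> W \<Longrightarrow> poly (P w) (f j w) = 0"
    unfolding alg_def by blast
  obtain Q where Q: "polyfam (vars j) Q" "\<And>w. P w = Q (\<lambda>i. f i w)"
    by (rule polyfam_lift[OF P(1)]) (rule that, assumption+)
  have pf: "(\<lambda>x. poly (Q x) (x j)) \<in> PF (vars (Suc j))"
    by (rule polyfam_poly[OF Q(1)]) (auto simp: vars_Suc intro: pf_coord)
  have "poly (Q x) (x j) = 0" for x
    by (rule dominantD[OF dominant_le[OF assms(1), of "Suc j"] pf]) (use P Q assms in auto)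
  \<comment> \<open>The family \<open>Q\<close> does not involve entry \<open>j\<close>, so that
    entry may take any value; a univariate polynomial vanishing on an infinite field is
    zero.\<close>
  then have "poly (Q x) s = 0" for x s
    using polyfam_vars_cong[OF Q(1), of x "x(j := s)"] by (metis fun_upd_apply less_irrefl)
  then have "Q x = 0" for x by (rule poly_zero_all)
  then show False using P(3) Q(2) by simp
qed

text \<open>Steinitz exchange: after \<open>j\<close> steps, \<open>j\<close> members of
  \<open>B\<close> have been traded for \<open>f 0, ..., f (j - 1)\<close>, and everything in
  \<open>B\<close> is still algebraic over the new family.\<close>

lemma steinitz:
  fixes f :: "nat \<Rightarrow> 'x \<Rightarrow> 'k::alg_closed_field"
  assumes irr: "irr C W" and fin: "finite C" "finite B" and B: "B \<subseteq> PF C"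
    and C: "\<And>z. z \<in> C \<Longrightarrow> alg W B z"
    and f: "\<And>i. i < m \<Longrightarrow> f i \<in> PF C" "dominant W m f"
  shows "m \<le> card B"
proof -
  have W: "W \<noteq> {}" using irr by (rule irr_nonempty)
  have algB: "alg W B g" if "g \<in> PF C" for g
    by (rule alg_trans_finite[OF irr fin(1) _ B that C])
       (use that W in \<open>auto intro: pf_coord alg_mono[OF alg_self]\<close>)
  have "\<exists>B'\<subseteq>B. card B' + j \<le> card B \<and> (\<forall>b\<in>B. alg W (f ` {..<j} \<union> B') b)" if "j \<le> m" for j
    using that
  proof (induction j)
    case 0
    show ?case using W by (intro exI[of _ B]) (auto intro: alg_self pf_coord)
  next
    case (Suc j)
    then obtain B' where B': "B' \<subseteq> B" "card B' + j \<le> card B" "\<forall>b\<in>B. alg W (f ` {..<j} \<union> B') b"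
      by auto
    let ?F = "f ` {..<j}"
    have F: "?F \<subseteq> PF C" and fj: "f j \<in> PF C" using f(1) Suc.prems by auto
    have finB': "finite B'" using B'(1) fin(2) finite_subset by blast
    have "alg W (?F \<union> B') (f j)"
    proof (rule alg_trans_finite[OF irr fin(2) B _ fj])
      show "alg W (B \<union> (?F \<union> B')) (f j)" using algB[OF fj] by (rule alg_mono) auto
    qed (use B' F B in auto)
    then have "\<exists>n B''. B'' \<subseteq> B' \<and> card B'' = n \<and> alg W (?F \<union> B'') (f j)" by auto
    \<comment> \<open>By minimality \<open>f j\<close> is no longer algebraic after deleting any
      \<open>b\<close> from \<open>B''\<close>, which is the situation of
      \<open>alg_exchange\<close>. The set is nonempty because a dominant family has no algebraic
      members over their predecessors.\<close>
    from exists_least_iff[THEN iffD1, OF this] obtain B'' where B'':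
      "B'' \<subseteq> B'" "alg W (?F \<union> B'') (f j)"
      and min: "\<And>D. D \<subseteq> B' \<Longrightarrow> card D < card B'' \<Longrightarrow> \<not> alg W (?F \<union> D) (f j)"
      by blast
    have "B'' \<noteq> {}" using dominant_not_alg[OF f(2), of j] Suc.prems B''(2) by auto
    then obtain b where b: "b \<in> B''" by blast
    have finB'': "finite B''" using finB' B''(1) finite_subset by blast
    let ?S = "?F \<union> (B'' - {b})"
    have "\<not> alg W ?S (f j)" using B''(1) b finB'' by (intro min psubset_card_mono) auto
    moreover have "insert b ?S = ?F \<union> B''" using b by auto
    ultimately have "alg W (insert (f j) ?S) b" using B''(2) alg_exchange[of W b ?S "f j"] by simp
    then have algb: "alg W (f ` {..<Suc j} \<union> (B' - {b})) b"
      by (rule alg_mono) (use B''(1) in \<open>auto simp: lessThan_Suc\<close>)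
    have "alg W (f ` {..<Suc j} \<union> (B' - {b})) c" if c: "c \<in> B" for c
    proof (rule alg_trans'[OF irr _ _ _ algb])
      show "alg W (insert b (f ` {..<Suc j} \<union> (B' - {b}))) c"
        using B'(3) c by (auto intro: alg_mono)
    qed (use F fj B B' B'' b c in \<open>auto simp: lessThan_Suc\<close>)
    moreover have "card (B' - {b}) + Suc j \<le> card B"
      using B'(2) card_Suc_Diff1[OF finB', of b] B''(1) b by auto
    ultimately show ?case using B'(1) by (intro exI[of _ "B' - {b}"]) auto
  qed
  from this[of m] show ?thesis by auto
qed

text \<open>The elements of \<open>T\<close> are tried one by one, and precisely those not algebraic
  over the family so far are appended.\<close>

lemma extend_dominant:
  assumes "W \<noteq> {}" "finite T" "dominant W m f"
  shows "\<exists>M\<ge>m. \<exists>h. (\<forall>i<m. h i = f i) \<and> (\<forall>i. m \<le> i \<and> i < M \<longrightarrow> h i \<in> T) \<and> dominant W M h \<and>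
    (\<forall>t\<in>T. alg W (h ` {..<M}) t)"
  using assms(2)
proof induction
  case empty
  show ?case using assms by (intro exI[of _ m] conjI exI[of _ f]) auto
next
  case (insert t T)
  then obtain M h where h: "M \<ge> m" "\<And>i. i < m \<Longrightarrow> h i = f i" "\<And>i. m \<le> i \<Longrightarrow> i < M \<Longrightarrow> h i \<in> T"
    "dominant W M h" "\<And>t. t \<in> T \<Longrightarrow> alg W (h ` {..<M}) t" by blast
  show ?case
  proof (cases "alg W (h ` {..<M}) t")
    case True
    then show ?thesis using h by (intro exI[of _ M] conjI exI[of _ h]) auto
  next
    case False
    define h' where "h' = h(M := t)"
    have h': "h' M = t" "\<And>i. i \<noteq> M \<Longrightarrow> h' i = h i" by (auto simp: h'_def)
    have im: "h' ` {..<M} = h ` {..<M}" by (rule image_cong) (auto simp: h')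
    have "dominant W M h'" using h(4) by (rule dominant_cong) (auto simp: h')
    then have "dominant W (Suc M) h'" using False by (intro dominant_Suc) (simp_all add: im h')
    moreover have "alg W (h' ` {..<Suc M}) s" if "s \<in> insert t T" for s
    proof (cases "s = t")
      case True
      then show ?thesis using assms(1) by (intro alg_self pf_coord) (auto simp: lessThan_Suc h')
    next
      case False
      then show ?thesis using h(5)[of s] that
        by (auto simp: lessThan_Suc im intro: alg_mono)
    qed
    ultimately show ?thesis using h(1-3)
      by (intro exI[of _ "Suc M"] conjI exI[of _ h']) (auto simp: less_Suc_eq h')
  qed
qed

text \<open>Nonzero relations on the individual sets would multiply to a nonzero relation on the
  union.\<close>

lemma dominant_Union:
  fixes f :: "nat \<Rightarrow> 'x \<Rightarrow> 'k::alg_closed_field"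
  assumes "finite F" "dominant (\<Union>F) m f"
  shows "\<exists>W\<in>F. dominant W m f"
proof (rule ccontr)
  assume "\<not> ?thesis"
  then have "\<forall>W\<in>F. \<exists>P. P \<in> PF (vars m) \<and> (\<forall>w\<in>W. P (\<lambda>i. f i w) = 0) \<and> (\<exists>x. P x \<noteq> 0)"
    unfolding dominant_def by blast
  then obtain P where P: "\<And>W. W \<in> F \<Longrightarrow> P W \<in> PF (vars m) \<and> (\<forall>w\<in>W. P W (\<lambda>i. f i w) = 0) \<and> (\<exists>x. P W x \<noteq> 0)"
    by metis
  then obtain x where x: "\<forall>W\<in>F. P W x \<noteq> 0"
    using pf_vars_prod_nonzero[OF assms(1), of P m] by blast
  have "(\<Prod>W\<in>F. P W x) = 0"
  proof (rule dominantD[OF assms(2), of "\<lambda>x. \<Prod>W\<in>F. P W x" x])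
    show "(\<lambda>x. \<Prod>W\<in>F. P W x) \<in> PF (vars m)" using P by (intro pf_prod) auto
    show "(\<Prod>W\<in>F. P W (\<lambda>i. f i w)) = 0" if "w \<in> \<Union>F" for w
      using that P assms(1) by (auto simp: prod_zero_iff)
  qed
  then show False using x assms(1) by (auto simp: prod_zero_iff)
qed

subsection \<open>Images of dominant maps\<close>

text \<open>Division by \<open>P\<close> after multiplying with powers of its coefficient of index
  \<open>n\<close>, which may vanish at some points. Comparing values only at roots of
  \<open>P\<close> makes it unnecessary to name the quotient.\<close>

lemma pseudo_remainder:
  assumes P: "polyfam S P" "n > 0" "\<And>x. degree (P x) \<le> n"
  shows "polyfam S A \<Longrightarrow> (\<And>x. degree (A x) \<le> d) \<Longrightarrow> \<exists>k R. polyfam S R \<and> (\<forall>x. degree (R x) < n) \<and>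
    (\<forall>x y. poly (P x) y = 0 \<longrightarrow> coeff (P x) n ^ k * poly (A x) y = poly (R x) y)"
proof (induction d arbitrary: A)
  case 0
  then show ?case using P(2) by (intro exI[of _ 0] exI[of _ A]) auto
next
  case (Suc d)
  let ?A = "\<lambda>x. poly_shift 1 (A x)"
  let ?c = "\<lambda>x. coeff (P x) n"
  have dA: "degree (?A x) \<le> d" for x
  proof (rule degree_le, intro allI impI)
    fix i assume "d < i"
    then show "coeff (?A x) i = 0"
      using Suc.prems(2)[of x] by (simp add: coeff_poly_shift coeff_eq_0)
  qed
  have "polyfam S ?A" using Suc.prems(1) dA
    by (intro polyfamI[of _ _ d]) (auto simp: coeff_poly_shift intro: polyfam_coeff)
  from Suc.IH[OF this dA] obtain k R where R: "polyfam S R" "\<And>x. degree (R x) < n"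
    "\<And>x y. poly (P x) y = 0 \<Longrightarrow> ?c x ^ k * poly (?A x) y = poly (R x) y"
    by auto
  \<comment> \<open>Multiplying \<open>R\<close> by the variable can create a term of degree
    \<open>n\<close>; the multiple of \<open>P\<close> cancels it.\<close>
  define R' where "R' = (\<lambda>x. [:?c x:] * ([:0, 1:] * R x) + [:- coeff (R x) (n - 1):] * P x
      + [:?c x ^ Suc k * coeff (A x) 0:])"
  have "polyfam S (\<lambda>x. [:0, 1:])" using polyfam_monom[OF pf_const[of 1], of S 1]
    by (simp add: monom_altdef)
  then have "polyfam S R'" unfolding R'_def
    using P(1) R(1) Suc.prems(1)
    by (intro polyfam_add polyfam_mult polyfam_const pf_mult pf_power pf_uminus polyfam_coeff)
  moreover have "degree (R' x) < n" for x
  proof -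
    have "coeff (R' x) i = 0" if i: "i \<ge> n" for i
    proof -
      obtain j where j: "i = Suc j" using i P(2) by (cases i) auto
      show ?thesis
      proof (cases "i = n")
        case True
        then have n: "n = Suc j" using j by simp
        show ?thesis unfolding R'_def j n by simp
      next
        case False
        then have "coeff (R x) j = 0" "coeff (P x) (Suc j) = 0"
          using i R(2)[of x] P(3)[of x] j by (auto intro!: coeff_eq_0)
        then show ?thesis by (simp add: R'_def j)
      qed
    qed
    then have "degree (R' x) \<le> n - 1" by (intro degree_le) auto
    then show ?thesis using P(2) by simp
  qed
  moreover have "?c x ^ Suc k * poly (A x) y = poly (R' x) y" if "poly (P x) y = 0" for x y
  proof -
    have "A x = pCons (coeff (A x) 0) (?A x)"
      by (rule poly_eqI) (auto simp: coeff_pCons coeff_poly_shift split: nat.split)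
    then have "poly (A x) y = coeff (A x) 0 + y * poly (?A x) y" by (metis poly_pCons)
    then have "?c x ^ Suc k * poly (A x) y = ?c x ^ Suc k * coeff (A x) 0 + ?c x * y * (?c x ^ k * poly (?A x) y)"
      by (simp add: algebra_simps)
    then show ?thesis using R(3)[OF that] that by (simp add: R'_def algebra_simps)
  qed
  ultimately show ?case by blast
qed

text \<open>The closure, in affine \<open>q\<close>-space, of the image of \<open>W\<close> under
  the functions \<open>t 0, ..., t (q - 1)\<close>.\<close>

definition zcl :: "'x set \<Rightarrow> nat \<Rightarrow> (nat \<Rightarrow> 'x \<Rightarrow> 'k::idom) \<Rightarrow> (nat \<Rightarrow> 'k) \<Rightarrow> bool" where
  "zcl W q t \<tau> \<longleftrightarrow> (\<forall>P\<in>PF (vars q). (\<forall>w\<in>W. P (\<lambda>i. t i w) = 0) \<longrightarrow> P \<tau> = 0)"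

lemma zclD: "zcl W q t \<tau> \<Longrightarrow> P \<in> PF (vars q) \<Longrightarrow> (\<And>w. w \<in> W \<Longrightarrow> P (\<lambda>i. t i w) = 0) \<Longrightarrow> P \<tau> = 0"
  unfolding zcl_def by blast

text \<open>
  One step of the extension theorem for homomorphisms into an algebraically closed field.
  Points of the closure of the image of \<open>t\<close> are the homomorphisms defined on the subalgebra
  generated by the \<open>t i\<close>. In the algebraic case the new value is a root of a relation of minimal
  degree; by pseudo-division every other relation is then satisfied as well.
\<close>

lemma extend_point_step:
  fixes t :: "nat \<Rightarrow> 'x \<Rightarrow> 'k::alg_closed_field"
  assumes irr: "irr C W" and t: "\<And>i. i \<le> q \<Longrightarrow> t i \<in> PF C"
    and b': "b' \<in> PF (vars (Suc q))" and nz: "nz W (\<lambda>w. b' (\<lambda>i. t i w))"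
  shows "\<exists>b\<in>PF (vars q). nz W (\<lambda>w. b (\<lambda>i. t i w)) \<and>
    (\<forall>\<tau>. zcl W q t \<tau> \<longrightarrow> b \<tau> \<noteq> 0 \<longrightarrow> (\<exists>y. zcl W (Suc q) t (\<tau>(q := y)) \<and> b' (\<tau>(q := y)) \<noteq> 0))"
proof (cases "alg W (t ` {..<q}) (t q)")
  case False
  obtain B where B: "polyfam (vars q) B" "\<And>x. b' x = poly (B x) (x q)"
    by (rule pf_insert[OF b'[unfolded vars_Suc]]) (rule that, assumption+)
  obtain w0 where w0: "w0 \<in> W" "poly (B (\<lambda>i. t i w0)) (t q w0) \<noteq> 0"
    using nz B(2) by (auto simp: nz_def)
  then have "B (\<lambda>i. t i w0) \<noteq> 0" by auto
  then obtain i where i: "coeff (B (\<lambda>i. t i w0)) i \<noteq> 0" by (auto simp: poly_eq_iff)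
  show ?thesis
  proof (intro bexI[of _ "\<lambda>x. coeff (B x) i"] conjI allI impI)
    show "nz W (\<lambda>w. coeff (B (\<lambda>i. t i w)) i)" using w0 i by (auto simp: nz_def)
    show "(\<lambda>x. coeff (B x) i) \<in> PF (vars q)" using B by (intro polyfam_coeff)
    fix \<tau> assume \<tau>: "zcl W q t \<tau>" "coeff (B \<tau>) i \<noteq> 0"
    then have "B \<tau> \<noteq> 0" by auto
    \<comment> \<open>In the transcendental case no relation constrains \<open>y\<close>; it only
      has to avoid the roots of a nonzero polynomial.\<close>
    then obtain y where y: "poly (B \<tau>) y \<noteq> 0" using poly_zero_all by blast
    have "B (\<tau>(q := y)) = B \<tau>" by (rule polyfam_vars_cong[OF B(1)]) auto
    then have "b' (\<tau>(q := y)) \<noteq> 0" using y by (simp add: B(2))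
    moreover have "zcl W (Suc q) t (\<tau>(q := y))"
      unfolding zcl_def
    proof (intro ballI impI)
      fix P assume P: "P \<in> PF (vars (Suc q))" "\<forall>w\<in>W. P (\<lambda>i. t i w) = 0"
      obtain Q where Q: "polyfam (vars q) Q" "\<And>x. P x = poly (Q x) (x q)"
        by (rule pf_insert[OF P(1)[unfolded vars_Suc]]) (rule that, assumption+)
      have "polyfam (t ` {..<q}) (\<lambda>w. Q (\<lambda>i. t i w))"
        by (rule polyfam_vars_compose[OF Q(1)]) (auto intro: pf_coord)
      then have z: "Q (\<lambda>i. t i w) = 0" if "w \<in> W" for w
        using False P(2)[unfolded Q(2)] that unfolding alg_def by blast
      have "Q \<tau> = 0"
        by (rule poly_eqI) (use zclD[OF \<tau>(1) polyfam_coeff[OF Q(1)]] z in auto)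
      moreover have "Q (\<tau>(q := y)) = Q \<tau>" by (rule polyfam_vars_cong[OF Q(1)]) auto
      ultimately show "P (\<tau>(q := y)) = 0" by (simp add: Q(2))
    qed
    ultimately show "\<exists>y. zcl W (Suc q) t (\<tau>(q := y)) \<and> b' (\<tau>(q := y)) \<noteq> 0" by blast
  qed
next
  case True
  let ?t = "\<lambda>w i. t i w"
  define Rel where "Rel n P \<longleftrightarrow> polyfam (vars q) P \<and> nz W (\<lambda>w. coeff (P (?t w)) n) \<and>
     (\<forall>w\<in>W. degree (P (?t w)) \<le> n) \<and> (\<forall>w\<in>W. poly (P (?t w)) (t q w) = 0)" for n P
  have relI: "\<exists>n. Rel n P \<and> n \<le> d" if P: "polyfam (vars q) P" "\<exists>w\<in>W. P (?t w) \<noteq> 0"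
    "\<forall>w\<in>W. poly (P (?t w)) (t q w) = 0" "\<And>w. w \<in> W \<Longrightarrow> degree (P (?t w)) \<le> d" for P d
  proof -
    have "polyfam (t ` {..<q}) (\<lambda>w. P (?t w))"
      by (rule polyfam_vars_compose[OF P(1)]) (auto intro: pf_coord)
    from polyfam_leading[OF this P(2)] obtain n where n: "nz W (\<lambda>w. coeff (P (?t w)) n)"
      "\<And>w. w \<in> W \<Longrightarrow> degree (P (?t w)) \<le> n" by blast
    then have "n \<le> d" using P(4) unfolding nz_def by (meson le_degree le_trans)
    then show ?thesis using n P unfolding Rel_def by blast
  qed
  have ex: "\<exists>n. \<exists>P. Rel n P"
  proof -
    obtain P where P: "polyfam (t ` {..<q}) P" "\<exists>w\<in>W. P w \<noteq> 0" "\<forall>w\<in>W. poly (P w) (t q w) = 0"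
      using True unfolding alg_def by blast
    obtain Q where Q: "polyfam (vars q) Q" "\<And>w. P w = Q (?t w)"
      by (rule polyfam_lift[OF P(1)]) (rule that, assumption+)
    obtain d where "\<And>x. degree (Q x) \<le> d" using polyfam_degree[OF Q(1)] by blast
    then show ?thesis using relI[OF Q(1), of d] P Q(2) by auto
  qed
  from exists_least_iff[THEN iffD1, OF ex] obtain n P0 where P0: "Rel n P0"
    and min: "\<And>m P. m < n \<Longrightarrow> \<not> Rel m P" by blast
  \<comment> \<open>Truncation bounds the degree by \<open>n\<close> at every point of affine space,
    as pseudo-division requires. At the image of \<open>W\<close> it changes nothing.\<close>
  define P where "P = (\<lambda>x. \<Sum>i\<le>n. monom (coeff (P0 x) i) i)"
  have P_eq: "P x = P0 x" if "degree (P0 x) \<le> n" for x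
    unfolding P_def by (rule poly_as_sum_of_monoms'[OF that])
  have P: "polyfam (vars q) P" "nz W (\<lambda>w. coeff (P (?t w)) n)"
     "\<And>w. w \<in> W \<Longrightarrow> poly (P (?t w)) (t q w) = 0"
    using P0 P_eq unfolding Rel_def nz_def
    by (auto simp: P_def intro!: polyfam_sum polyfam_monom polyfam_coeff)
  have degP: "degree (P x) \<le> n" for x
    unfolding P_def by (intro degree_sum_le) (auto intro: order.trans[OF degree_monom_le])
  have npos: "n > 0"
  proof (rule ccontr)
    assume "\<not> n > 0"
    then have n0: "n = 0" by simp
    obtain w where w: "w \<in> W" "coeff (P (?t w)) n \<noteq> 0" using P(2) by (auto simp: nz_def)
    have "poly (P (?t w)) (t q w) = coeff (P (?t w)) 0"
      using poly_bounded[OF degP, of "?t w" "t q w"] n0 by simp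
    then show False using P(3)[OF w(1)] w(2) n0 by simp
  qed
  let ?S = "t ` {..<q}"
  have S: "insert (t q) ?S = t ` {..<Suc q}" by (auto simp: lessThan_Suc)
  have irrS: "irr (insert (t q) ?S) W" using irr by (rule irr_hull) (use t in auto)
  have bS: "(\<lambda>w. b' (?t w)) \<in> PF (insert (t q) ?S)"
    unfolding S by (rule pf_vars_compose[OF b']) (auto intro: pf_coord)
  \<comment> \<open>A multiple of \<open>b'\<close> that does not involve \<open>t q\<close>: where
    it is nonzero, so is \<open>b'\<close>, whichever root \<open>y\<close> is chosen.\<close>
  obtain u r where ur: "u \<in> PF (insert (t q) ?S)" "r \<in> PF ?S" "nz W r"
    "\<And>w. w \<in> W \<Longrightarrow> u w * b' (?t w) = r w"
    by (rule alg_multiple[OF irrS True bS nz]) (rule that, assumption+)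
  obtain U where U: "U \<in> PF (vars (Suc q))" "\<And>w. u w = U (?t w)"
    by (rule pf_lift[OF ur(1)[unfolded S]]) (rule that, assumption+)
  obtain R1 where R1: "R1 \<in> PF (vars q)" "\<And>w. r w = R1 (?t w)"
    by (rule pf_lift[OF ur(2)]) (rule that, assumption+)
  show ?thesis
  proof (intro bexI[of _ "\<lambda>x. coeff (P x) n * R1 x"] conjI allI impI)
    show bpf: "(\<lambda>x. coeff (P x) n * R1 x) \<in> PF (vars q)"
      using P(1) R1 by (intro pf_mult polyfam_coeff)
    show "nz W (\<lambda>w. coeff (P (?t w)) n * R1 (?t w))"
    proof (rule irr_nz_mult[OF irr _ _ P(2)])
      show "nz W (\<lambda>w. R1 (?t w))" using ur(3) R1(2) by (simp add: nz_def)
    qed (use t in \<open>auto intro!: pf_vars_compose[OF R1(1)] pf_vars_compose[OF polyfam_coeff[OF P(1)]]\<close>)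
    fix \<tau> assume \<tau>: "zcl W q t \<tau>" "coeff (P \<tau>) n * R1 \<tau> \<noteq> 0"
    then have "degree (P \<tau>) > 0" using npos by (metis le_degree mult_zero_left order_less_le_trans)
    then obtain y where y: "poly (P \<tau>) y = 0" using alg_closed_imp_poly_has_root by blast
    have upd: "Q (\<tau>(q := y)) = Q \<tau>" if "polyfam (vars q) Q" for Q
      by (rule polyfam_vars_cong[OF that]) auto
    have z: "zcl W (Suc q) t (\<tau>(q := y))"
      unfolding zcl_def
    proof (intro ballI impI)
      fix F assume F: "F \<in> PF (vars (Suc q))" "\<forall>w\<in>W. F (\<lambda>i. t i w) = 0"
      obtain Q where Q: "polyfam (vars q) Q" "\<And>x. F x = poly (Q x) (x q)"
        by (rule pf_insert[OF F(1)[unfolded vars_Suc]]) (rule that, assumption+)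
      obtain d where d: "\<And>x. degree (Q x) \<le> d" using polyfam_degree[OF Q(1)] by blast
      obtain k R where R: "polyfam (vars q) R" "\<And>x. degree (R x) < n"
        "\<And>x y. poly (P x) y = 0 \<Longrightarrow> coeff (P x) n ^ k * poly (Q x) y = poly (R x) y"
        using pseudo_remainder[OF P(1) npos degP Q(1) d] by blast
      have "R (?t w) = 0" if wW: "w \<in> W" for w
      proof (rule ccontr)
        assume "R (?t w) \<noteq> 0"
        moreover have "poly (R (?t w)) (t q w) = 0" if "w \<in> W" for w
          using R(3)[OF P(3)[OF that], symmetric] F(2) Q(2) that by simp
        moreover have "degree (R x) \<le> n - 1" for x using R(2)[of x] by simp
        ultimately obtain m where "Rel m R" "m \<le> n - 1"
          using relI[OF R(1), of "n - 1"] wW by blast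
        then show False using min[of m R] npos by simp
      qed
      then have "R \<tau> = 0"
        by (intro poly_eqI) (use zclD[OF \<tau>(1) polyfam_coeff[OF R(1)]] in auto)
      then have "poly (Q \<tau>) y = 0" using R(3)[OF y] \<tau>(2) by simp
      then show "F (\<tau>(q := y)) = 0" by (simp add: Q(2) upd[OF Q(1)])
    qed
    moreover have "U (\<tau>(q := y)) * b' (\<tau>(q := y)) - R1 (\<tau>(q := y)) = 0"
    proof (rule zclD[OF z])
      show "(\<lambda>x. U x * b' x - R1 x) \<in> PF (vars (Suc q))"
        using U(1) b' R1(1) pf_vars_mono[of R1 q "Suc q"] by (auto intro!: pf_intros)
    qed (use ur(4) U(2) R1(2) in simp)
    moreover have "R1 (\<tau>(q := y)) = R1 \<tau>" by (rule pf_vars_cong[OF R1(1)]) auto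
    ultimately show "\<exists>y. zcl W (Suc q) t (\<tau>(q := y)) \<and> b' (\<tau>(q := y)) \<noteq> 0"
      using \<tau>(2) by (intro exI[of _ y]) auto
  qed
qed

text \<open>The last variable is treated first; the open condition obtained for it becomes the
  condition to be met by the preceding variables.\<close>

lemma extend_point:
  fixes t :: "nat \<Rightarrow> 'x \<Rightarrow> 'k::alg_closed_field"
  assumes irr: "irr C W"
  shows "(\<And>i. i < q + n \<Longrightarrow> t i \<in> PF C) \<Longrightarrow> b' \<in> PF (vars (q + n)) \<Longrightarrow> nz W (\<lambda>w. b' (\<lambda>i. t i w)) \<Longrightarrow>
    \<exists>b\<in>PF (vars q). nz W (\<lambda>w. b (\<lambda>i. t i w)) \<and>
    (\<forall>\<tau>. zcl W q t \<tau> \<longrightarrow> b \<tau> \<noteq> 0 \<longrightarrow> (\<exists>\<tau>'. (\<forall>i<q. \<tau>' i = \<tau> i) \<and> zcl W (q + n) t \<tau>' \<and> b' \<tau>' \<noteq> 0))"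
proof (induction n arbitrary: b')
  case 0
  then show ?case by auto
next
  case (Suc n)
  obtain b1 where b1: "b1 \<in> PF (vars (q + n))" "nz W (\<lambda>w. b1 (\<lambda>i. t i w))"
    "\<And>\<tau>. zcl W (q + n) t \<tau> \<Longrightarrow> b1 \<tau> \<noteq> 0 \<Longrightarrow>
      (\<exists>y. zcl W (Suc (q + n)) t (\<tau>(q + n := y)) \<and> b' (\<tau>(q + n := y)) \<noteq> 0)"
    using extend_point_step[OF irr, of "q + n" t b'] Suc.prems by auto
  obtain b where b: "b \<in> PF (vars q)" "nz W (\<lambda>w. b (\<lambda>i. t i w))"
    "\<And>\<tau>. zcl W q t \<tau> \<Longrightarrow> b \<tau> \<noteq> 0 \<Longrightarrow> (\<exists>\<tau>'. (\<forall>i<q. \<tau>' i = \<tau> i) \<and> zcl W (q + n) t \<tau>' \<and> b1 \<tau>' \<noteq> 0)"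
    using Suc.IH[OF _ b1(1,2)] Suc.prems(1) by auto
  show ?case
  proof (intro bexI[of _ b] conjI allI impI b)
    fix \<tau> assume "zcl W q t \<tau>" "b \<tau> \<noteq> 0"
    from b(3)[OF this] obtain \<tau>' where \<tau>': "\<forall>i<q. \<tau>' i = \<tau> i" "zcl W (q + n) t \<tau>'" "b1 \<tau>' \<noteq> 0" by blast
    from b1(3)[OF this(2,3)] obtain y where
      "zcl W (Suc (q + n)) t (\<tau>'(q + n := y))" "b' (\<tau>'(q + n := y)) \<noteq> 0" by blast
    then show "\<exists>\<tau>'. (\<forall>i<q. \<tau>' i = \<tau> i) \<and> zcl W (q + Suc n) t \<tau>' \<and> b' \<tau>' \<noteq> 0"
      using \<tau>'(1) by (intro exI[of _ "\<tau>'(q + n := y)"]) auto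
  qed
qed

definition zclosure :: "'x set \<Rightarrow> ('x \<Rightarrow> 'k::idom) set \<Rightarrow> 'x set \<Rightarrow> 'x set" where
  "zclosure Om C W = {x \<in> Om. \<forall>p\<in>PF C. (\<forall>w\<in>W. p w = 0) \<longrightarrow> p x = 0}"

lemma zclosureD: "x \<in> zclosure Om C W \<Longrightarrow> p \<in> PF C \<Longrightarrow> (\<And>w. w \<in> W \<Longrightarrow> p w = 0) \<Longrightarrow> p x = 0"
  unfolding zclosure_def by blast

text \<open>The image of a dominant map contains a nonempty basic open set, as in Chevalley's
  theorem. The coordinates on \<open>W\<close> are appended to \<open>f\<close>, and a generic value
  of \<open>f\<close> is extended to values of all coordinates. Then \<open>chart\<close> realizes
  these values by a point, and \<open>lc\<close> shows that the point lies in
  \<open>W\<close>.\<close>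

lemma dominant_image_open:
  fixes f :: "nat \<Rightarrow> 'x \<Rightarrow> 'k::alg_closed_field"
  assumes irr: "irr C W" and fin: "finite C" and chart: "\<And>c. \<exists>x\<in>Om. \<forall>z\<in>C. z x = c z"
    and f: "\<And>i. i < m \<Longrightarrow> f i \<in> PF C" "dominant W m f" and b: "b \<in> PF C" "nz W b"
    and lc: "\<And>x. x \<in> zclosure Om C W \<Longrightarrow> b x \<noteq> 0 \<Longrightarrow> x \<in> W"
  shows "\<exists>h\<in>PF (vars m). (\<exists>c. h c \<noteq> 0) \<and> (\<forall>c. h c \<noteq> 0 \<longrightarrow> (\<exists>w\<in>W. b w \<noteq> 0 \<and> (\<forall>i<m. f i w = c i)))"
proof -
  obtain n and e :: "nat \<Rightarrow> 'x \<Rightarrow> 'k" where e: "bij_betw e {..<n} C"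
    using ex_bij_betw_nat_finite[OF fin] by (auto simp: atLeast0LessThan)
  then have C: "C = e ` {..<n}" by (auto simp: bij_betw_def)
  define t where "t = (\<lambda>i. if i < m then f i else e (i - m))"
  have t: "t i \<in> PF C" if "i < m + n" for i
    using that f(1) by (auto simp: t_def C intro!: pf_coord)
  have shift: "(\<lambda>x. Q (\<lambda>i. x (m + i))) \<in> PF (vars (m + n))" if "Q \<in> PF (vars n)" for Q :: "(nat \<Rightarrow> 'k) \<Rightarrow> 'k"
    by (rule pf_vars_compose[OF that]) (auto intro: pf_vars_var)
  have te: "(\<lambda>i. t (m + i) w) = (\<lambda>i. e i w)" for w by (auto simp: t_def)
  have lift: "\<exists>P\<in>PF (vars n). \<forall>w. p w = P (\<lambda>i. e i w)" if "p \<in> PF C" for p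
    by (rule pf_lift[OF that[unfolded C]]) blast
  obtain B where B: "B \<in> PF (vars n)" "\<And>w. b w = B (\<lambda>i. e i w)" using lift[OF b(1)] by blast
  obtain h where h: "h \<in> PF (vars m)" "nz W (\<lambda>w. h (\<lambda>i. t i w))"
    "\<And>\<tau>. zcl W m t \<tau> \<Longrightarrow> h \<tau> \<noteq> 0 \<Longrightarrow>
       (\<exists>\<tau>'. (\<forall>i<m. \<tau>' i = \<tau> i) \<and> zcl W (m + n) t \<tau>' \<and> B (\<lambda>i. \<tau>' (m + i)) \<noteq> 0)"
    using extend_point[where t = t and q = m and n = n and b' = "\<lambda>x. B (\<lambda>i. x (m + i))", OF irr t shift[OF B(1)]] b(2)
    unfolding te B(2)[symmetric] by blast
  have dom: "dominant W m t" using f(2) by (rule dominant_cong) (simp add: t_def)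
  show ?thesis
  proof (intro bexI[of _ h] conjI allI impI h)
    show "\<exists>c. h c \<noteq> 0" using h(2) by (auto simp: nz_def)
    fix c assume c: "h c \<noteq> 0"
    have "zcl W m t c" using dom unfolding zcl_def dominant_def by blast
    from h(3)[OF this c] obtain \<tau> where \<tau>: "\<forall>i<m. \<tau> i = c i" "zcl W (m + n) t \<tau>"
      "B (\<lambda>i. \<tau> (m + i)) \<noteq> 0" by blast
    obtain x where x: "x \<in> Om" "\<And>z. z \<in> C \<Longrightarrow> z x = \<tau> (m + the_inv_into {..<n} e z)"
      using chart[of "\<lambda>z. \<tau> (m + the_inv_into {..<n} e z)"] by blast
    have ex: "e i x = \<tau> (m + i)" if "i < n" for i
      using x(2)[of "e i"] that e by (auto simp: C bij_betw_def the_inv_into_f_f)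
    have eval: "P (\<lambda>i. e i x) = P (\<lambda>i. \<tau> (m + i))" if "P \<in> PF (vars n)" for P
      by (rule pf_vars_cong[OF that]) (rule ex)
    have "x \<in> zclosure Om C W"
      unfolding zclosure_def
    proof (intro CollectI conjI x(1) ballI impI)
      fix p assume p: "p \<in> PF C" "\<forall>w\<in>W. p w = 0"
      obtain P where P: "P \<in> PF (vars n)" "\<And>w. p w = P (\<lambda>i. e i w)" using lift[OF p(1)] by blast
      have "P (\<lambda>i. \<tau> (m + i)) = 0"
        by (rule zclD[OF \<tau>(2) shift[OF P(1)]]) (use p(2) P(2) te in simp)
      then show "p x = 0" by (simp add: P(2) eval[OF P(1)])
    qed
    moreover have bx: "b x \<noteq> 0" using \<tau>(3) by (simp add: B(2) eval[OF B(1)])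
    ultimately have "x \<in> W" by (rule lc)
    moreover have "f i x = c i" if i: "i < m" for i
    proof -
      \<comment> \<open>On \<open>W\<close> the function \<open>f i\<close> is the polynomial
        \<open>F\<close> in the coordinates. This identity persists at \<open>\<tau>\<close>, so
        \<open>x\<close> has the prescribed value of \<open>f i\<close> and not only the chosen
        coordinates.\<close>
      obtain F where F: "F \<in> PF (vars n)" "\<And>w. f i w = F (\<lambda>i. e i w)" using lift[OF f(1)[OF i]] by blast
      have "\<tau> i - F (\<lambda>i. \<tau> (m + i)) = 0"
      proof (rule zclD[OF \<tau>(2), of "\<lambda>x. x i - F (\<lambda>i. x (m + i))"])
        show "(\<lambda>x. x i - F (\<lambda>i. x (m + i))) \<in> PF (vars (m + n))"
          using i by (intro pf_diff shift F pf_vars_var) auto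
        show "t i w - F (\<lambda>i. t (m + i) w) = 0" for w
          using i F(2)[of w] unfolding te by (simp add: t_def)
      qed
      then show ?thesis using \<tau>(1) i by (simp add: F(2) eval[OF F(1)])
    qed
    ultimately show "\<exists>w\<in>W. b w \<noteq> 0 \<and> (\<forall>i<m. f i w = c i)" using bx by blast
  qed
qed

subsection \<open>Noetherian property\<close>

inductive_set idl :: "('x \<Rightarrow> 'k::comm_ring_1) set \<Rightarrow> ('x \<Rightarrow> 'k) set \<Rightarrow> ('x \<Rightarrow> 'k) set"
  for C F where
  zero: "(\<lambda>_. 0) \<in> idl C F"
| step: "p \<in> idl C F \<Longrightarrow> r \<in> PF C \<Longrightarrow> f \<in> F \<Longrightarrow> (\<lambda>x. p x + r x * f x) \<in> idl C F"

lemma idl_add: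
  assumes "p \<in> idl C F" "q \<in> idl C F"
  shows "(\<lambda>x. p x + q x) \<in> idl C F"
  using assms(2)
proof induction
  case zero then show ?case using assms(1) by simp
next
  case (step q r f)
  then show ?case using idl.step[of "\<lambda>x. p x + q x" C F r f] by (simp add: add.assoc)
qed

lemma idl_mult:
  assumes "p \<in> idl C F" "q \<in> PF C"
  shows "(\<lambda>x. q x * p x) \<in> idl C F"
  using assms(1)
proof induction
  case zero then show ?case by (simp add: idl.zero)
next
  case (step p r f)
  then show ?case using idl.step[of "\<lambda>x. q x * p x" C F "\<lambda>x. q x * r x" f] pf_mult[OF assms(2)]
    by (simp add: algebra_simps)
qed

lemma idl_base: "f \<in> F \<Longrightarrow> f \<in> idl C F"
  using idl.step[OF idl.zero pf_const[of 1], of f F C] by simp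

lemma idl_hull: "p \<in> idl C F \<Longrightarrow> F \<subseteq> idl C F' \<Longrightarrow> p \<in> idl C F'"
  by (induction rule: idl.induct) (auto intro!: idl.zero idl_add idl_mult)

lemma idl_mono: "p \<in> idl C F \<Longrightarrow> F \<subseteq> F' \<Longrightarrow> p \<in> idl C F'"
  by (erule idl_hull) (auto intro: idl_base)

lemma idl_pf: "p \<in> idl C F \<Longrightarrow> F \<subseteq> PF C \<Longrightarrow> p \<in> PF C"
  by (induction rule: idl.induct) (auto intro!: pf_const pf_add pf_mult)

lemma idl_zero: "p \<in> idl C F \<Longrightarrow> \<forall>f\<in>F. f x = 0 \<Longrightarrow> p x = 0"
  by (induction rule: idl.induct) auto

lemma idl_prefix:
  fixes f :: "nat \<Rightarrow> 'x \<Rightarrow> 'k::comm_ring_1"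
  assumes "p \<in> idl C (range f)"
  shows "\<exists>n. p \<in> idl C (f ` {..<n})"
  using assms
proof induction
  case zero then show ?case by (auto intro: idl.zero)
next
  case (step p r g)
  then obtain n i where n: "p \<in> idl C (f ` {..<n})" "g = f i" by blast
  have "p \<in> idl C (f ` {..<max n (Suc i)})" by (rule idl_mono[OF n(1)]) auto
  then have "(\<lambda>x. p x + r x * g x) \<in> idl C (f ` {..<max n (Suc i)})"
    by (rule idl.step) (use step n in auto)
  then show ?case by blast
qed

lemma idl_prefix_finite:
  fixes f :: "nat \<Rightarrow> 'x \<Rightarrow> 'k::comm_ring_1"
  assumes "finite F" "F \<subseteq> idl C (range f)"
  shows "\<exists>n. F \<subseteq> idl C (f ` {..<n})"
  using assms
proof induction
  case (insert p F)
  then obtain m n where "F \<subseteq> idl C (f ` {..<n})" "p \<in> idl C (f ` {..<m})"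
    using idl_prefix[of p C f] by auto
  then have "insert p F \<subseteq> idl C (f ` {..<max m n})"
    by (auto intro: idl_mono)
  then show ?case by blast
qed auto

lemma idl_image_sum:
  assumes "p \<in> idl C (a ` {..<n::nat})"
  shows "\<exists>r. (\<forall>i<n. r i \<in> PF C) \<and> (\<forall>x. p x = (\<Sum>i<n. r i x * a i x))"
  using assms
proof induction
  case zero
  show ?case by (intro exI[of _ "\<lambda>_ _. 0"]) (auto intro: pf_const)
next
  case (step p s f)
  then obtain r i where r: "\<forall>i<n. r i \<in> PF C" "\<forall>x. p x = (\<Sum>i<n. r i x * a i x)"
    and i: "f = a i" "i < n" by auto
  show ?case
  proof (intro exI[of _ "\<lambda>j x. r j x + (if j = i then s x else 0)"] conjI allI impI)
    fix j assume "j < n"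
    then show "(\<lambda>x. r j x + (if j = i then s x else 0)) \<in> PF C"
      using r step by (cases "j = i") (auto intro: pf_add)
  next
    fix x
    show "p x + s x * f x = (\<Sum>j<n. (r j x + (if j = i then s x else 0)) * a j x)"
      using r i by (simp add: distrib_right sum.distrib if_distrib[of "\<lambda>y. y * _"] cong: if_cong)
  qed
qed

text \<open>The ascending chain condition for ideals, stated for sequences of functions; a
  descending chain of closed sets produces such a sequence directly.\<close>

definition noeth :: "('x \<Rightarrow> 'k::comm_ring_1) set \<Rightarrow> bool" where
  "noeth C \<longleftrightarrow> (\<forall>f::nat \<Rightarrow> _. range f \<subseteq> PF C \<longrightarrow> (\<exists>n. f n \<in> idl C (f ` {..<n})))"

lemma noeth_empty: "noeth ({} :: ('x \<Rightarrow> 'k::field) set)"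
  unfolding noeth_def
proof (intro allI impI)
  fix f :: "nat \<Rightarrow> 'x \<Rightarrow> 'k" assume f: "range f \<subseteq> PF {}"
  have "\<exists>c. p = (\<lambda>_. c)" if "p \<in> PF {}" for p :: "'x \<Rightarrow> 'k"
    using that by induction auto
  then have "\<forall>i. \<exists>c. f i = (\<lambda>_. c)" using f by blast
  then obtain c where c: "\<And>i. f i = (\<lambda>_. c i)" by metis
  show "\<exists>n. f n \<in> idl {} (f ` {..<n})"
  proof (cases "c 0 = 0")
    case True
    then show ?thesis by (intro exI[of _ 0]) (simp add: c idl.zero)
  next
    case False
    have "(\<lambda>x. (c 1 / c 0) * f 0 x) \<in> idl {} (f ` {..<1})"
      by (intro idl_mult idl_base pf_const) auto
    then show ?thesis using False by (intro exI[of _ 1]) (simp add: c)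
  qed
qed

text \<open>
  Hilbert's basis theorem: pick successively elements of minimal degree outside the ideal
  generated by the previous ones; a relation between leading coefficients lowers the degree.
\<close>

lemma noeth_insert:
  assumes C: "noeth C"
  shows "noeth (insert t C)"
proof (rule ccontr)
  let ?C = "insert t C"
  assume "\<not> noeth ?C"
  then have "\<exists>f::nat \<Rightarrow> _. range f \<subseteq> PF ?C \<and> (\<forall>n. f n \<notin> idl ?C (f ` {..<n}))"
    unfolding noeth_def by simp
  then obtain f :: "nat \<Rightarrow> _" where f: "range f \<subseteq> PF ?C" and bad: "\<forall>n. f n \<notin> idl ?C (f ` {..<n})"
    by (elim exE conjE) (rule that, assumption+)
  define I where "I = idl ?C (range f)"
  have IPF: "I \<subseteq> PF ?C" using idl_pf f unfolding I_def by blast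
  \<comment> \<open>A finite subset of \<open>I\<close> involves only finitely many members of the
    sequence, so the next member would contradict \<open>bad\<close>.\<close>
  have notfin: "I - idl ?C F \<noteq> {}" if F: "finite F" "F \<subseteq> I" for F
  proof
    assume *: "I - idl ?C F = {}"
    obtain n where "F \<subseteq> idl ?C (f ` {..<n})"
      using idl_prefix_finite[of F ?C f] F unfolding I_def by blast
    moreover have "f n \<in> idl ?C F" using * idl_base[of "f n" "range f" ?C] unfolding I_def by blast
    ultimately show False using bad[rule_format, of n] idl_hull[of "f n" ?C F] by blast
  qed
  define rep where "rep p d P \<longleftrightarrow> polyfam C P \<and> (\<forall>x. p x = poly (P x) (t x)) \<and> (\<forall>x. degree (P x) \<le> d)"
    for p d P
  define mind where "mind p = (LEAST d. \<exists>P. rep p d P)" for p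
  have ex_rep: "\<exists>d P. rep p d P" if "p \<in> I" for p
  proof -
    have "p \<in> PF ?C" using IPF that by blast
    then obtain P where P: "polyfam C P" "\<And>x. p x = poly (P x) (t x)"
      by (rule pf_insert) (rule that, assumption+)
    then show ?thesis using polyfam_degree[OF P(1)] unfolding rep_def by blast
  qed
  have mind: "\<exists>P. rep p (mind p) P" if "p \<in> I" for p
    unfolding mind_def by (rule LeastI_ex[OF ex_rep[OF that]])
  have mind_le: "mind p \<le> d" if "rep p d P" for p d P
    unfolding mind_def by (rule Least_le) (use that in blast)
  define good where "good F p \<longleftrightarrow> p \<in> I - idl ?C F \<and> (\<forall>q\<in>I - idl ?C F. mind p \<le> mind q)" for F p
  define pick where "pick F = (SOME p. good F p)" for F
  have pick: "good F (pick F)" if "finite F" "F \<subseteq> I" for F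
  proof -
    have "\<exists>p0. p0 \<in> I - idl ?C F" using notfin[OF that] by blast
    then obtain p0 where "p0 \<in> I - idl ?C F" ..
    from ex_has_least_nat[of "\<lambda>p. p \<in> I - idl ?C F", OF this, of mind] have "\<exists>p. good F p"
      unfolding good_def by blast
    then show ?thesis unfolding pick_def by (rule someI_ex)
  qed
  define Fs where "Fs = rec_nat {} (\<lambda>_ F. insert (pick F) F)"
  have Fs0: "Fs 0 = {}" and FsS: "Fs (Suc k) = insert (pick (Fs k)) (Fs k)" for k
    by (simp_all add: Fs_def)
  define g where "g k = pick (Fs k)" for k
  have Fs: "Fs k = g ` {..<k}" for k
    by (induction k) (auto simp: Fs0 FsS g_def lessThan_Suc)
  have gI: "finite (Fs k) \<and> Fs k \<subseteq> I" for k
  proof (induction k)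
    case (Suc k)
    then show ?case using pick[of "Fs k"] by (auto simp: FsS good_def)
  qed (simp add: Fs0)
  have good: "good (Fs k) (g k)" for k using pick gI by (simp add: g_def)
  have dmono: "mind (g k) \<le> mind (g l)" if "k \<le> l" for k l
  proof -
    have "Fs k \<subseteq> Fs l" unfolding Fs using that by (intro image_mono) auto
    then have "g l \<in> I - idl ?C (Fs k)"
      using good[of l] idl_mono[of "g l" ?C "Fs k" "Fs l"] by (auto simp: good_def)
    then show ?thesis using good[of k] by (auto simp: good_def)
  qed
  have "\<forall>k. \<exists>P. rep (g k) (mind (g k)) P" using mind good by (auto simp: good_def)
  then obtain P where P: "\<And>k. rep (g k) (mind (g k)) (P k)" by metis
  let ?d = "\<lambda>k. mind (g k)"
  have pfP: "polyfam C (P i)" for i using P unfolding rep_def by blast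
  define a where "a k = (\<lambda>x. coeff (P k x) (?d k))" for k
  have "range a \<subseteq> PF C" using pfP by (auto simp: a_def intro: polyfam_coeff)
  then obtain n where "a n \<in> idl C (a ` {..<n})" using C unfolding noeth_def by blast
  then obtain r where r: "\<And>i. i < n \<Longrightarrow> r i \<in> PF C" "\<And>x. a n x = (\<Sum>i<n. r i x * a i x)"
    using idl_image_sum by blast
  \<comment> \<open>The powers of \<open>t\<close> shift the earlier picks to the degree of
    \<open>g n\<close>, and the \<open>r i\<close> make the leading coefficients cancel in
    \<open>h\<close>. The exponents are genuine differences because the degrees increase along the
    picks.\<close>
  define s where "s i x = - r i x * t x ^ (?d n - ?d i)" for i x
  define h where "h x = g n x + (\<Sum>i<n. s i x * g i x)" for x
  have sPF: "s i \<in> PF ?C" if "i < n" for i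
    unfolding s_def using that r(1)[of i]
    by (intro pf_mult pf_uminus pf_power) (auto intro: pf_coord pf_mono)
  have sumI: "(\<lambda>x. \<Sum>i<n. u i x * g i x) \<in> idl ?C (Fs n)" if "\<And>i. i < n \<Longrightarrow> u i \<in> PF ?C" for u
  proof -
    have "(\<lambda>x. \<Sum>i<k. u i x * g i x) \<in> idl ?C (Fs n)" if "k \<le> n" for k
      using that
    proof (induction k)
      case 0 then show ?case by (simp add: idl.zero)
    next
      case (Suc k)
      then show ?case
        using idl.step[of "\<lambda>x. \<Sum>i<k. u i x * g i x" ?C "Fs n" "u k" "g k"] \<open>\<And>i. i < n \<Longrightarrow> u i \<in> PF ?C\<close>
        by (auto simp: Fs)
    qed
    then show ?thesis by simp
  qed
  have hI: "h \<in> I - idl ?C (Fs n)"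
  proof
    have "idl ?C (Fs n) \<subseteq> I" using gI[of n] idl_hull unfolding I_def by blast
    moreover have "g n \<in> I" using good[of n] by (auto simp: good_def)
    ultimately show "h \<in> I" using sumI[of s, OF sPF] unfolding I_def h_def by (intro idl_add) auto
    show "h \<notin> idl ?C (Fs n)"
    proof
      assume "h \<in> idl ?C (Fs n)"
      from idl_add[OF this sumI[of "\<lambda>i x. - s i x"]] sPF
      have "(\<lambda>x. h x + (\<Sum>i<n. - s i x * g i x)) \<in> idl ?C (Fs n)" by (auto intro: pf_uminus)
      then have "g n \<in> idl ?C (Fs n)" by (simp add: h_def sum_negf)
      then show False using good[of n] by (simp add: good_def)
    qed
  qed
  define Q where "Q x = P n x + (\<Sum>i<n. [:- r i x:] * (monom 1 (?d n - ?d i) * P i x))" for x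
  have Q: "polyfam C Q" unfolding Q_def
    using r(1) by (intro polyfam_add polyfam_sum polyfam_mult polyfam_const polyfam_monom pfP pf_const pf_uminus) auto
  have hQ: "h x = poly (Q x) (t x)" for x
    using P unfolding rep_def h_def Q_def s_def
    by (simp add: poly_sum poly_monom algebra_simps)
  have cQ: "coeff (Q x) j = 0" if "j \<ge> ?d n" for x j
  proof -
    have "coeff (monom 1 (?d n - ?d i) * P i x) j = (if j = ?d n then a i x else 0)" if i: "i \<le> n" for i
    proof -
      have le: "?d i \<le> ?d n" using dmono i by simp
      have dg: "degree (P i x) \<le> ?d i" using P unfolding rep_def by blast
      show ?thesis
      proof (cases "j = ?d n")
        case True
        then show ?thesis using le by (simp add: coeff_monom_mult a_def)
      next
        case False
        then have "j - (?d n - ?d i) > ?d i" using \<open>j \<ge> ?d n\<close> le by simp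
        then show ?thesis using dg False \<open>j \<ge> ?d n\<close> by (simp add: coeff_monom_mult coeff_eq_0)
      qed
    qed
    note c = this
    have "coeff (P n x) j = (if j = ?d n then a n x else 0)"
      using c[of n] by (simp add: coeff_monom_mult)
    moreover have "coeff (\<Sum>i<n. [:- r i x:] * (monom 1 (?d n - ?d i) * P i x)) j
        = (\<Sum>i<n. - r i x * (if j = ?d n then a i x else 0))"
      unfolding coeff_sum by (intro sum.cong refl) (simp add: c)
    ultimately show ?thesis by (simp add: Q_def r(2) sum_negf)
  qed
  show False
  proof (cases "?d n = 0")
    \<comment> \<open>Degree zero is separate because \<open>0 - 1 = 0\<close> gives no smaller
      degree; here the cancellation makes \<open>h\<close> itself zero.\<close>
    case True
    then have "Q x = 0" for x using cQ by (intro poly_eqI) auto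
    then have "h = (\<lambda>_. 0)" using hQ by auto
    then show False using hI by (simp add: idl.zero)
  next
    case False
    have "degree (Q x) \<le> ?d n - 1" for x
      by (rule degree_le) (use cQ False in auto)
    then have "rep h (?d n - 1) Q" using Q hQ unfolding rep_def by blast
    then have "mind h \<le> ?d n - 1" by (rule mind_le)
    moreover have "?d n \<le> mind h" using good[of n] hI by (auto simp: good_def)
    ultimately show False using False by simp
  qed
qed

lemma noeth_finite: "finite C \<Longrightarrow> noeth (C :: ('x \<Rightarrow> 'k::field) set)"
  by (induction rule: finite_induct) (auto intro: noeth_empty noeth_insert)

section \<open>Closed subsets and decomposition into irreducible sets\<close>

definition relclosed :: "('x \<Rightarrow> 'k::idom) set \<Rightarrow> 'x set \<Rightarrow> 'x set \<Rightarrow> bool" where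
  "relclosed C W E \<longleftrightarrow> (\<exists>P\<subseteq>PF C. E = {w \<in> W. \<forall>p\<in>P. p w = 0})"

lemma relclosedE:
  assumes "relclosed C W E"
  obtains P where "P \<subseteq> PF C" "E = {w \<in> W. \<forall>p\<in>P. p w = 0}"
  using assms unfolding relclosed_def by blast

lemma relclosed_self: "relclosed C W W"
  unfolding relclosed_def by (intro exI[of _ "{}"]) auto

lemma relclosed_subset: "relclosed C W E \<Longrightarrow> E \<subseteq> W"
  unfolding relclosed_def by blast

lemma relclosed_trans: "relclosed C E D \<Longrightarrow> relclosed C W E \<Longrightarrow> relclosed C W D"
  unfolding relclosed_def
  by (elim exE conjE, rule_tac x = "P \<union> Pa" in exI) auto

lemma relclosed_zero: "p \<in> PF C \<Longrightarrow> relclosed C W {w \<in> W. p w = 0}"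
  unfolding relclosed_def by (intro exI[of _ "{p}"]) auto

text \<open>Along a strictly descending chain choose \<open>f i\<close> vanishing on
  \<open>S (Suc i)\<close> but not on \<open>S i\<close>. Some \<open>f n\<close> lies in the ideal
  of its predecessors, all of which vanish on \<open>S n\<close>, a contradiction.\<close>

lemma relclosed_wf:
  assumes "finite (C :: ('x \<Rightarrow> 'k::field) set)"
  shows "wf {(D, E). relclosed C W D \<and> relclosed C W E \<and> D \<subset> E}"
  unfolding wf_iff_no_infinite_down_chain
proof
  assume "\<exists>S. \<forall>i. (S (Suc i), S i) \<in> {(D, E). relclosed C W D \<and> relclosed C W E \<and> D \<subset> E}"
  then obtain S where "\<forall>i. (S (Suc i), S i) \<in> {(D, E). relclosed C W D \<and> relclosed C W E \<and> D \<subset> E}" ..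
  then have S: "\<And>i::nat. relclosed C W (S i)" "\<And>i. S (Suc i) \<subset> S i" by simp_all
  have "\<forall>i. \<exists>f. f \<in> PF C \<and> (\<forall>w\<in>S (Suc i). f w = 0) \<and> (\<exists>w\<in>S i. f w \<noteq> 0)"
  proof
    fix i
    obtain P where P: "P \<subseteq> PF C" "S (Suc i) = {w \<in> W. \<forall>p\<in>P. p w = 0}" using S(1)[of "Suc i"] by (elim relclosedE)
    obtain w where w: "w \<in> S i" "w \<notin> S (Suc i)" using S(2)[of i] by blast
    then have "w \<in> W" using relclosed_subset[OF S(1)] by blast
    then obtain p where "p \<in> P" "p w \<noteq> 0" using w P by blast
    then show "\<exists>f. f \<in> PF C \<and> (\<forall>w\<in>S (Suc i). f w = 0) \<and> (\<exists>w\<in>S i. f w \<noteq> 0)" using P w by blast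
  qed
  then obtain f where f: "\<And>i. f i \<in> PF C" "\<And>i w. w \<in> S (Suc i) \<Longrightarrow> f i w = 0" "\<And>i. \<exists>w\<in>S i. f i w \<noteq> 0"
    by metis
  obtain n where n: "f n \<in> idl C (f ` {..<n})"
    using noeth_finite[OF assms] f(1) unfolding noeth_def by blast
  have mono: "S j \<subseteq> S i" if "i \<le> j" for i j
    using lift_Suc_antimono_le[of S i j] S(2) that by blast
  have "f n w = 0" if "w \<in> S n" for w
  proof (rule idl_zero[OF n], rule ballI)
    fix g assume "g \<in> f ` {..<n}"
    then obtain i where i: "g = f i" "Suc i \<le> n" by auto
    then show "g w = 0" using f(2) mono[OF i(2)] that by blast
  qed
  then show False using f(3)[of n] by blast
qed

text \<open>Noetherian induction: if \<open>p * q\<close> vanishes on \<open>E\<close> but neither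
  factor does, then \<open>E\<close> is the union of the two smaller zero sets.\<close>

lemma irr_decomposition:
  assumes "finite (C :: ('x \<Rightarrow> 'k::field) set)" "relclosed C W E"
  shows "\<exists>F. finite F \<and> E = \<Union>F \<and> (\<forall>D\<in>F. relclosed C W D \<and> irr C D)"
  using assms(2)
proof (induction E rule: wf_induct_rule[OF relclosed_wf[OF assms(1), of W]])
  case (1 E)
  show ?case
  proof (cases "E = {} \<or> irr C E")
    case True
    then show ?thesis
    proof
      assume "E = {}" then show ?thesis by (intro exI[of _ "{}"]) auto
    next
      assume "irr C E" then show ?thesis using 1 by (intro exI[of _ "{E}"]) auto
    qed
  next
    case False
    then obtain p q where pq: "p \<in> PF C" "q \<in> PF C" "\<forall>w\<in>E. p w * q w = 0" "\<exists>w\<in>E. p w \<noteq> 0" "\<exists>w\<in>E. q w \<noteq> 0"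
      unfolding irr_def by blast
    have sub: "\<exists>F. finite F \<and> {w \<in> E. s w = 0} = \<Union>F \<and> (\<forall>D\<in>F. relclosed C W D \<and> irr C D)"
      if "s \<in> PF C" "\<exists>w\<in>E. s w \<noteq> 0" for s
    proof (rule "1.IH")
      show *: "relclosed C W {w \<in> E. s w = 0}"
        using relclosed_trans[OF relclosed_zero[OF that(1)] "1.prems"] .
      then show "({w \<in> E. s w = 0}, E) \<in> {(D, E). relclosed C W D \<and> relclosed C W E \<and> D \<subset> E}"
        using "1.prems" that(2) by auto
    qed
    obtain F1 where F1: "finite F1" "{w \<in> E. p w = 0} = \<Union>F1" "\<forall>D\<in>F1. relclosed C W D \<and> irr C D"
      using sub[OF pq(1,4)] by (elim exE conjE) (rule that, assumption+)
    obtain F2 where F2: "finite F2" "{w \<in> E. q w = 0} = \<Union>F2" "\<forall>D\<in>F2. relclosed C W D \<and> irr C D"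
      using sub[OF pq(2,5)] by (elim exE conjE) (rule that, assumption+)
    have "E = {w \<in> E. p w = 0} \<union> {w \<in> E. q w = 0}" using pq(3) by auto
    also have "\<dots> = \<Union>(F1 \<union> F2)" using F1 F2 by simp
    finally show ?thesis using F1 F2 by (intro exI[of _ "F1 \<union> F2"]) auto
  qed
qed

section \<open>From the topology to polynomial functions\<close>

lemma closedin_relclosed:
  assumes "W \<subseteq> Om"
  shows "closedin (subtopology (zariski_topology Om C) W) E \<longleftrightarrow> relclosed C W E"
proof
  assume "closedin (subtopology (zariski_topology Om C) W) E"
  then obtain P where "P \<subseteq> PF C" "E = zero_locus Om P \<inter> W"
    by (auto simp: closedin_subtopology closedin_zariski)
  then show "relclosed C W E" using assms unfolding relclosed_def
    by (intro exI[of _ P]) (auto simp: zero_locus_def)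
next
  assume "relclosed C W E"
  then obtain P where P: "P \<subseteq> PF C" "E = {w \<in> W. \<forall>p\<in>P. p w = 0}" unfolding relclosed_def by blast
  then have "E = zero_locus Om P \<inter> W" using assms by (auto simp: zero_locus_def)
  then show "closedin (subtopology (zariski_topology Om C) W) E"
    using P(1) by (auto simp: closedin_subtopology closedin_zariski)
qed

lemma irreducible_space_irr:
  assumes "E \<subseteq> Om"
  shows "irreducible_space (subtopology (zariski_topology Om C) E) \<longleftrightarrow> irr C E"
proof
  assume irr: "irreducible_space (subtopology (zariski_topology Om C) E)"
  have top: "topspace (subtopology (zariski_topology Om C) E) = E" using assms by auto
  show "irr C E"
    unfolding irr_def
  proof (intro conjI ballI impI)
    show "E \<noteq> {}" using irr unfolding irreducible_space_def top by blast
    fix p q assume pq: "p \<in> PF C" "q \<in> PF C" "\<forall>w\<in>E. p w * q w = 0"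
    have "{w \<in> E. p w = 0} \<union> {w \<in> E. q w = 0} = E" using pq(3) by auto
    moreover have "closedin (subtopology (zariski_topology Om C) E) {w \<in> E. p w = 0}"
      "closedin (subtopology (zariski_topology Om C) E) {w \<in> E. q w = 0}"
      using pq by (auto simp: closedin_relclosed[OF assms] intro: relclosed_zero)
    ultimately have "{w \<in> E. p w = 0} = E \<or> {w \<in> E. q w = 0} = E"
      using irr unfolding irreducible_space_def top by blast
    then show "(\<forall>w\<in>E. p w = 0) \<or> (\<forall>w\<in>E. q w = 0)" by blast
  qed
next
  assume irr: "irr C E"
  have top: "topspace (subtopology (zariski_topology Om C) E) = E" using assms by auto
  show "irreducible_space (subtopology (zariski_topology Om C) E)"
    unfolding irreducible_space_def top closedin_relclosed[OF assms]
  proof (intro conjI allI impI; (elim conjE)?)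
    show "E \<noteq> {}" using irr by (rule irr_nonempty)
    fix E1 E2 assume E: "relclosed C E E1" "relclosed C E E2" "E1 \<union> E2 = E"
    obtain P1 where P1: "P1 \<subseteq> PF C" "E1 = {w \<in> E. \<forall>p\<in>P1. p w = 0}" using E(1) by (elim relclosedE)
    obtain P2 where P2: "P2 \<subseteq> PF C" "E2 = {w \<in> E. \<forall>p\<in>P2. p w = 0}" using E(2) by (elim relclosedE)
    show "E1 = E \<or> E2 = E"
    proof (rule ccontr)
      assume "\<not> ?thesis"
      then obtain p1 p2 where p: "p1 \<in> P1" "\<exists>w\<in>E. p1 w \<noteq> 0" "p2 \<in> P2" "\<exists>w\<in>E. p2 w \<noteq> 0"
        using P1(2) P2(2) by blast
      have "p1 w * p2 w = 0" if "w \<in> E" for w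
        using that E(3) P1(2) P2(2) p by auto
      then show False using irr p P1(1) P2(1) unfolding irr_def by blast
    qed
  qed
qed

lemma irreduciblein_irr:
  assumes "W \<subseteq> Om"
  shows "irreduciblein (subtopology (zariski_topology Om C) W) E \<longleftrightarrow> E \<subseteq> W \<and> irr C E"
proof (cases "E \<subseteq> W")
  case True
  then have "subtopology (subtopology (zariski_topology Om C) W) E = subtopology (zariski_topology Om C) E"
    by (simp add: subtopology_subtopology Int_absorb1)
  then show ?thesis using True assms irreducible_space_irr[of E Om C]
    unfolding irreduciblein_def by auto
qed (auto simp: irreduciblein_def)

subsection \<open>Krull dimension and transcendence degree\<close>

text \<open>For irreducible \<open>W\<close> this is the transcendence degree of its function field;
  for reducible \<open>W\<close>, \<open>dominant_Union\<close> reduces it to the components. On the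
  empty set no family is dominant and the maximum is unspecified.\<close>

definition trdeg :: "('x \<Rightarrow> 'k::idom) set \<Rightarrow> 'x set \<Rightarrow> nat" where
  "trdeg C W = Max {m. \<exists>f. (\<forall>i<m. f i \<in> PF C) \<and> dominant W m f}"

text \<open>The family is dominant on some irreducible component, where \<open>steinitz\<close>
  compares it with the coordinates.\<close>

lemma dominant_le_card:
  fixes C :: "('x \<Rightarrow> 'k::alg_closed_field) set"
  assumes "finite C" "\<And>i. i < m \<Longrightarrow> f i \<in> PF C" "dominant W m f"
  shows "m \<le> card C"
proof -
  obtain F where F: "finite F" "W = \<Union>F" "\<forall>D\<in>F. relclosed C W D \<and> irr C D"
    using irr_decomposition[OF assms(1) relclosed_self, of W] by (elim exE conjE) (rule that, assumption+)
  then obtain D where D: "D \<in> F" "dominant D m f" using dominant_Union[of F m f] assms(3) by blast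
  show ?thesis
  proof (rule steinitz[OF _ assms(1,1) _ _ assms(2) D(2)])
    show "irr C D" using F D by blast
    then show "alg D C z" if "z \<in> C" for z
      using that by (intro alg_self pf_coord irr_nonempty)
  qed (auto intro: pf_coord)
qed

lemma dominant_zero: "W \<noteq> {} \<Longrightarrow> dominant W 0 f"
proof -
  have "\<exists>c. P = (\<lambda>_. c)" if "P \<in> PF (vars 0)" for P :: "(nat \<Rightarrow> 'b::idom) \<Rightarrow> 'b"
    using that by induction (auto simp: vars_def)
  then show "W \<noteq> {} \<Longrightarrow> dominant W 0 f" unfolding dominant_def by fastforce
qed

lemma trdeg_ge:
  fixes C :: "('x \<Rightarrow> 'k::alg_closed_field) set"
  assumes "finite C" "\<And>i. i < m \<Longrightarrow> f i \<in> PF C" "dominant W m f"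
  shows "m \<le> trdeg C W"
  unfolding trdeg_def
proof (rule Max_ge)
  show "finite {m. \<exists>f. (\<forall>i<m. f i \<in> PF C) \<and> dominant W m f}"
    by (rule finite_subset[of _ "{..card C}"]) (auto intro: dominant_le_card[OF assms(1)])
qed (use assms in auto)

lemma trdeg_ex:
  fixes C :: "('x \<Rightarrow> 'k::alg_closed_field) set"
  assumes "finite C" "W \<noteq> {}"
  shows "\<exists>f. (\<forall>i<trdeg C W. f i \<in> PF C) \<and> dominant W (trdeg C W) f"
proof -
  let ?M = "{m. \<exists>f. (\<forall>i<m. f i \<in> PF C) \<and> dominant W m f}"
  have "finite ?M"
    by (rule finite_subset[of _ "{..card C}"]) (auto intro: dominant_le_card[OF assms(1)])
  moreover have "0 \<in> ?M" using dominant_zero[OF assms(2)] by blast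
  ultimately have "Max ?M \<in> ?M" by (intro Max_in) auto
  then show ?thesis by (simp add: trdeg_def)
qed

text \<open>
  A function \<open>g\<close> vanishing on \<open>W'\<close> but not on \<open>W\<close> is independent of \<open>f\<close>: after dividing a relation by a
  power of \<open>g\<close>, its constant term would be a relation for \<open>f\<close> on \<open>W'\<close>.
\<close>

lemma dominant_step:
  fixes C :: "('x \<Rightarrow> 'k::idom) set"
  assumes irr: "irr C W" and W': "relclosed C W W'" "W' \<noteq> W"
    and f: "\<And>i. i < m \<Longrightarrow> f i \<in> PF C" "dominant W' m f"
  shows "\<exists>f. (\<forall>i<Suc m. f i \<in> PF C) \<and> dominant W (Suc m) f"
proof -
  obtain P where P: "P \<subseteq> PF C" "W' = {w \<in> W. \<forall>p\<in>P. p w = 0}" using W'(1) by (elim relclosedE)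
  then obtain g where g: "g \<in> PF C" "nz W g" "\<And>w. w \<in> W' \<Longrightarrow> g w = 0"
    using W'(2) unfolding nz_def by blast
  have W'W: "W' \<subseteq> W" using P by blast
  define f' where "f' = f(m := g)"
  have ff': "(\<lambda>i. f' i w) = (\<lambda>i. f i w)(m := g w)" for w by (auto simp: f'_def)
  have "dominant W (Suc m) f'"
    unfolding dominant_def
  proof (intro ballI impI allI)
    fix A x assume A: "A \<in> PF (vars (Suc m))" "\<forall>w\<in>W. A (\<lambda>i. f' i w) = 0"
    obtain Q where Q: "polyfam (vars m) Q" "\<And>x. A x = poly (Q x) (x m)"
      by (rule pf_insert[OF A(1)[unfolded vars_Suc]]) (rule that, assumption+)
    let ?F = "\<lambda>w i. f i w"
    have QF: "polyfam C (\<lambda>w. Q (?F w))" by (rule polyfam_vars_compose[OF Q(1) f(1)])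
    have eq: "poly (Q (?F w)) (g w) = 0" if "w \<in> W" for w
    proof -
      have "Q ((\<lambda>i. f i w)(m := g w)) = Q (?F w)" by (rule polyfam_vars_cong[OF Q(1)]) auto
      then show ?thesis using A(2)[rule_format, OF that] Q(2) ff' by simp
    qed
    have coef: "coeff (Q (?F w)) i = 0" if "w \<in> W" for w i
    proof -
      have "\<forall>w\<in>W. coeff (Q (?F w)) i = 0"
      proof (induction i rule: less_induct)
        case (less i)
        let ?R = "\<lambda>w. poly_shift i (Q (?F w))"
        have "polyfam C ?R"
        proof -
          obtain d where d: "\<And>x. degree (Q x) \<le> d" using polyfam_degree[OF Q(1)] by blast
          have "degree (?R w) \<le> d" for w
          proof (rule degree_le, intro allI impI)
            fix j assume "d < j"
            then have "degree (Q (?F w)) < j + i" using d[of "?F w"] by simp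
            then show "coeff (?R w) j = 0" by (simp add: coeff_poly_shift coeff_eq_0)
          qed
          then show ?thesis using polyfam_coeff[OF QF] by (intro polyfamI) (auto simp: coeff_poly_shift)
        qed
        then have RPF: "(\<lambda>w. poly (?R w) (g w)) \<in> PF C"
          by (rule polyfam_poly) (use g in \<open>auto intro: pf_coord\<close>)
        have dec: "poly (Q (?F w)) y = y ^ i * poly (?R w) y" if "w \<in> W" for w y
        proof -
          have "Q (?F w) = monom 1 i * ?R w"
            by (rule poly_eqI) (use less that in \<open>auto simp: coeff_monom_mult coeff_poly_shift\<close>)
          then show ?thesis by (metis mult_1 poly_monom poly_mult)
        qed
        have Rz: "poly (?R w) (g w) = 0" if "w \<in> W" for w
          by (rule irr_cancel[OF irr _ RPF irr_nz_power[OF irr g(1,2), of i] _ that])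
             (use g eq dec in \<open>auto intro: pf_power\<close>)
        have "coeff (Q x) i = 0" for x
        proof (rule dominantD[OF f(2) polyfam_coeff[OF Q(1)]])
          fix w assume w: "w \<in> W'"
          then have "poly (?R w) 0 = 0" using Rz W'W g(3) by (metis subsetD)
          then show "coeff (Q (?F w)) i = 0" by (simp add: poly_0_coeff_0 coeff_poly_shift)
        qed
        then show ?case by simp
      qed
      then show ?thesis using that by blast
    qed
    have "coeff (Q x) i = 0" for i
      by (rule dominantD[OF f(2) polyfam_coeff[OF Q(1)]]) (use coef W'W in blast)
    then have "Q x = 0" by (intro poly_eqI) simp
    then show "A x = 0" by (simp add: Q(2))
  qed
  moreover have "f' i \<in> PF C" if "i < Suc m" for i
    using that f(1)[of i] g(1) by (auto simp: f'_def less_Suc_eq)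
  ultimately show ?thesis by blast
qed

text \<open>The next smaller member of the chain is a component of a generic level set of the last function.\<close>

lemma chain_exists:
  fixes f :: "nat \<Rightarrow> 'x \<Rightarrow> 'k::alg_closed_field"
  assumes fin: "finite C" and chart: "\<And>c. \<exists>x\<in>Om. \<forall>z\<in>C. z x = c z" and b: "b \<in> PF C"
  shows "irr C W \<Longrightarrow> (\<And>i. i < m \<Longrightarrow> f i \<in> PF C) \<Longrightarrow> dominant W m f \<Longrightarrow> nz W b \<Longrightarrow>
    (\<And>x. x \<in> zclosure Om C W \<Longrightarrow> b x \<noteq> 0 \<Longrightarrow> x \<in> W) \<Longrightarrow>
    \<exists>c. (\<forall>k\<le>m. relclosed C W (c k) \<and> irr C (c k)) \<and> (\<forall>k<m. c k \<subset> c (Suc k)) \<and> c m = W"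
proof (induction m arbitrary: W)
  case 0
  then show ?case by (intro exI[of _ "\<lambda>_. W"]) (auto intro: relclosed_self)
next
  case (Suc m)
  note irr = Suc.prems(1) and lc = Suc.prems(5)
  obtain h c where h: "h \<in> PF (vars (Suc m))" "h c \<noteq> 0"
    "\<And>c. h c \<noteq> 0 \<Longrightarrow> \<exists>w\<in>W. b w \<noteq> 0 \<and> (\<forall>i<Suc m. f i w = c i)"
    using dominant_image_open[OF irr fin chart Suc.prems(2,3) b Suc.prems(4) lc] by blast
  let ?W = "{w \<in> W. f m w - c m = 0}"
  have cl: "relclosed C W ?W" by (rule relclosed_zero) (auto intro!: pf_diff pf_const Suc.prems)
  obtain F where F: "finite F" "?W = \<Union>F" "\<forall>D\<in>F. relclosed C W D \<and> irr C D"
    using irr_decomposition[OF fin cl] by (elim exE conjE) (rule that, assumption+)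
  \<comment> \<open>Only components meeting the open set \<open>b \<noteq> 0\<close> are kept,
    because agreement with the closure is known only there. The level is chosen so that the map
    attains generic values at points of this open set.\<close>
  let ?F = "{D \<in> F. nz D b}"
  let ?h = "\<lambda>x. h (x(m := c m))"
  have h': "?h \<in> PF (vars m)"
  proof (rule pf_compose[OF h(1)])
    fix g assume "g \<in> (vars (Suc m) :: ((nat \<Rightarrow> 'k) \<Rightarrow> 'k) set)"
    then obtain i where i: "g = (\<lambda>x. x i)" "i < Suc m" by (auto simp: vars_def)
    then show "(\<lambda>w. g (w(m := c m))) \<in> PF (vars m)"
      by (cases "i = m") (auto intro: pf_const pf_vars_var)
  qed
  have "dominant (\<Union>?F) m f"
    unfolding dominant_def
  proof (intro ballI impI allI, rule ccontr)
    fix P x assume P: "P \<in> PF (vars m)" "\<forall>w\<in>\<Union>?F. P (\<lambda>i. f i w) = 0" "P x \<noteq> 0"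
    have "?h c \<noteq> 0" using h(2) by simp
    from pf_vars_domain[OF P(1) h' P(3) this] obtain y where y: "P y \<noteq> 0" "?h y \<noteq> 0" by blast
    obtain w where w: "w \<in> W" "b w \<noteq> 0" "\<forall>i<Suc m. f i w = (y(m := c m)) i" using h(3)[OF y(2)] by blast
    then have "w \<in> ?W" by auto
    then have "w \<in> \<Union>?F" using F(2) w(2) by (auto simp: nz_def)
    then have "P (\<lambda>i. f i w) = 0" using P(2) by blast
    moreover have "P (\<lambda>i. f i w) = P y" by (rule pf_vars_cong[OF P(1)]) (use w(3) in auto)
    ultimately show False using y(1) by simp
  qed
  then obtain D where D: "D \<in> F" "nz D b" "dominant D m f"
    using dominant_Union[of ?F m f] F(1) by auto
  have D': "relclosed C W D" "irr C D" "D \<subseteq> ?W" using F D(1) by auto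
  have lcD: "x \<in> D" if x: "x \<in> zclosure Om C D" "b x \<noteq> 0" for x
  proof -
    have "x \<in> zclosure Om C W" using x(1) D'(3) unfolding zclosure_def by blast
    then have "x \<in> W" using lc x(2) by blast
    obtain P where P: "P \<subseteq> PF C" "D = {w \<in> W. \<forall>p\<in>P. p w = 0}" using D'(1) by (elim relclosedE)
    have "p x = 0" if "p \<in> P" for p
      by (rule zclosureD[OF x(1)]) (use that P in auto)
    then show ?thesis using P \<open>x \<in> W\<close> by simp
  qed
  obtain ch where ch: "\<forall>k\<le>m. relclosed C D (ch k) \<and> irr C (ch k)" "\<forall>k<m. ch k \<subset> ch (Suc k)" "ch m = D"
    using Suc.IH[OF D'(2) _ D(3,2) lcD] Suc.prems(2) by auto
  have "D \<noteq> W"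
  proof
    assume "D = W"
    then have "f m w - c m = 0" if "w \<in> W" for w using D'(3) that by blast
    then have "(\<lambda>_. c m + 1) m - c m = 0"
      using dominantD[OF Suc.prems(3), of "\<lambda>x. x m - c m" "\<lambda>_. c m + 1"]
      by (simp add: pf_diff pf_const pf_vars_var)
    then show False by simp
  qed
  then have "D \<subset> W" using D'(3) by blast
  then show ?case using ch relclosed_trans[OF _ D'(1)] irr
    by (intro exI[of _ "ch(Suc m := W)"]) (auto simp: le_Suc_eq less_Suc_eq relclosed_self)
qed

text \<open>Near each of its points \<open>W\<close> agrees with its closure. Closedness would be
  too strong, since automorphisms are singled out among linear maps by the open condition of
  invertibility as well.\<close>

definition loc_closed :: "'x set \<Rightarrow> ('x \<Rightarrow> 'k::idom) set \<Rightarrow> 'x set \<Rightarrow> bool" where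
  "loc_closed Om C W \<longleftrightarrow> W \<subseteq> Om \<and>
     (\<forall>w\<in>W. \<exists>b\<in>PF C. b w \<noteq> 0 \<and> (\<forall>x\<in>zclosure Om C W. b x \<noteq> 0 \<longrightarrow> x \<in> W))"

lemma loc_closed_relclosed:
  assumes "loc_closed Om C W" "relclosed C W D"
  shows "loc_closed Om C D"
proof -
  obtain P where P: "P \<subseteq> PF C" "D = {w \<in> W. \<forall>p\<in>P. p w = 0}" using assms(2) by (elim relclosedE)
  have cl: "x \<in> D" if "x \<in> W" "x \<in> zclosure Om C D" for x
    using that P zclosureD[OF that(2)] by blast
  have "zclosure Om C D \<subseteq> zclosure Om C W" using P unfolding zclosure_def by blast
  moreover have "D \<subseteq> W" using P(2) by blast
  moreover have "W \<subseteq> Om" using assms(1) by (simp add: loc_closed_def)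
  ultimately show ?thesis
    unfolding loc_closed_def
  proof (intro conjI ballI)
    fix w assume "w \<in> D"
    then have "w \<in> W" using \<open>D \<subseteq> W\<close> by blast
    then obtain b where "b \<in> PF C" "b w \<noteq> 0" "\<forall>x\<in>zclosure Om C W. b x \<noteq> 0 \<longrightarrow> x \<in> W"
      using assms(1) unfolding loc_closed_def by blast
    then show "\<exists>b\<in>PF C. b w \<noteq> 0 \<and> (\<forall>x\<in>zclosure Om C D. b x \<noteq> 0 \<longrightarrow> x \<in> D)"
      using cl \<open>zclosure Om C D \<subseteq> zclosure Om C W\<close> by (intro bexI[of _ b]) auto
  qed auto
qed

text \<open>Each strict inclusion of a chain adds an independent function by
  \<open>dominant_step\<close>. Conversely, a maximal dominant family stays dominant on one
  irreducible component, in which \<open>chain_exists\<close> builds a chain of that length.\<close>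

theorem krull_dim_trdeg:
  fixes C :: "('x \<Rightarrow> 'k::alg_closed_field) set"
  assumes fin: "finite C" and chart: "\<And>c. \<exists>x\<in>Om. \<forall>z\<in>C. z x = c z"
    and lc: "loc_closed Om C W" and W: "W \<noteq> {}"
  shows "krull_dim (subtopology (zariski_topology Om C) W) = ereal (real (trdeg C W))"
proof -
  have WOm: "W \<subseteq> Om" using lc by (simp add: loc_closed_def)
  let ?ch = "\<lambda>n c. (\<forall>k\<le>n. relclosed C W (c k) \<and> irr C (c k)) \<and> (\<forall>k<n::nat. c k \<subset> c (Suc k))"
  have eq: "krull_dim (subtopology (zariski_topology Om C) W) = Sup {ereal (real n) | n. \<exists>c. ?ch n c}"
    proof -
    have "(closedin (subtopology (zariski_topology Om C) W) E \<and>
        irreduciblein (subtopology (zariski_topology Om C) W) E) \<longleftrightarrow> relclosed C W E \<and> irr C E" for E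
      unfolding closedin_relclosed[OF WOm] irreduciblein_irr[OF WOm] using relclosed_subset[of C W E] by blast
    then show ?thesis unfolding krull_dim_def by simp
  qed
  have up: "n \<le> trdeg C W" if c: "?ch n c" for n c
  proof -
    have "\<exists>f. (\<forall>i<k. f i \<in> PF C) \<and> dominant (c k) k f" if "k \<le> n" for k
      using that
    proof (induction k)
      case 0
      then show ?case using c[THEN conjunct1, rule_format, of 0] dominant_zero[of "c 0"] irr_nonempty[of C "c 0"] by blast
    next
      case (Suc k)
      then obtain f where f: "\<forall>i<k. f i \<in> PF C" "dominant (c k) k f" by auto
      have irr: "irr C (c (Suc k))" and sub: "c k \<subset> c (Suc k)" using c Suc.prems by auto
      obtain P where P: "P \<subseteq> PF C" "c k = {w \<in> W. \<forall>p\<in>P. p w = 0}" using c[THEN conjunct1, rule_format, of k] Suc.prems by (auto elim: relclosedE)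
      have "c (Suc k) \<subseteq> W" using c Suc.prems relclosed_subset[of C W "c (Suc k)"] by blast
      then have "relclosed C (c (Suc k)) (c k)" unfolding relclosed_def
        using P sub by (intro exI[of _ P]) auto
      then show ?case using dominant_step[OF irr, of "c k" k f] f sub by auto
    qed
    from this[of n] obtain f where f: "\<forall>i<n. f i \<in> PF C" "dominant (c n) n f" by auto
    have "c n \<subseteq> W" using c relclosed_subset[of C W "c n"] by blast
    then show ?thesis using trdeg_ge[OF fin, of n f W] f dominant_subset[of "c n" n f W] by blast
  qed
  obtain f where f: "\<And>i. i < trdeg C W \<Longrightarrow> f i \<in> PF C" "dominant W (trdeg C W) f"
    using trdeg_ex[OF fin W] by blast
  obtain F where F: "finite F" "W = \<Union>F" "\<forall>D\<in>F. relclosed C W D \<and> irr C D"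
    using irr_decomposition[OF fin relclosed_self, of W] by (elim exE conjE) (rule that, assumption+)
  then obtain D where D: "D \<in> F" "dominant D (trdeg C W) f" using dominant_Union[of F "trdeg C W" f] f(2) by blast
  have D': "relclosed C W D" "irr C D" using F(3) D(1) by auto
  obtain w where w: "w \<in> D" using irr_nonempty[OF D'(2)] by blast
  obtain b where b: "b \<in> PF C" "b w \<noteq> 0" "\<forall>x\<in>zclosure Om C D. b x \<noteq> 0 \<longrightarrow> x \<in> D"
    using loc_closed_relclosed[OF lc D'(1)] w unfolding loc_closed_def by blast
  have "nz D b" using w b by (auto simp: nz_def)
  then obtain c where "\<forall>k\<le>trdeg C W. relclosed C D (c k) \<and> irr C (c k)" "\<forall>k<trdeg C W. c k \<subset> c (Suc k)"
    using chain_exists[OF fin chart b(1) D'(2) f(1) D(2)] b(3) by blast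
  then have "?ch (trdeg C W) c" using relclosed_trans[OF _ D'(1)] by blast
  then show ?thesis unfolding eq
    by (intro antisym Sup_least Sup_upper) (use up in auto)
qed

lemma pf_pull:
  assumes "p \<in> PF C" "\<And>f. f \<in> C \<Longrightarrow> \<exists>q\<in>PF D. \<forall>w\<in>W. f (h w) = q w"
  shows "\<exists>q\<in>PF D. \<forall>w\<in>W. p (h w) = q w"
proof -
  have "(\<lambda>w. p (h w)) \<in> PF ((\<lambda>f w. f (h w)) ` C)"
    by (rule pf_compose[OF assms(1)]) (auto intro: pf_coord)
  then show ?thesis by (rule pf_cong_on) (use assms(2) in auto)
qed

lemma irr_image:
  assumes "irr D W" "\<And>f. f \<in> C \<Longrightarrow> \<exists>q\<in>PF D. \<forall>w\<in>W. f (h w) = q w"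
  shows "irr C (h ` W)"
  unfolding irr_def
proof (intro conjI ballI impI)
  show "h ` W \<noteq> {}" using irr_nonempty[OF assms(1)] by simp
  fix p q assume pq: "p \<in> PF C" "q \<in> PF C" "\<forall>w\<in>h ` W. p w * q w = 0"
  obtain p' where p': "p' \<in> PF D" "\<forall>w\<in>W. p (h w) = p' w" using pf_pull[OF pq(1), of D W h] assms(2) by blast
  obtain q' where q': "q' \<in> PF D" "\<forall>w\<in>W. q (h w) = q' w" using pf_pull[OF pq(2), of D W h] assms(2) by blast
  have "\<forall>w\<in>W. p' w * q' w = 0" using pq(3) p'(2) q'(2) by auto
  then have "(\<forall>w\<in>W. p' w = 0) \<or> (\<forall>w\<in>W. q' w = 0)" using assms(1) p'(1) q'(1) unfolding irr_def by blast
  then show "(\<forall>w\<in>h ` W. p w = 0) \<or> (\<forall>w\<in>h ` W. q w = 0)" using p'(2) q'(2) by auto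
qed

lemma irr_cong:
  assumes "irr D W" "\<And>f. f \<in> C \<Longrightarrow> \<exists>q\<in>PF D. \<forall>w\<in>W. f w = q w"
  shows "irr C W"
  using irr_image[of D W C "\<lambda>w. w"] assms by simp

lemma irr_nz_prod:
  assumes "irr C W" "\<And>i. i \<in> I \<Longrightarrow> p i \<in> PF C \<and> nz W (p i)"
  shows "nz W (\<lambda>w. \<Prod>i\<in>I. p i w)"
  using assms(2)
proof (induction I rule: infinite_finite_induct)
  case (insert i I)
  have "nz W (\<lambda>w. p i w * (\<Prod>i\<in>I. p i w))"
    using insert.prems insert.IH by (intro irr_nz_mult[OF assms(1)] pf_prod) auto
  then show ?case using insert.hyps by simp
qed (auto intro: nz_one[OF assms(1)])

text \<open>Otherwise each \<open>E\<close> is contained in the zero set of a function that is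
  nonzero on \<open>D\<close>; the product of these functions is nonzero on \<open>D\<close> and yet
  vanishes there.\<close>

lemma irr_subset_Union:
  assumes "irr C D" "finite F" "\<And>E. E \<in> F \<Longrightarrow> relclosed C H E" "D \<subseteq> H" "D \<subseteq> \<Union>F"
  shows "\<exists>E\<in>F. D \<subseteq> E"
proof (rule ccontr)
  assume not: "\<not> ?thesis"
  have "\<forall>E\<in>F. \<exists>p. p \<in> PF C \<and> (\<forall>w\<in>E. p w = 0) \<and> nz D p"
  proof
    fix E assume E: "E \<in> F"
    obtain P where P: "P \<subseteq> PF C" "E = {w \<in> H. \<forall>p\<in>P. p w = 0}"
      using assms(3)[OF E] by (elim relclosedE)
    obtain w where "w \<in> D" "w \<notin> E" using not E by blast
    then obtain p where "p \<in> P" "p w \<noteq> 0" using P(2) assms(4) by blast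
    then show "\<exists>p. p \<in> PF C \<and> (\<forall>w\<in>E. p w = 0) \<and> nz D p"
      using P \<open>w \<in> D\<close> unfolding nz_def by blast
  qed
  then obtain p where p: "\<And>E. E \<in> F \<Longrightarrow> p E \<in> PF C \<and> (\<forall>w\<in>E. p E w = 0) \<and> nz D (p E)" by metis
  then have "nz D (\<lambda>w. \<Prod>E\<in>F. p E w)" by (intro irr_nz_prod[OF assms(1)]) auto
  moreover have "(\<Prod>E\<in>F. p E w) = 0" if w: "w \<in> D" for w
  proof -
    obtain E where "E \<in> F" "w \<in> E" using assms(5) w by blast
    then show ?thesis using p[of E] assms(2) by (intro prod_zero) auto
  qed
  ultimately show False by (simp add: nz_def)
qed

subsection \<open>Openness of linear independence\<close>

text \<open>The column set \<open>L\<close> may be infinite; below it is once the whole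
  stabilizer.\<close>

definition rows_indep :: "'i set \<Rightarrow> 'l set \<Rightarrow> ('i \<Rightarrow> 'l \<Rightarrow> 'k::comm_ring_1) \<Rightarrow> bool" where
  "rows_indep I L a \<longleftrightarrow> (\<forall>c. (\<forall>l\<in>L. (\<Sum>k\<in>I. c k * a k l) = 0) \<longrightarrow> (\<forall>k\<in>I. c k = 0))"

lemma rows_indepD: "rows_indep I L a \<Longrightarrow> (\<And>l. l \<in> L \<Longrightarrow> (\<Sum>k\<in>I. c k * a k l) = 0) \<Longrightarrow> k \<in> I \<Longrightarrow> c k = 0"
  unfolding rows_indep_def by blast

lemma rows_indep_cong: "rows_indep I L a \<Longrightarrow> (\<And>k l. k \<in> I \<Longrightarrow> l \<in> L \<Longrightarrow> a k l = b k l) \<Longrightarrow> rows_indep I L b"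
  unfolding rows_indep_def by simp

text \<open>In place of a minor, \<open>D\<close> is the product of the pivots of a fraction-free
  elimination carried out at \<open>x0\<close>.\<close>

lemma rows_indep_open_aux:
  fixes a :: "'i \<Rightarrow> 'l \<Rightarrow> 'x \<Rightarrow> 'k::field"
  assumes "finite I"
  shows "(\<And>k l. k \<in> I \<Longrightarrow> l \<in> L \<Longrightarrow> a k l \<in> PF C) \<Longrightarrow> rows_indep I L (\<lambda>k l. a k l x0) \<Longrightarrow>
    \<exists>D\<in>PF C. D x0 \<noteq> 0 \<and> (\<forall>x. D x \<noteq> 0 \<longrightarrow> rows_indep I L (\<lambda>k l. a k l x))"
  using assms
proof (induction I arbitrary: a rule: finite_induct)
  case empty
  show ?case by (intro bexI[of _ "\<lambda>_. 1"]) (auto simp: rows_indep_def intro: pf_const)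
next
  case (insert n I)
  note pf = insert.prems(1) and ind = insert.prems(2)
  have "\<exists>l\<in>L. a n l x0 \<noteq> 0"
  proof (rule ccontr)
    assume *: "\<not> ?thesis"
    have "(\<lambda>k. if k = n then 1 else 0) n = (0::'k)"
    proof (rule rows_indepD[OF ind, where c = "\<lambda>k. if k = n then 1 else 0"])
      fix l assume "l \<in> L"
      then show "(\<Sum>k\<in>insert n I. (if k = n then 1 else 0) * a k l x0) = 0"
        using * by (intro sum.neutral) auto
    qed auto
    then show False by simp
  qed
  then obtain l0 where l0: "l0 \<in> L" "a n l0 x0 \<noteq> 0" by blast
  define b where "b k l x = a n l0 x * a k l x - a k l0 x * a n l x" for k l x
  have sumb: "(\<Sum>k\<in>I. c k * b k l x) = a n l0 x * (\<Sum>k\<in>I. c k * a k l x) - (\<Sum>k\<in>I. c k * a k l0 x) * a n l x"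
    for c l x by (simp add: b_def sum_subtractf algebra_simps sum_distrib_left sum_distrib_right)
  have "b k l \<in> PF C" if "k \<in> I" "l \<in> L" for k l
    unfolding b_def using that l0 by (intro pf_diff pf_mult pf) auto
  moreover have "rows_indep I L (\<lambda>k l. b k l x0)"
    unfolding rows_indep_def
  proof (intro allI impI ballI)
    fix c k assume c: "\<forall>l\<in>L. (\<Sum>k\<in>I. c k * b k l x0) = 0" and k: "k \<in> I"
    let ?c = "\<lambda>k. if k = n then - (\<Sum>k\<in>I. c k * a k l0 x0) else a n l0 x0 * c k"
    have "?c k = 0"
    proof (rule rows_indepD[OF ind, where c = ?c])
      fix l assume l: "l \<in> L"
      have "(\<Sum>k\<in>I. ?c k * a k l x0) = a n l0 x0 * (\<Sum>k\<in>I. c k * a k l x0)"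
        unfolding sum_distrib_left using insert.hyps(2) by (intro sum.cong) auto
      then show "(\<Sum>k\<in>insert n I. ?c k * a k l x0) = 0"
        using c[rule_format, OF l] insert.hyps by (simp add: sumb)
    qed (use k in auto)
    moreover have "k \<noteq> n" using k insert.hyps(2) by blast
    ultimately show "c k = 0" using l0(2) by simp
  qed
  ultimately obtain D where D: "D \<in> PF C" "D x0 \<noteq> 0" "\<And>x. D x \<noteq> 0 \<Longrightarrow> rows_indep I L (\<lambda>k l. b k l x)"
    using insert.IH[of b] by blast
  show ?case
  proof (intro bexI[of _ "\<lambda>x. a n l0 x * D x"] conjI allI impI)
    show "a n l0 x0 * D x0 \<noteq> 0" using l0 D by simp
    show "(\<lambda>x. a n l0 x * D x) \<in> PF C" using l0 D by (intro pf_mult pf) auto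
    fix x assume x: "a n l0 x * D x \<noteq> 0"
    then have Dx: "rows_indep I L (\<lambda>k l. b k l x)" using D(3) by auto
    show "rows_indep (insert n I) L (\<lambda>k l. a k l x)"
      unfolding rows_indep_def
    proof (intro allI impI)
      fix c assume c: "\<forall>l\<in>L. (\<Sum>k\<in>insert n I. c k * a k l x) = 0"
      have c': "(\<Sum>k\<in>I. c k * a k l x) = - c n * a n l x" if "l \<in> L" for l
        using c[rule_format, OF that] insert.hyps by (simp add: add_eq_0_iff)
      have cI: "c k = 0" if "k \<in> I" for k
        by (rule rows_indepD[OF Dx _ that]) (simp add: sumb c' l0(1))
      then have "c n * a n l0 x = 0" using c'[OF l0(1)] by simp
      then have "c n = 0" using x by auto
      then show "\<forall>k\<in>insert n I. c k = 0" using cI by auto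
    qed
  qed
qed

lemma rows_indep_open:
  fixes a :: "'i \<Rightarrow> 'l \<Rightarrow> 'x \<Rightarrow> 'k::field"
  assumes "finite I" "\<And>k l. k \<in> I \<Longrightarrow> l \<in> L \<Longrightarrow> \<exists>q\<in>PF C. \<forall>x\<in>Om. a k l x = q x"
    "x0 \<in> Om" "rows_indep I L (\<lambda>k l. a k l x0)"
  shows "\<exists>D\<in>PF C. D x0 \<noteq> 0 \<and> (\<forall>x\<in>Om. D x \<noteq> 0 \<longrightarrow> rows_indep I L (\<lambda>k l. a k l x))"
proof -
  have "\<forall>k l. \<exists>q. k \<in> I \<longrightarrow> l \<in> L \<longrightarrow> q \<in> PF C \<and> (\<forall>x\<in>Om. a k l x = q x)" using assms(2) by blast
  then obtain a' where a': "\<And>k l. k \<in> I \<Longrightarrow> l \<in> L \<Longrightarrow> a' k l \<in> PF C \<and> (\<forall>x\<in>Om. a k l x = a' k l x)"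
    by metis
  have "rows_indep I L (\<lambda>k l. a' k l x0)"
    by (rule rows_indep_cong[OF assms(4)]) (use a' assms(3) in auto)
  then obtain D where D: "D \<in> PF C" "D x0 \<noteq> 0" "\<And>x. D x \<noteq> 0 \<Longrightarrow> rows_indep I L (\<lambda>k l. a' k l x)"
    using rows_indep_open_aux[OF assms(1), of L a' C x0] a' by blast
  have "rows_indep I L (\<lambda>k l. a k l x)" if "x \<in> Om" "D x \<noteq> 0" for x
    by (rule rows_indep_cong[OF D(3)[OF that(2)]]) (use a' that in auto)
  then show ?thesis using D by blast
qed

text \<open>Among the ways of writing \<open>P\<close> as a sum of products of functions in separate
  variables, one with the fewest terms has independent second factors: a dependence would eliminate
  one of them and shorten the sum.\<close>

lemma tensor_decomposition:
  fixes P :: "(nat \<Rightarrow> 'k::field) \<Rightarrow> 'k"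
  assumes "P \<in> PF (vars (e + s))"
  shows "\<exists>(I::nat set) p q. finite I \<and> (\<forall>k\<in>I. p k \<in> PF (vars e)) \<and> (\<forall>k\<in>I. q k \<in> PF (vars s)) \<and>
    (\<forall>x. P x = (\<Sum>k\<in>I. p k x * q k (\<lambda>i. x (e + i)))) \<and> rows_indep I UNIV q"
proof -
  define T where "T n I p q \<longleftrightarrow> finite I \<and> card I = n \<and> (\<forall>k\<in>I. p k \<in> PF (vars e)) \<and> (\<forall>k\<in>I. q k \<in> PF (vars s)) \<and>
    (\<forall>x. P x = (\<Sum>k\<in>I. p k x * q k (\<lambda>i. x (e + i))))"
    for n and I :: "nat set" and p q
  let ?t = "\<lambda>(p :: (nat \<Rightarrow> 'k) \<Rightarrow> 'k) (q :: (nat \<Rightarrow> 'k) \<Rightarrow> 'k) x. p x * q (\<lambda>i. x (e + i))"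
  have "\<exists>l. (\<forall>(p, q)\<in>set l. p \<in> PF (vars e) \<and> q \<in> PF (vars s)) \<and>
      (\<forall>x. P x = (\<Sum>(p, q)\<leftarrow>l. ?t p q x))"
    using assms
  proof induction
    case (const c)
    show ?case by (intro exI[of _ "[(\<lambda>_. c, \<lambda>_. 1)]"]) (auto intro: pf_const)
  next
    case (coord f)
    then obtain i where i: "f = (\<lambda>x. x i)" "i < e + s" by (auto simp: vars_def)
    show ?case
    proof (cases "i < e")
      case True
      then show ?thesis using i
        by (intro exI[of _ "[(\<lambda>x. x i, \<lambda>_. 1)]"]) (auto intro: pf_const pf_vars_var)
    next
      case False
      then show ?thesis using i
        by (intro exI[of _ "[(\<lambda>_. 1, \<lambda>x. x (i - e))]"]) (auto intro!: pf_const pf_vars_var)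
    qed
  next
    case (add P Q)
    then obtain l1 l2 where "\<forall>(p, q)\<in>set l1. p \<in> PF (vars e) \<and> q \<in> PF (vars s)"
      "\<forall>x. P x = (\<Sum>(p, q)\<leftarrow>l1. ?t p q x)" "\<forall>(p, q)\<in>set l2. p \<in> PF (vars e) \<and> q \<in> PF (vars s)"
      "\<forall>x. Q x = (\<Sum>(p, q)\<leftarrow>l2. ?t p q x)" by blast
    then show ?case by (intro exI[of _ "l1 @ l2"]) auto
  next
    case (mult P Q)
    then obtain l1 l2 where l: "\<forall>(p, q)\<in>set l1. p \<in> PF (vars e) \<and> q \<in> PF (vars s)"
      "\<forall>x. P x = (\<Sum>(p, q)\<leftarrow>l1. ?t p q x)" "\<forall>(p, q)\<in>set l2. p \<in> PF (vars e) \<and> q \<in> PF (vars s)"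
      "\<forall>x. Q x = (\<Sum>(p, q)\<leftarrow>l2. ?t p q x)" by blast
    let ?m = "\<lambda>(p :: (nat \<Rightarrow> 'k) \<Rightarrow> 'k, q :: (nat \<Rightarrow> 'k) \<Rightarrow> 'k) (p' :: (nat \<Rightarrow> 'k) \<Rightarrow> 'k, q' :: (nat \<Rightarrow> 'k) \<Rightarrow> 'k). (\<lambda>x. p x * p' x, \<lambda>x. q x * q' x)"
    have one: "(\<Sum>(p, q)\<leftarrow>map (?m a) l. ?t p q x) = ?t (fst a) (snd a) x * (\<Sum>(p, q)\<leftarrow>l. ?t p q x)"
      for a :: "((nat \<Rightarrow> 'k) \<Rightarrow> 'k) \<times> ((nat \<Rightarrow> 'k) \<Rightarrow> 'k)" and l x
      by (induction l) (auto simp: algebra_simps split: prod.splits)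
    have "(\<Sum>(p, q)\<leftarrow>concat (map (\<lambda>a. map (?m a) l2) l). ?t p q x) =
        (\<Sum>(p, q)\<leftarrow>l. ?t p q x) * (\<Sum>(p, q)\<leftarrow>l2. ?t p q x)" for l x
    proof (induction l)
      case (Cons a l)
      then show ?case by (simp only: list.map concat.simps map_append sum_list_append one)
        (simp add: algebra_simps split: prod.splits)
    qed simp
    moreover have "\<forall>(p, q)\<in>set (concat (map (\<lambda>a. map (?m a) l2) l1)). p \<in> PF (vars e) \<and> q \<in> PF (vars s)"
      using l(1,3) by (fastforce intro: pf_mult)
    ultimately show ?case using l(2,4) by (intro exI[of _ "concat (map (\<lambda>a. map (?m a) l2) l1)"]) auto
  qed
  then obtain l where l: "\<forall>(p, q)\<in>set l. p \<in> PF (vars e) \<and> q \<in> PF (vars s)"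
    "\<forall>x. P x = (\<Sum>(p, q)\<leftarrow>l. ?t p q x)" by blast
  have "T (length l) {..<length l} (\<lambda>k. fst (l ! k)) (\<lambda>k. snd (l ! k))"
    unfolding T_def using l
    by (auto simp: sum_list_sum_nth atLeast0LessThan case_prod_beta)
  then have "\<exists>n. \<exists>I p q. T n I p q" by blast
  from exists_least_iff[THEN iffD1, OF this] obtain n I p q where T: "T n I p q"
    and min: "\<And>m I p q. m < n \<Longrightarrow> \<not> T m I p q" by blast
  have fin: "finite I" and cI: "card I = n" and p: "\<And>k. k \<in> I \<Longrightarrow> p k \<in> PF (vars e)"
    and q: "\<And>k. k \<in> I \<Longrightarrow> q k \<in> PF (vars s)"
    and P: "\<And>x. P x = (\<Sum>k\<in>I. p k x * q k (\<lambda>i. x (e + i)))"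
    using T by (auto simp: T_def)
  have "rows_indep I UNIV q"
    unfolding rows_indep_def
  proof (intro allI impI ballI, rule ccontr)
    fix c j assume c: "\<forall>z\<in>UNIV. (\<Sum>k\<in>I. c k * q k z) = 0" "j \<in> I" "c j \<noteq> 0"
    let ?J = "I - {j}"
    let ?p = "\<lambda>k x. p k x - c k / c j * p j x"
    have qj: "q j z = (\<Sum>k\<in>?J. - (c k / c j) * q k z)" for z
    proof -
      have "c j * q j z + (\<Sum>k\<in>?J. c k * q k z) = 0"
        using c(1) sum.remove[OF fin c(2), of "\<lambda>k. c k * q k z"] by simp
      then have "q j z = - (\<Sum>k\<in>?J. c k * q k z) / c j" using c(3) by (simp add: field_simps eq_neg_iff_add_eq_0)
      then show ?thesis by (simp add: sum_divide_distrib sum_negf)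
    qed
    have "P x = (\<Sum>k\<in>?J. ?p k x * q k (\<lambda>i. x (e + i)))" for x
    proof -
      let ?z = "\<lambda>i. x (e + i)"
      have "P x = p j x * q j ?z + (\<Sum>k\<in>?J. p k x * q k ?z)"
        unfolding P by (rule sum.remove[OF fin c(2)])
      also have "p j x * q j ?z = (\<Sum>k\<in>?J. - (c k / c j * p j x) * q k ?z)"
        by (subst qj) (simp add: sum_distrib_left algebra_simps)
      finally show ?thesis by (simp add: sum.distrib[symmetric] algebra_simps)
    qed
    moreover have "?p k \<in> PF (vars e)" if "k \<in> ?J" for k
      using that p c(2) by (intro pf_diff pf_mult pf_const) auto
    moreover have "card ?J < n" using c(2) fin cI by (metis card_Diff1_less)
    ultimately show False using min[of "card ?J" ?J ?p q] fin q unfolding T_def by auto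
  qed
  then show ?thesis using fin p q P by blast
qed

subsection \<open>Comparing dominant families\<close>

lemma dominant_pullback:
  assumes "dominant W m f" "\<And>i. i < m \<Longrightarrow> f i \<in> PF C"
    "\<And>p w. p \<in> PF C \<Longrightarrow> (\<And>w'. w' \<in> W' \<Longrightarrow> p (h w') = 0) \<Longrightarrow> w \<in> W \<Longrightarrow> p w = 0"
  shows "dominant W' m (\<lambda>i w. f i (h w))"
  unfolding dominant_def
proof (intro ballI impI allI)
  fix P x assume P: "P \<in> PF (vars m)" "\<forall>w\<in>W'. P (\<lambda>i. f i (h w)) = 0"
  have pf: "(\<lambda>w. P (\<lambda>i. f i w)) \<in> PF C" by (rule pf_vars_compose[OF P(1) assms(2)])
  show "P x = 0"
    by (rule dominantD[OF assms(1) P(1)]) (rule assms(3)[OF pf], use P(2) in auto)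
qed

text \<open>Density of the image, the last assumption, is what keeps the relation nonzero after
  substitution.\<close>

lemma alg_pullback:
  assumes "alg W S g" "\<And>w. w \<in> W' \<Longrightarrow> h w \<in> W" "\<And>f. f \<in> S \<Longrightarrow> (\<lambda>w. f (h w)) \<in> PF S'"
    "\<And>p w. p \<in> PF S \<Longrightarrow> (\<And>w'. w' \<in> W' \<Longrightarrow> p (h w') = 0) \<Longrightarrow> w \<in> W \<Longrightarrow> p w = 0"
  shows "alg W' S' (\<lambda>w. g (h w))"
proof -
  obtain P where P: "polyfam S P" "\<exists>w\<in>W. P w \<noteq> 0" "\<forall>w\<in>W. poly (P w) (g w) = 0"
    using assms(1) unfolding alg_def by blast
  obtain n where n: "\<And>x. degree (P x) \<le> n" using polyfam_degree[OF P(1)] by blast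
  have "polyfam S' (\<lambda>w. P (h w))"
    by (rule polyfamI[of _ _ n]) (rule pf_compose[OF polyfam_coeff[OF P(1)] assms(3)], auto intro: n)
  moreover have "\<exists>w\<in>W'. P (h w) \<noteq> 0"
  proof (rule ccontr)
    assume *: "\<not> ?thesis"
    have "coeff (P w) i = 0" if "w \<in> W" for w i
      by (rule assms(4)[OF polyfam_coeff[OF P(1)] _ that]) (use * in auto)
    then show False using P(2) by (auto simp: poly_eq_iff)
  qed
  ultimately show ?thesis using P(3) assms(2) unfolding alg_def by blast
qed

lemma trdeg_alg:
  fixes C :: "('x \<Rightarrow> 'k::alg_closed_field) set"
  assumes "finite C" "\<And>i. i < trdeg C W \<Longrightarrow> f i \<in> PF C" "dominant W (trdeg C W) f" "z \<in> PF C"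
  shows "alg W (f ` {..<trdeg C W}) z"
proof (rule ccontr)
  let ?d = "trdeg C W"
  assume *: "\<not> ?thesis"
  define f' where "f' = f(?d := z)"
  have f': "f' ?d = z" "\<And>i. i \<noteq> ?d \<Longrightarrow> f' i = f i" by (auto simp: f'_def)
  have im: "f' ` {..<?d} = f ` {..<?d}" by (rule image_cong) (auto simp: f')
  have "dominant W ?d f'" using assms(3) by (rule dominant_cong) (auto simp: f')
  then have "dominant W (Suc ?d) f'" using * by (intro dominant_Suc) (auto simp: im f')
  moreover have "f' i \<in> PF C" if "i < Suc ?d" for i
    using that assms(2)[of i] assms(4) f' by (cases "i = ?d") auto
  ultimately have "Suc ?d \<le> ?d" using trdeg_ge[OF assms(1)] by blast
  then show False by simp
qed

section \<open>Products\<close>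

definition prod_coords :: "('x \<Rightarrow> 'k) set \<Rightarrow> ('y \<Rightarrow> 'k) set \<Rightarrow> ('x \<times> 'y \<Rightarrow> 'k) set" where
  "prod_coords C D = (\<lambda>f w. f (fst w)) ` C \<union> (\<lambda>f w. f (snd w)) ` D"

lemma finite_prod_coords: "finite C \<Longrightarrow> finite D \<Longrightarrow> finite (prod_coords C D)"
  by (simp add: prod_coords_def)

lemma pf_fst: "p \<in> PF C \<Longrightarrow> (\<lambda>w. p (fst w)) \<in> PF (prod_coords C D)"
  by (rule pf_compose[of p C fst]) (auto simp: prod_coords_def intro: pf_coord)

lemma pf_snd: "p \<in> PF D \<Longrightarrow> (\<lambda>w. p (snd w)) \<in> PF (prod_coords C D)"
  by (rule pf_compose[of p D snd]) (auto simp: prod_coords_def intro: pf_coord)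

lemma pf_slice_fst:
  assumes "p \<in> PF (prod_coords C D)" shows "(\<lambda>x. p (x, y)) \<in> PF C"
  by (rule pf_compose[OF assms, of "\<lambda>x. (x, y)"]) (auto simp: prod_coords_def intro: pf_coord pf_const)

lemma pf_slice_snd:
  assumes "p \<in> PF (prod_coords C D)" shows "(\<lambda>y. p (x, y)) \<in> PF D"
  by (rule pf_compose[OF assms, of "\<lambda>y. (x, y)"]) (auto simp: prod_coords_def intro: pf_coord pf_const)

text \<open>Irreducibility of \<open>W\<close> yields one \<open>z\<close> for which both functions
  have a nonzero slice over \<open>z\<close>; irreducibility of \<open>W'\<close> then makes the
  product of these slices nonzero.\<close>

lemma irr_prod:
  assumes "irr C W" "irr D W'"
  shows "irr (prod_coords C D) (W \<times> W')"
  unfolding irr_def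
proof (intro conjI ballI impI)
  show "W \<times> W' \<noteq> {}" using irr_nonempty[OF assms(1)] irr_nonempty[OF assms(2)] by simp
  fix p q assume pq: "p \<in> PF (prod_coords C D)" "q \<in> PF (prod_coords C D)" "\<forall>w\<in>W \<times> W'. p w * q w = 0"
  show "(\<forall>w\<in>W \<times> W'. p w = 0) \<or> (\<forall>w\<in>W \<times> W'. q w = 0)"
  proof (rule ccontr)
    assume "\<not> ?thesis"
    then obtain x y x' y' where xy: "x \<in> W" "y \<in> W'" "p (x, y) \<noteq> 0" "x' \<in> W" "y' \<in> W'" "q (x', y') \<noteq> 0"
      by auto
    have "nz W (\<lambda>z. p (z, y) * q (z, y'))"
      by (rule irr_nz_mult[OF assms(1) pf_slice_fst[OF pq(1)] pf_slice_fst[OF pq(2)]])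
         (use xy in \<open>auto simp: nz_def\<close>)
    then obtain z where z: "z \<in> W" "p (z, y) \<noteq> 0" "q (z, y') \<noteq> 0" by (auto simp: nz_def)
    have "nz W' (\<lambda>v. p (z, v) * q (z, v))"
      by (rule irr_nz_mult[OF assms(2) pf_slice_snd[OF pq(1)] pf_slice_snd[OF pq(2)]])
         (use xy z in \<open>auto simp: nz_def\<close>)
    then show False using pq(3) z(1) by (auto simp: nz_def)
  qed
qed

lemma irr_affine: "irr (vars N) (UNIV :: (nat \<Rightarrow> 'k::alg_closed_field) set)"
  unfolding irr_def
proof (intro conjI ballI impI)
  fix p q :: "(nat \<Rightarrow> 'k) \<Rightarrow> 'k"
  assume pq: "p \<in> PF (vars N)" "q \<in> PF (vars N)" "\<forall>w\<in>UNIV. p w * q w = 0"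
  show "(\<forall>w\<in>UNIV. p w = 0) \<or> (\<forall>w\<in>UNIV. q w = 0)"
  proof (rule ccontr)
    assume "\<not> ?thesis"
    then obtain a b where "p a \<noteq> 0" "q b \<noteq> 0" by auto
    from pf_vars_domain[OF pq(1,2) this] show False using pq(3) by auto
  qed
qed simp

text \<open>All coordinates of the product are algebraic over a transcendence basis of
  \<open>W\<close> together with the \<open>N\<close> affine coordinates, and
  \<open>steinitz\<close> applies.\<close>

lemma dominant_prod_affine_le:
  fixes C :: "('x \<Rightarrow> 'k::alg_closed_field) set"
  assumes irr: "irr C W" and fin: "finite C"
    and f: "\<And>i. i < m \<Longrightarrow> f i \<in> PF (prod_coords C (vars N))" "dominant (W \<times> UNIV) m f"
  shows "m \<le> trdeg C W + N"
proof -
  let ?d = "trdeg C W"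
  have W: "W \<noteq> {}" using irr by (rule irr_nonempty)
  obtain u where u: "\<And>i. i < ?d \<Longrightarrow> u i \<in> PF C" "dominant W ?d u" using trdeg_ex[OF fin W] by blast
  let ?B = "(\<lambda>i w. u i (fst w)) ` {..<?d} \<union> (\<lambda>i w. snd w i) ` {..<N}"
  have finB: "finite ?B" by simp
  have "m \<le> card ?B"
  proof (rule steinitz[OF irr_prod[OF irr irr_affine] _ finB _ _ f])
    show "finite (prod_coords C (vars N :: ((nat \<Rightarrow> 'k) \<Rightarrow> 'k) set))"
      using fin by (intro finite_prod_coords) (auto simp: vars_def)
    show "?B \<subseteq> PF (prod_coords C (vars N))"
      using pf_fst[OF u(1)] pf_snd[OF pf_vars_var] by fastforce
    fix z assume "z \<in> prod_coords C (vars N)"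
    then consider g where "g \<in> C" "z = (\<lambda>w. g (fst w))" | i where "i < N" "z = (\<lambda>w. snd w i)"
      unfolding prod_coords_def vars_def by auto
    then show "alg (W \<times> UNIV) ?B z"
    proof cases
      case 1
      have "alg W (u ` {..<?d}) g" by (rule trdeg_alg[OF fin u]) (use 1 in \<open>auto intro: pf_coord\<close>)
      then show ?thesis unfolding 1(2)
        by (rule alg_pullback) (auto intro!: pf_coord)
    next
      case 2
      then show ?thesis using W by (intro alg_self pf_coord) auto
    qed
  qed
  also have "card ?B \<le> ?d + N"
    by (rule order.trans[OF card_Un_le add_mono]) (auto intro: card_image_le[THEN order.trans])
  finally show ?thesis .
qed

subsection \<open>The identity component\<close>

lemma connectedin_irr:
  assumes "irr C D" "D \<subseteq> H" "H \<subseteq> Om"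
  shows "connectedin (subtopology (zariski_topology Om C) H) D"
  unfolding connectedin_closedin closedin_relclosed[OF assms(3)]
proof (intro conjI notI; (elim exE conjE)?)
  show "D \<subseteq> topspace (subtopology (zariski_topology Om C) H)" using assms by auto
  fix E1 E2 assume E: "relclosed C H E1" "relclosed C H E2" "D \<subseteq> E1 \<union> E2"
    "E1 \<inter> E2 \<inter> D = {}" "E1 \<inter> D \<noteq> {}" "E2 \<inter> D \<noteq> {}"
  have "\<exists>E\<in>{E1, E2}. D \<subseteq> E" by (rule irr_subset_Union[OF assms(1) _ _ assms(2)]) (use E in auto)
  then show False using E by blast
qed

text \<open>Left translations move any point to any other. As some point lies on just one maximal
  irreducible subset, all points do; these subsets are therefore disjoint, and the one through
  \<open>id\<close> is the connected component.\<close>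

lemma identity_component:
  fixes C :: "(('a \<Rightarrow> 'a) \<Rightarrow> 'k::field) set"
  assumes fin: "finite C" and H: "H \<subseteq> Om" and id: "id \<in> H"
    and comp: "\<And>g h. g \<in> H \<Longrightarrow> h \<in> H \<Longrightarrow> g \<circ> h \<in> H"
    and inv: "\<And>g. g \<in> H \<Longrightarrow> \<exists>h\<in>H. h \<circ> g = id \<and> g \<circ> h = id"
    and trans: "\<And>g f. g \<in> H \<Longrightarrow> f \<in> C \<Longrightarrow> \<exists>q\<in>PF C. \<forall>h\<in>H. f (g \<circ> h) = q h"
    and G: "G = connected_component_of_set (subtopology (zariski_topology Om C) H) id"
  shows "irr C G" "relclosed C H G" "id \<in> G" "\<And>g h. g \<in> G \<Longrightarrow> h \<in> G \<Longrightarrow> g \<circ> h \<in> G"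
    "\<And>g. g \<in> G \<Longrightarrow> \<exists>h\<in>G. h \<circ> g = id \<and> g \<circ> h = id"
proof -
  obtain F where F: "finite F" "H = \<Union>F" "\<forall>D\<in>F. relclosed C H D \<and> irr C D"
    using irr_decomposition[OF fin relclosed_self, of H] by (elim exE conjE) (rule that, assumption+)
  define F' where "F' = {D \<in> F. \<forall>E\<in>F. D \<subseteq> E \<longrightarrow> E = D}"
  have F'F: "F' \<subseteq> F" and finF': "finite F'" using F(1) by (auto simp: F'_def)
  have max: "\<exists>E\<in>F'. D \<subseteq> E" if DF: "D \<in> F" for D
  proof -
    obtain E where "E \<in> F" "D \<subseteq> E" "\<forall>E'\<in>F. E \<subseteq> E' \<longrightarrow> E = E'"
      using finite_has_maximal2[OF F(1) DF] by blast
    then show ?thesis unfolding F'_def by blast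
  qed
  have UF': "\<Union>F' = H" using F(2) F'F max by blast
  have rel: "relclosed C H D" "irr C D" "D \<subseteq> H" if "D \<in> F'" for D
    using that F'F F by auto
  have max': "E = D" if "D \<in> F'" "E \<in> F'" "D \<subseteq> E" for D E
    using that F'F unfolding F'_def by blast
  have cover: "\<exists>E\<in>F'. D \<subseteq> E" if "irr C D" "D \<subseteq> H" for D
    by (rule irr_subset_Union[OF that(1) finF' rel(1) that(2)]) (use that UF' in auto)
  have tr: "\<exists>E\<in>F'. (\<circ>) g ` D \<subseteq> E" if "g \<in> H" "irr C D" "D \<subseteq> H" for g D
  proof (rule cover)
    show "irr C ((\<circ>) g ` D)"
      by (rule irr_image[OF that(2)]) (use trans[OF that(1)] that(3) in blast)
    show "(\<circ>) g ` D \<subseteq> H" using comp that by auto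
  qed
  obtain D1 where D1: "D1 \<in> F'" using id UF' by blast
  have "\<not> D1 \<subseteq> \<Union>(F' - {D1})"
  proof
    assume "D1 \<subseteq> \<Union>(F' - {D1})"
    then have "\<exists>E\<in>F' - {D1}. D1 \<subseteq> E"
      by (intro irr_subset_Union[OF rel(2)[OF D1] _ _ rel(3)[OF D1]]) (use finF' rel(1) in auto)
    then show False using max'[OF D1] by blast
  qed
  \<comment> \<open>An irreducible set contained in no other member is not covered by the finitely
    many others, hence has a point lying on it alone.\<close>
  then obtain p where p: "p \<in> D1" "\<And>E. E \<in> F' \<Longrightarrow> p \<in> E \<Longrightarrow> E = D1" by blast
  have pH: "p \<in> H" using p(1) rel(3)[OF D1] by blast
  have disj: "D = E" if DE: "D \<in> F'" "E \<in> F'" "q \<in> D" "q \<in> E" for D E q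
  proof -
    have qH: "q \<in> H" using DE rel(3) by blast
    obtain r where r: "r \<in> H" "r \<circ> q = id" using inv[OF qH] by blast
    \<comment> \<open>Left translation by this element takes \<open>q\<close> to
      \<open>p\<close>.\<close>
    have gH: "p \<circ> r \<in> H" using comp pH r(1) by blast
    obtain gi where gi: "gi \<in> H" "gi \<circ> (p \<circ> r) = id" using inv[OF gH] by blast
    have gq: "(p \<circ> r) \<circ> q = p" using r(2) by (simp add: comp_assoc)
    have sub: "(\<circ>) (p \<circ> r) ` X \<subseteq> D1" if X: "X \<in> F'" "q \<in> X" for X
    proof -
      obtain E' where E': "E' \<in> F'" "(\<circ>) (p \<circ> r) ` X \<subseteq> E'" using tr[OF gH rel(2,3)[OF X(1)]] by blast
      have "p \<in> E'" using E'(2) X(2) gq by (metis image_subset_iff)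
      then show ?thesis using p(2)[OF E'(1)] E'(2) by simp
    qed
    \<comment> \<open>Translating \<open>D1\<close> back lands in one member \<open>D''\<close>,
      which therefore contains every member through \<open>q\<close>; by maximality all of them are
      equal.\<close>
    obtain D'' where D'': "D'' \<in> F'" "(\<circ>) gi ` D1 \<subseteq> D''" using tr[OF gi(1) rel(2,3)[OF D1]] by blast
    have ret: "X \<subseteq> D''" if X: "X \<in> F'" "q \<in> X" for X
    proof
      fix x assume x: "x \<in> X"
      have "(p \<circ> r) \<circ> x \<in> D1" using sub[OF X] x by blast
      then have "gi \<circ> ((p \<circ> r) \<circ> x) \<in> D''" using D''(2) by blast
      moreover have "gi \<circ> ((p \<circ> r) \<circ> x) = x"
        using gi(2) by (metis comp_assoc id_comp)
      ultimately show "x \<in> D''" by simp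
    qed
    show ?thesis using max'[OF DE(1) D''(1) ret[OF DE(1,3)]] max'[OF DE(2) D''(1) ret[OF DE(2,4)]] by simp
  qed
  obtain D0 where D0: "D0 \<in> F'" "id \<in> D0" using id UF' by blast
  let ?T = "subtopology (zariski_topology Om C) H"
  have GD0: "G = D0"
  proof
    show "D0 \<subseteq> G" unfolding G
      by (rule connected_component_of_maximal[OF connectedin_irr[OF rel(2,3)[OF D0(1)] H] D0(2)])
    let ?K = "connected_component_of_set ?T id"
    have K: "connectedin ?T ?K" by (rule connectedin_connected_component_of)
    have idK: "id \<in> ?K" using id H by (auto simp: connected_component_of_refl)
    let ?R = "\<Union>(F' - {D0})"
    have "closedin ?T D0" using rel(1)[OF D0(1)] closedin_relclosed[OF H] by blast
    moreover have "closedin ?T ?R"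
      by (rule closedin_Union) (use finF' rel(1) closedin_relclosed[OF H] in auto)
    moreover have "?K \<subseteq> D0 \<union> ?R"
    proof -
      have "?K \<subseteq> H" using connectedin_subset_topspace[OF K] by auto
      then show ?thesis using UF' by blast
    qed
    moreover have "D0 \<inter> ?R \<inter> ?K = {}" using disj[OF D0(1)] by blast
    moreover have "D0 \<inter> ?K \<noteq> {}" using D0(2) idK by blast
    ultimately have "?R \<inter> ?K = {}" using K unfolding connectedin_closedin by blast
    then show "G \<subseteq> D0" using \<open>?K \<subseteq> D0 \<union> ?R\<close> unfolding G by blast
  qed
  show "irr C G" "relclosed C H G" "id \<in> G" using rel D0 by (auto simp: GD0)
  have sub: "(\<circ>) g ` D0 \<subseteq> D0" if g: "g \<in> H" "x \<in> D0" "g \<circ> x \<in> D0" for g x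
  proof -
    obtain E where E: "E \<in> F'" "(\<circ>) g ` D0 \<subseteq> E" using tr[OF g(1) rel(2,3)[OF D0(1)]] by blast
    then have "g \<circ> x \<in> E" using g(2) by blast
    then show ?thesis using disj[OF E(1) D0(1) _ g(3)] E(2) by simp
  qed
  show "g \<circ> h \<in> G" if "g \<in> G" "h \<in> G" for g h
    using sub[of g id] that D0 rel(3)[OF D0(1)] unfolding GD0 by auto
  show "\<exists>h\<in>G. h \<circ> g = id \<and> g \<circ> h = id" if g: "g \<in> G" for g
  proof -
    have "g \<in> H" using g rel(3)[OF D0(1)] GD0 by blast
    then obtain h where h: "h \<in> H" "h \<circ> g = id" "g \<circ> h = id" using inv by blast
    have "h \<circ> id \<in> D0" using sub[of h g] h g D0(2) unfolding GD0 by auto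
    then show ?thesis using h unfolding GD0 by (intro bexI[of _ h]) auto
  qed
qed

subsection \<open>Coordinates on a finite-dimensional multialgebra\<close>

locale fd_multialgebra =
  fixes A :: "('k::alg_closed_field, 'a::ab_group_add, 'i) multialg"
  assumes multialgebra: "multialgebra A" and fin_dim: "fin_dim A"
begin

sublocale vs: vector_space "smult A"
  using multialgebra by (simp add: multialgebra_def)

definition Bs :: "'a set" where
  "Bs = (SOME B. finite B \<and> vs.independent B \<and> vs.span B = UNIV)"

lemma Bs: "finite Bs" "vs.independent Bs" "vs.span Bs = UNIV"
proof -
  obtain S where S: "finite S" "vs.span S = UNIV" using fin_dim unfolding fin_dim_def by blast
  obtain B where B: "B \<subseteq> S" "vs.independent B" "S \<subseteq> vs.span B" using vs.maximal_independent_subset .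
  have "vs.span B = UNIV" using S(2) vs.span_minimal[OF B(3) vs.subspace_span] by auto
  then have "\<exists>B. finite B \<and> vs.independent B \<and> vs.span B = UNIV"
    using B S(1) finite_subset by blast
  from someI_ex[OF this] show "finite Bs" "vs.independent Bs" "vs.span Bs = UNIV"
    unfolding Bs_def by blast+
qed

sublocale vs: finite_dimensional_vector_space "smult A" Bs
  by unfold_locales (rule Bs)+

abbreviation scl (infixr "*a" 75) where "c *a v \<equiv> smult A c v"

definition ep :: "'a \<Rightarrow> 'a \<Rightarrow> 'k" where "ep b v = vs.representation Bs v b"

lemma ep_sum: "(\<Sum>b\<in>Bs. ep b v *a b) = v"
  unfolding ep_def by (rule vs.sum_representation_eq) (use Bs in auto)

lemma lf_iff: "\<phi> \<in> linear_functionals A \<longleftrightarrow> (\<forall>x y. \<phi> (x + y) = \<phi> x + \<phi> y) \<and> (\<forall>c x. \<phi> (c *a x) = c * \<phi> x)"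
proof -
  have "vector_space ((*) :: 'k \<Rightarrow> 'k \<Rightarrow> 'k)" by unfold_locales (auto simp: algebra_simps)
  then show ?thesis unfolding linear_functionals_def Vector_Spaces.linear_iff using vs.vector_space_axioms by auto
qed

lemma lin_iff: "Vector_Spaces.linear (smult A) (smult A) f \<longleftrightarrow>
   (\<forall>x y. f (x + y) = f x + f y) \<and> (\<forall>c x. f (c *a x) = c *a f x)"
  unfolding Vector_Spaces.linear_iff using vs.vector_space_axioms by auto

lemma lf_rep:
  assumes "vs.independent E" "vs.span E = UNIV"
  shows "(\<lambda>v. vs.representation E v b) \<in> linear_functionals A"
  unfolding lf_iff using vs.representation_add[OF assms(1)] vs.representation_scale[OF assms(1)] assms(2) by auto

lemma ep_lf: "ep b \<in> linear_functionals A"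
  using lf_rep[OF Bs(2,3), of b] unfolding ep_def[abs_def] .

lemma lf_zero: "\<phi> \<in> linear_functionals A \<Longrightarrow> \<phi> 0 = 0"
  unfolding lf_iff by (metis mult_zero_left vs.scale_zero_left)

lemma lf_sum:
  assumes "\<phi> \<in> linear_functionals A"
  shows "\<phi> (\<Sum>i\<in>I. c i *a v i) = (\<Sum>i\<in>I. c i * \<phi> (v i))"
  using assms lf_zero[OF assms] by (induction I rule: infinite_finite_induct) (auto simp: lf_iff)

lemma lin_sum:
  assumes "Vector_Spaces.linear (smult A) (smult A) f"
  shows "f (\<Sum>i\<in>I. c i *a v i) = (\<Sum>i\<in>I. c i *a f (v i))"
proof -
  have "f 0 = 0" using assms unfolding lin_iff by (metis vs.scale_zero_left)
  then show ?thesis using assms by (induction I rule: infinite_finite_induct) (auto simp: lin_iff)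
qed

lemma lin_expand: "Vector_Spaces.linear (smult A) (smult A) f \<Longrightarrow> f v = (\<Sum>b\<in>Bs. ep b v *a f b)"
  using lin_sum[of f "\<lambda>b. ep b v" "\<lambda>b. b" Bs] by (simp add: ep_sum)

lemma ep_basis: "b \<in> Bs \<Longrightarrow> c \<in> Bs \<Longrightarrow> ep b c = (if b = c then 1 else 0)"
  unfolding ep_def by (simp add: vs.representation_basis[OF Bs(2)])

lemma ep_comb: "b \<in> Bs \<Longrightarrow> ep b (\<Sum>c\<in>Bs. u c *a c) = u b"
  using Bs(1) by (simp add: lf_sum[OF ep_lf] ep_basis if_distrib[of "\<lambda>x. _ * x"] cong: if_cong)

lemma lf_separate:
  assumes "\<And>\<phi>. \<phi> \<in> linear_functionals A \<Longrightarrow> \<phi> v = \<phi> w"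
  shows "v = w"
proof -
  have "ep b v = ep b w" for b by (rule assms[OF ep_lf])
  then have "(\<lambda>b. ep b v) = (\<lambda>b. ep b w)" by blast
  then have "(\<Sum>b\<in>Bs. ep b v *a b) = (\<Sum>b\<in>Bs. ep b w *a b)" by metis
  then show ?thesis unfolding ep_sum .
qed

lemma ep_separate: "(\<And>b. b \<in> Bs \<Longrightarrow> ep b v = 0) \<Longrightarrow> v = 0"
  using ep_sum[of v] by simp

lemma lf_separate_subspace:
  assumes "vs.subspace M" "v \<notin> M"
  shows "\<exists>\<phi>\<in>linear_functionals A. (\<forall>m\<in>M. \<phi> m = 0) \<and> \<phi> v \<noteq> 0"
proof -
  obtain B where B: "B \<subseteq> M" "vs.independent B" "M \<subseteq> vs.span B" using vs.maximal_independent_subset .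
  have "vs.span B \<subseteq> M" using B(1) assms(1) by (rule vs.span_minimal)
  then have vB: "v \<notin> vs.span B" using assms(2) by blast
  have vM: "v \<notin> B" using vB vs.span_base by blast
  have ind: "vs.independent (insert v B)" using B(2) vB by (simp add: vs.independent_insert)
  define E where "E = vs.extend_basis (insert v B)"
  have E: "insert v B \<subseteq> E" "vs.independent E" "vs.span E = UNIV"
    unfolding E_def using vs.extend_basis_superset[OF ind] vs.independent_extend_basis[OF ind]
      vs.span_extend_basis[OF ind] by auto
  show ?thesis
  proof (intro bexI[of _ "\<lambda>x. vs.representation E x v"] conjI ballI lf_rep E)
    show "vs.representation E v v \<noteq> 0" using vs.representation_basis[OF E(2), of v] E(1) by simp
    fix m assume "m \<in> M"
    then have m: "m \<in> vs.span B" using B(3) by blast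
    have "vs.representation E m = vs.representation B m"
      by (rule vs.representation_extend[OF E(2) m]) (use E(1) in auto)
    then show "vs.representation E m v = 0" using vM vs.representation_ne_zero by metis
  qed
qed

abbreviation "OmE \<equiv> {f. Vector_Spaces.linear (smult A) (smult A) f}"

text \<open>Finitely many coordinates, as the Noetherian and transcendence arguments require;
  \<open>End_eq\<close> shows that they induce the topology of \<open>End_space A\<close>.\<close>

definition CE :: "(('a \<Rightarrow> 'a) \<Rightarrow> 'k) set" where
  "CE = (\<lambda>(b, c) f. ep b (f c)) ` (Bs \<times> Bs)"

definition CV :: "nat \<Rightarrow> ((nat \<Rightarrow> 'a) \<Rightarrow> 'k) set" where
  "CV r = (\<lambda>(b, j) x. ep b (x j)) ` (Bs \<times> {..<r})"

lemma finite_CE: "finite CE" and finite_CV: "finite (CV r)"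
  using Bs(1) by (auto simp: CE_def CV_def)

text \<open>The coordinates can be prescribed freely. This is the \<open>chart\<close> premise, by
  which points are recovered from values of coordinates.\<close>

lemma chart_CV: "\<exists>x\<in>tuples r UNIV. \<forall>z\<in>CV r. z x = c z"
  by (rule bexI[of _ "\<lambda>j\<in>{..<r}. \<Sum>b\<in>Bs. c (\<lambda>x. ep b (x j)) *a b"])
     (auto simp: CV_def ep_comb)

lemma chart_CE: "\<exists>f\<in>OmE. \<forall>z\<in>CE. z f = c z"
proof -
  define W where "W b = (\<Sum>d\<in>Bs. c (\<lambda>f. ep d (f b)) *a d)" for b
  define f where "f v = (\<Sum>b\<in>Bs. ep b v *a W b)" for v
  have f: "f b = W b" if "b \<in> Bs" for b
  proof -
    have "f b = (\<Sum>e\<in>Bs. if e = b then W e else 0)"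
      unfolding f_def by (rule sum.cong) (auto simp: ep_basis that)
    then show ?thesis using Bs(1) that by simp
  qed
  have "ep b (v + w) = ep b v + ep b w" "ep b (s *a v) = s * ep b v" for b v w s
    using ep_lf by (auto simp: lf_iff)
  then have "f \<in> OmE"
    unfolding mem_Collect_eq lin_iff f_def
    by (auto simp: vs.scale_left_distrib sum.distrib vs.scale_sum_right)
  moreover have "\<forall>z\<in>CE. z f = c z" by (auto simp: CE_def f W_def ep_comb)
  ultimately show ?thesis by blast
qed

text \<open>Vector-valued polynomial maps, tested by functionals. Agreement is asked only on
  \<open>Om\<close>: for instance \<open>f v\<close> is a polynomial in the matrix coefficients of
  \<open>f\<close> only for linear \<open>f\<close>.\<close>

definition polymap :: "'x set \<Rightarrow> ('x \<Rightarrow> 'k) set \<Rightarrow> ('x \<Rightarrow> 'a) \<Rightarrow> bool" where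
  "polymap Om C h \<longleftrightarrow> (\<forall>\<phi>\<in>linear_functionals A. \<exists>q\<in>PF C. \<forall>x\<in>Om. \<phi> (h x) = q x)"

lemma polymapD: "polymap Om C h \<Longrightarrow> \<phi> \<in> linear_functionals A \<Longrightarrow> \<exists>q\<in>PF C. \<forall>x\<in>Om. \<phi> (h x) = q x"
  by (simp add: polymap_def)

lemma polymap_const: "polymap Om C (\<lambda>_. v)"
  unfolding polymap_def by (auto intro: pf_const)

lemma polymap_add: "polymap Om C h \<Longrightarrow> polymap Om C k \<Longrightarrow> polymap Om C (\<lambda>x. h x + k x)"
  unfolding polymap_def
proof (intro ballI)
  fix \<phi> assume \<phi>: "\<phi> \<in> linear_functionals A"
    and "\<forall>\<phi>\<in>linear_functionals A. \<exists>q\<in>PF C. \<forall>x\<in>Om. \<phi> (h x) = q x"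
    and "\<forall>\<phi>\<in>linear_functionals A. \<exists>q\<in>PF C. \<forall>x\<in>Om. \<phi> (k x) = q x"
  then obtain p q where "p \<in> PF C" "\<forall>x\<in>Om. \<phi> (h x) = p x" "q \<in> PF C" "\<forall>x\<in>Om. \<phi> (k x) = q x" by blast
  then show "\<exists>q\<in>PF C. \<forall>x\<in>Om. \<phi> (h x + k x) = q x" using \<phi>
    by (intro bexI[of _ "\<lambda>x. p x + q x"]) (auto simp: lf_iff intro: pf_add)
qed

lemma polymap_scale:
  assumes "polymap Om C h" "\<exists>q\<in>PF C. \<forall>x\<in>Om. s x = q x"
  shows "polymap Om C (\<lambda>x. s x *a h x)"
  unfolding polymap_def
proof (intro ballI)
  fix \<phi> assume \<phi>: "\<phi> \<in> linear_functionals A"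
  obtain p where p: "p \<in> PF C" "\<forall>x\<in>Om. \<phi> (h x) = p x" using polymapD[OF assms(1) \<phi>] by blast
  obtain q where q: "q \<in> PF C" "\<forall>x\<in>Om. s x = q x" using assms(2) by blast
  show "\<exists>q\<in>PF C. \<forall>x\<in>Om. \<phi> (s x *a h x) = q x" using \<phi> p q
    by (intro bexI[of _ "\<lambda>x. q x * p x"]) (auto simp: lf_iff intro: pf_mult)
qed

lemma polymap_sum: "(\<And>i. i \<in> I \<Longrightarrow> polymap Om C (h i)) \<Longrightarrow> polymap Om C (\<lambda>x. \<Sum>i\<in>I. h i x)"
  by (induction I rule: infinite_finite_induct) (auto intro: polymap_const polymap_add)

lemma polymap_cong: "polymap Om C h \<Longrightarrow> (\<And>x. x \<in> Om \<Longrightarrow> h x = k x) \<Longrightarrow> polymap Om C k"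
  unfolding polymap_def by simp

lemma polymap_of_ep:
  assumes "\<And>b. b \<in> Bs \<Longrightarrow> \<exists>q\<in>PF C. \<forall>x\<in>Om. ep b (h x) = q x"
  shows "polymap Om C h"
proof -
  have "polymap Om C (\<lambda>x. \<Sum>b\<in>Bs. ep b (h x) *a b)"
    by (intro polymap_sum polymap_scale polymap_const assms)
  then show ?thesis by (simp add: ep_sum)
qed

lemma polymap_CV: "j < r \<Longrightarrow> polymap Om (CV r) (\<lambda>x. x j)"
  by (rule polymap_of_ep) (auto intro!: bexI pf_coord simp: CV_def)

lemma polymap_CE:
  assumes "Om \<subseteq> OmE"
  shows "polymap Om CE (\<lambda>f. f v)"
proof -
  have "polymap Om CE (\<lambda>f. f c)" if "c \<in> Bs" for c
    by (rule polymap_of_ep) (use that in \<open>auto intro!: bexI pf_coord simp: CE_def\<close>)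
  then have "polymap Om CE (\<lambda>f. \<Sum>c\<in>Bs. ep c v *a f c)"
    by (intro polymap_sum polymap_scale) (auto intro: pf_const)
  then show ?thesis by (rule polymap_cong) (use assms lin_expand in auto)
qed

lemma polymap_pull:
  assumes "polymap Om C h" "\<And>x. x \<in> W \<Longrightarrow> k x \<in> Om" "\<And>f. f \<in> C \<Longrightarrow> (\<lambda>w. f (k w)) \<in> PF D"
  shows "polymap W D (\<lambda>x. h (k x))"
  unfolding polymap_def
proof
  fix \<phi> assume "\<phi> \<in> linear_functionals A"
  from polymapD[OF assms(1) this] obtain q where q: "q \<in> PF C" "\<forall>x\<in>Om. \<phi> (h x) = q x" by blast
  have "(\<lambda>w. q (k w)) \<in> PF D" by (rule pf_compose[OF q(1) assms(3)])
  then show "\<exists>q\<in>PF D. \<forall>x\<in>W. \<phi> (h (k x)) = q x"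
    by (rule bexI[rotated]) (use q(2) assms(2) in auto)
qed

lemma oper_linear:
  "i \<in> opindex A \<Longrightarrow> x \<in> tuples (arity A i) UNIV \<Longrightarrow> j < arity A i \<Longrightarrow>
    Vector_Spaces.linear (smult A) (smult A) (\<lambda>a. oper A i (x(j := a)))"
  using multialgebra unfolding multialgebra_def by blast

text \<open>Multilinearity expands one argument after another in the basis. The induction is on a
  bound \<open>j\<close> such that the arguments from index \<open>j\<close> on are already
  constant.\<close>

lemma polymap_oper:
  assumes i: "i \<in> opindex A" and h: "\<And>k. k < arity A i \<Longrightarrow> polymap Om C (h k)"
  shows "polymap Om C (\<lambda>x. oper A i (\<lambda>k\<in>{..<arity A i}. h k x))"
proof -
  let ?n = "arity A i"
  have "polymap Om C (\<lambda>x. oper A i (\<lambda>k\<in>{..<?n}. h k x))"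
    if "j \<le> ?n" "\<And>k. k < ?n \<Longrightarrow> polymap Om C (h k)" "\<And>k. j \<le> k \<Longrightarrow> k < ?n \<Longrightarrow> \<exists>v. h k = (\<lambda>_. v)" for j h
    using that
  proof (induction j arbitrary: h)
    case 0
    then have "\<forall>k. \<exists>v. k < ?n \<longrightarrow> h k = (\<lambda>_. v)" by blast
    from choice[OF this] obtain v where "\<And>k. k < ?n \<Longrightarrow> h k = (\<lambda>_. v k)" by blast
    then have "oper A i (\<lambda>k\<in>{..<?n}. h k x) = oper A i (\<lambda>k\<in>{..<?n}. v k)" for x
      by (intro arg_cong[of _ _ "oper A i"] restrict_ext) simp
    then show ?case by (simp only: polymap_const)
  next
    case (Suc j)
    let ?t = "\<lambda>x. \<lambda>k\<in>{..<?n}. h k x"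
    have j: "j < ?n" using Suc.prems(1) by simp
    have eq: "oper A i (?t x) = (\<Sum>b\<in>Bs. ep b (h j x) *a oper A i (\<lambda>k\<in>{..<?n}. (h(j := \<lambda>_. b)) k x))" for x
    proof -
      have upd: "(?t x)(j := a) = (\<lambda>k\<in>{..<?n}. (h(j := \<lambda>_. a)) k x)" for a
        using j by (auto simp: restrict_def fun_eq_iff)
      have "oper A i (?t x) = oper A i ((?t x)(j := h j x))" using j by (simp add: fun_upd_idem)
      also have "\<dots> = (\<Sum>b\<in>Bs. ep b (h j x) *a oper A i ((?t x)(j := b)))"
        by (rule lin_expand[OF oper_linear[OF i _ j]]) auto
      finally show ?thesis unfolding upd .
    qed
    have "polymap Om C (\<lambda>x. \<Sum>b\<in>Bs. ep b (h j x) *a oper A i (\<lambda>k\<in>{..<?n}. (h(j := \<lambda>_. b)) k x))"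
    proof (intro polymap_sum polymap_scale)
      fix b
      show "\<exists>q\<in>PF C. \<forall>x\<in>Om. ep b (h j x) = q x"
        by (rule polymapD[OF Suc.prems(2)[OF j] ep_lf])
      show "polymap Om C (\<lambda>x. oper A i (\<lambda>k\<in>{..<?n}. (h(j := \<lambda>_. b)) k x))"
      proof (rule Suc.IH)
        fix k assume k: "k < ?n"
        show "polymap Om C ((h(j := \<lambda>_. b)) k)" using Suc.prems(2)[OF k] by (auto intro: polymap_const)
        assume "j \<le> k"
        then show "\<exists>v. (h(j := \<lambda>_. b)) k = (\<lambda>_. v)" using Suc.prems(3)[OF _ k] by (cases "k = j") auto
      qed (use j in auto)
    qed
    then show ?case by (simp only: eq)
  qed
  from this[of ?n h] show ?thesis using h by auto
qed

lemma rows_indep_vec: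
  "rows_indep I Bs (\<lambda>k l. ep l (v k)) \<longleftrightarrow> (\<forall>c. (\<Sum>k\<in>I. c k *a v k) = 0 \<longrightarrow> (\<forall>k\<in>I. c k = 0))"
proof -
  have "(\<forall>l\<in>Bs. (\<Sum>k\<in>I. c k * ep l (v k)) = 0) \<longleftrightarrow> (\<Sum>k\<in>I. c k *a v k) = 0" for c
    unfolding lf_sum[OF ep_lf, symmetric] using ep_separate lf_zero[OF ep_lf] by auto
  then show ?thesis unfolding rows_indep_def by simp
qed

lemma rows_indep_independent:
  assumes "finite I" "rows_indep I Bs (\<lambda>k l. ep l (v k))"
  shows "inj_on v I" "vs.independent (v ` I)"
proof -
  have ind: "\<And>c k. (\<Sum>k\<in>I. c k *a v k) = 0 \<Longrightarrow> k \<in> I \<Longrightarrow> c k = 0"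
    using assms(2) unfolding rows_indep_vec by blast
  show inj: "inj_on v I"
  proof (rule inj_onI, rule ccontr)
    fix k l assume kl: "k \<in> I" "l \<in> I" "v k = v l" "k \<noteq> l"
    let ?c = "\<lambda>i. if i = k then 1 else if i = l then - 1 else (0::'k)"
    have "(\<Sum>i\<in>I. ?c i *a v i) = (\<Sum>i\<in>{k, l}. ?c i *a v i)"
      by (rule sum.mono_neutral_right) (use assms(1) kl in auto)
    also have "\<dots> = 0" using kl by simp
    finally have "?c k = (0::'k)" using ind[of ?c, OF _ kl(1)] by blast
    then show False by simp
  qed
  show "vs.independent (v ` I)"
  proof (rule vs.independent_if_scalars_zero)
    show "finite (v ` I)" using assms(1) by simp
    fix f x assume f: "(\<Sum>x\<in>v ` I. f x *a x) = 0" "x \<in> v ` I"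
    then have "(\<Sum>k\<in>I. f (v k) *a v k) = 0" using inj by (simp add: sum.reindex)
    then show "f x = 0" using ind[of "\<lambda>k. f (v k)"] f(2) by blast
  qed
qed

lemma independent_rows_indep:
  assumes "vs.independent B"
  shows "rows_indep B Bs (\<lambda>k l. ep l k)"
  unfolding rows_indep_vec using assms unfolding vs.independent_explicit by blast

lemma independent_open:
  assumes "finite I" "\<And>k. k \<in> I \<Longrightarrow> polymap Om C (v k)" "x0 \<in> Om" "rows_indep I Bs (\<lambda>k l. ep l (v k x0))"
  shows "\<exists>D\<in>PF C. D x0 \<noteq> 0 \<and> (\<forall>x\<in>Om. D x \<noteq> 0 \<longrightarrow> rows_indep I Bs (\<lambda>k l. ep l (v k x)))"
  by (rule rows_indep_open[where a = "\<lambda>k l x. ep l (v k x)", OF assms(1) _ assms(3,4)])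
     (rule polymapD[OF assms(2) ep_lf])

lemma V_eq: "V A r = zariski_topology (tuples r UNIV) (CV r)"
  unfolding V_def
proof (rule zariski_topology_cong)
  fix f :: "(nat \<Rightarrow> 'a) \<Rightarrow> 'k"
  assume "f \<in> {(\<lambda>x. \<phi> (x j)) | \<phi> j. \<phi> \<in> linear_functionals A \<and> j < r}"
  then show "\<exists>g\<in>PF (CV r). \<forall>x\<in>tuples r UNIV. f x = g x"
    using polymapD[OF polymap_CV] by fastforce
next
  fix f :: "(nat \<Rightarrow> 'a) \<Rightarrow> 'k"
  assume "f \<in> CV r"
  then show "\<exists>g\<in>PF {(\<lambda>x. \<phi> (x j)) | \<phi> j. \<phi> \<in> linear_functionals A \<and> j < r}. \<forall>x\<in>tuples r UNIV. f x = g x"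
    using ep_lf by (intro bexI[of _ f] pf_coord) (auto simp: CV_def)
qed

lemma End_eq: "End_space A = zariski_topology OmE CE"
  unfolding End_space_def
proof (rule zariski_topology_cong)
  fix f :: "('a \<Rightarrow> 'a) \<Rightarrow> 'k"
  assume "f \<in> {(\<lambda>f. \<phi> (f a)) | \<phi> a. \<phi> \<in> linear_functionals A}"
  then show "\<exists>g\<in>PF CE. \<forall>x\<in>OmE. f x = g x"
    using polymapD[OF polymap_CE[OF order_refl]] by fastforce
next
  fix f :: "('a \<Rightarrow> 'a) \<Rightarrow> 'k"
  assume "f \<in> CE"
  then show "\<exists>g\<in>PF {(\<lambda>f. \<phi> (f a)) | \<phi> a. \<phi> \<in> linear_functionals A}. \<forall>x\<in>OmE. f x = g x"
    using ep_lf by (intro bexI[of _ f] pf_coord) (auto simp: CE_def)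
qed

subsection \<open>Generated subalgebras\<close>

lemma subalgebra_subspace: "subalgebra A S \<Longrightarrow> vs.subspace S"
  by (simp add: subalgebra_def)

lemma subalgebra_generated: "subalgebra A (generated A X)"
  unfolding generated_def
proof (rule hull_in)
  fix T assume T: "Ball T (subalgebra A)"
  have "vs.subspace (\<Inter>T)" using T by (intro vs.subspace_Inter) (auto simp: subalgebra_def)
  moreover have "oper A i x \<in> \<Inter>T" if "i \<in> opindex A" "x \<in> tuples (arity A i) (\<Inter>T)" for i x
  proof
    fix S assume S: "S \<in> T"
    then have "x \<in> tuples (arity A i) S" using that(2) by (auto simp: PiE_iff)
    then show "oper A i x \<in> S" using T S that(1) unfolding subalgebra_def by blast
  qed
  ultimately show "subalgebra A (\<Inter>T)" by (simp add: subalgebra_def)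
qed

lemma generated_minimal: "subalgebra A S \<Longrightarrow> X \<subseteq> S \<Longrightarrow> generated A X \<subseteq> S"
  unfolding generated_def by (rule hull_minimal)

lemma generated_inc: "x \<in> X \<Longrightarrow> x \<in> generated A X"
  unfolding generated_def by (rule hull_inc)

text \<open>\<open>H\<close> consists of the polynomial maps whose value at each \<open>x\<close>
  lies in the subalgebra generated by \<open>x\<close>. Their values at \<open>x0\<close> form a
  subalgebra containing the entries of \<open>x0\<close>, so a basis of the subalgebra generated by
  \<open>x0\<close> spreads out to maps in \<open>H\<close>, which stay independent on an open
  set.\<close>

lemma generated_dim_open:
  assumes "x0 \<in> tuples r UNIV"
  shows "\<exists>D\<in>PF (CV r). D x0 \<noteq> 0 \<and> (\<forall>x\<in>tuples r UNIV. D x \<noteq> 0 \<longrightarrow>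
    vs.dim (generated A (x ` {..<r})) \<ge> vs.dim (generated A (x0 ` {..<r})))"
proof -
  let ?Om = "tuples r (UNIV :: 'a set)"
  let ?gen = "\<lambda>x. generated A (x ` {..<r})"
  define H where "H = {h. polymap ?Om (CV r) h \<and> (\<forall>x\<in>?Om. h x \<in> ?gen x)}"
  have sub: "subalgebra A ((\<lambda>h. h x0) ` H)"
    unfolding subalgebra_def
  proof (intro conjI ballI)
    have gs: "vs.subspace (?gen x)" for x by (rule subalgebra_subspace[OF subalgebra_generated])
    show "vs.subspace ((\<lambda>h. h x0) ` H)"
      unfolding vs.subspace_def
    proof (intro conjI ballI allI)
      have "(\<lambda>_. 0) \<in> H" using vs.subspace_0[OF gs] by (auto simp: H_def polymap_const)
      then show "0 \<in> (\<lambda>h. h x0) ` H" by force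
    next
      fix u v assume "u \<in> (\<lambda>h. h x0) ` H" "v \<in> (\<lambda>h. h x0) ` H"
      then obtain h k where hk: "h \<in> H" "k \<in> H" "u = h x0" "v = k x0" by blast
      have "(\<lambda>x. h x + k x) \<in> H" using hk(1,2) vs.subspace_add[OF gs] by (auto simp: H_def polymap_add)
      then show "u + v \<in> (\<lambda>h. h x0) ` H" using hk(3,4) by force
    next
      fix c u assume "u \<in> (\<lambda>h. h x0) ` H"
      then obtain h where h: "h \<in> H" "u = h x0" by blast
      have "(\<lambda>x. c *a h x) \<in> H" using h(1) vs.subspace_scale[OF gs]
        by (auto simp: H_def intro!: polymap_scale pf_const)
      then show "c *a u \<in> (\<lambda>h. h x0) ` H" using h(2) by force
    qed
    fix i x assume i: "i \<in> opindex A" and x: "x \<in> tuples (arity A i) ((\<lambda>h. h x0) ` H)"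
    have "\<forall>k<arity A i. \<exists>h. h \<in> H \<and> x k = h x0" using x by (auto simp: PiE_iff)
    then obtain h where h: "\<And>k. k < arity A i \<Longrightarrow> h k \<in> H \<and> x k = h k x0" by metis
    let ?o = "\<lambda>y. oper A i (\<lambda>k\<in>{..<arity A i}. h k y)"
    have "x = (\<lambda>k\<in>{..<arity A i}. h k x0)"
      using x h by (intro ext) (auto simp: PiE_iff extensional_def)
    moreover have "?o \<in> H"
      unfolding H_def
    proof (intro CollectI conjI ballI)
      show "polymap ?Om (CV r) ?o" using h by (intro polymap_oper[OF i]) (auto simp: H_def)
      fix y assume "y \<in> ?Om"
      then have "(\<lambda>k\<in>{..<arity A i}. h k y) \<in> tuples (arity A i) (?gen y)"
        using h by (auto simp: H_def)
      then show "?o y \<in> ?gen y" using subalgebra_generated i unfolding subalgebra_def by blast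
    qed
    ultimately show "oper A i x \<in> (\<lambda>h. h x0) ` H"
      by (intro image_eqI[where x = ?o]) simp_all
  qed
  have "x0 ` {..<r} \<subseteq> (\<lambda>h. h x0) ` H"
  proof
    fix v assume "v \<in> x0 ` {..<r}"
    then obtain j where j: "j < r" "v = x0 j" by auto
    then have "(\<lambda>x. x j) \<in> H" by (auto simp: H_def intro: polymap_CV generated_inc)
    then show "v \<in> (\<lambda>h. h x0) ` H" using j(2) by force
  qed
  then have gH: "?gen x0 \<subseteq> (\<lambda>h. h x0) ` H" using generated_minimal[OF sub] by blast
  obtain B where B: "B \<subseteq> ?gen x0" "vs.independent B" "?gen x0 \<subseteq> vs.span B" "card B = vs.dim (?gen x0)"
    by (rule vs.basis_exists)
  have finB: "finite B" using B(2) by (rule vs.finiteI_independent)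
  have "\<forall>b\<in>B. \<exists>h. h \<in> H \<and> h x0 = b" using B(1) gH by blast
  then obtain h where h: "\<And>b. b \<in> B \<Longrightarrow> h b \<in> H \<and> h b x0 = b" by metis
  have "rows_indep B Bs (\<lambda>k l. ep l (h k x0))"
    by (rule rows_indep_cong[OF independent_rows_indep[OF B(2)]]) (use h in auto)
  then obtain D where D: "D \<in> PF (CV r)" "D x0 \<noteq> 0"
    "\<And>x. x \<in> ?Om \<Longrightarrow> D x \<noteq> 0 \<Longrightarrow> rows_indep B Bs (\<lambda>k l. ep l (h k x))"
    using independent_open[OF finB _ assms, of "CV r" h] h unfolding H_def by blast
  have "vs.dim (?gen x) \<ge> vs.dim (?gen x0)" if x: "x \<in> ?Om" "D x \<noteq> 0" for x
  proof -
    note ind = rows_indep_independent[OF finB D(3)[OF x]]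
    have "(\<lambda>k. h k x) ` B \<subseteq> ?gen x" using h x(1) by (auto simp: H_def)
    from vs.independent_card_le_dim[OF this ind(2)] show ?thesis
      using card_image[OF ind(1)] B(4) by simp
  qed
  then show ?thesis using D by blast
qed

lemma relclosed_nongenerating:
  "relclosed (CV r) (tuples r UNIV) {x \<in> tuples r UNIV. generated A (x ` {..<r}) \<noteq> UNIV}"
proof -
  let ?Om = "tuples r (UNIV :: 'a set)"
  let ?N = "{x \<in> ?Om. generated A (x ` {..<r}) \<noteq> UNIV}"
  let ?P = "{p \<in> PF (CV r). \<forall>x\<in>?N. p x = 0}"
  have "?N = {x \<in> ?Om. \<forall>p\<in>?P. p x = 0}"
  proof (intro equalityI subsetI)
    fix x0 assume x0: "x0 \<in> {x \<in> ?Om. \<forall>p\<in>?P. p x = 0}"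
    show "x0 \<in> ?N"
    proof (rule ccontr)
      assume n: "x0 \<notin> ?N"
      obtain D where D: "D \<in> PF (CV r)" "D x0 \<noteq> 0" "\<forall>x\<in>?Om. D x \<noteq> 0 \<longrightarrow>
        vs.dim (generated A (x ` {..<r})) \<ge> vs.dim (generated A (x0 ` {..<r}))"
        using generated_dim_open[of x0 r] x0 by blast
      have "generated A (x ` {..<r}) = UNIV" if "x \<in> ?Om" "D x \<noteq> 0" for x
      proof (rule vs.subspace_dim_equal[OF subalgebra_subspace[OF subalgebra_generated] vs.subspace_UNIV subset_UNIV])
        have "generated A (x0 ` {..<r}) = UNIV" using n x0 by blast
        then show "vs.dim UNIV \<le> vs.dim (generated A (x ` {..<r}))" using D(3) that by simp
      qed
      then have "D \<in> ?P" using D(1) by blast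
      then show False using x0 D(2) by blast
    qed
  qed auto
  then show ?thesis unfolding relclosed_def by (intro exI[of _ ?P]) auto
qed

lemma proper_subalgebra_maximal:
  assumes "subalgebra A S" "S \<noteq> UNIV"
  shows "\<exists>N. maximal_subalgebra A N \<and> S \<subseteq> N"
proof -
  let ?Q = "\<lambda>N. subalgebra A N \<and> N \<noteq> UNIV \<and> S \<subseteq> N"
  have "\<exists>N. ?Q N \<and> (\<forall>N'. ?Q N' \<longrightarrow> vs.dim N' \<le> vs.dim N)"
    by (rule ex_has_greatest_nat[of ?Q S vs.dim "Suc vs.dimension"])
       (use assms vs.dim_subset_UNIV in \<open>auto simp: less_Suc_eq_le\<close>)
  then obtain N where N: "?Q N" "\<And>N'. ?Q N' \<Longrightarrow> vs.dim N' \<le> vs.dim N" by blast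
  have "N' = N" if "subalgebra A N'" "N' \<noteq> UNIV" "N \<subseteq> N'" for N'
  proof -
    have "vs.dim N' \<le> vs.dim N" using N that by blast
    then have "N = N'" using N(1) that
      by (intro vs.subspace_dim_equal) (auto simp: subalgebra_def)
    then show ?thesis by simp
  qed
  then show ?thesis using N(1) unfolding maximal_subalgebra_def by blast
qed

subsection \<open>The automorphism group\<close>

abbreviation "Aut \<equiv> automorphisms A"

lemma Aut_lin: "Aut \<subseteq> OmE"
  by (auto simp: automorphisms_def)

lemma Aut_id: "id \<in> Aut"
proof -
  have "compose {..<n} id x = x" if "x \<in> tuples n (UNIV :: 'a set)" for n and x :: "nat \<Rightarrow> 'a"
    using that by (auto simp: fun_eq_iff compose_def PiE_iff extensional_def)
  then show ?thesis unfolding automorphisms_def by (simp add: lin_iff)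
qed

lemma Aut_comp: "g \<in> Aut \<Longrightarrow> h \<in> Aut \<Longrightarrow> g \<circ> h \<in> Aut"
  unfolding automorphisms_def
proof (intro CollectI conjI ballI; (elim CollectE conjE)?)
  assume "Vector_Spaces.linear (smult A) (smult A) g" "Vector_Spaces.linear (smult A) (smult A) h"
  then show "Vector_Spaces.linear (smult A) (smult A) (g \<circ> h)" by (simp add: lin_iff)
next
  assume "bij g" "bij h" then show "bij (g \<circ> h)" by (simp add: bij_comp)
next
  fix i x
  assume i: "i \<in> opindex A" and x: "x \<in> tuples (arity A i) (UNIV :: 'a set)"
    and g: "\<forall>i\<in>opindex A. \<forall>x\<in>tuples (arity A i) UNIV. g (oper A i x) = oper A i (compose {..<arity A i} g x)"
    and h: "\<forall>i\<in>opindex A. \<forall>x\<in>tuples (arity A i) UNIV. h (oper A i x) = oper A i (compose {..<arity A i} h x)"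
  have "compose {..<arity A i} h x \<in> tuples (arity A i) UNIV" by (auto simp: compose_def)
  moreover have "compose {..<arity A i} g (compose {..<arity A i} h x) = compose {..<arity A i} (g \<circ> h) x"
    by (auto simp: compose_def fun_eq_iff)
  ultimately show "(g \<circ> h) (oper A i x) = oper A i (compose {..<arity A i} (g \<circ> h) x)"
    using g h i x by simp
qed

lemma Aut_inv:
  assumes "g \<in> Aut"
  shows "\<exists>h\<in>Aut. h \<circ> g = id \<and> g \<circ> h = id"
proof -
  have lin: "Vector_Spaces.linear (smult A) (smult A) g" and bij: "bij g"
    and op: "\<And>i x. i \<in> opindex A \<Longrightarrow> x \<in> tuples (arity A i) UNIV \<Longrightarrow>
       g (oper A i x) = oper A i (compose {..<arity A i} g x)"
    using assms unfolding automorphisms_def by auto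
  define h where "h = inv g"
  have hg: "h (g x) = x" and gh: "g (h x) = x" for x
    using bij unfolding h_def by (simp_all add: bij_is_inj bij_is_surj surj_f_inv_f)
  have "Vector_Spaces.linear (smult A) (smult A) h"
    unfolding lin_iff
  proof (intro conjI allI)
    have "h (g (h x + h y)) = h (x + y)" for x y using lin by (simp add: lin_iff gh)
    then show "h (x + y) = h x + h y" for x y by (simp add: hg)
    have "h (g (c *a h x)) = h (c *a x)" for c x using lin by (simp add: lin_iff gh)
    then show "h (c *a x) = c *a h x" for c x by (simp add: hg)
  qed
  moreover have "bij h" unfolding h_def using bij by (rule bij_imp_bij_inv)
  moreover have "h (oper A i x) = oper A i (compose {..<arity A i} h x)"
    if i: "i \<in> opindex A" and x: "x \<in> tuples (arity A i) UNIV" for i x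
  proof -
    have "compose {..<arity A i} h x \<in> tuples (arity A i) UNIV" by (auto simp: compose_def)
    moreover have "compose {..<arity A i} g (compose {..<arity A i} h x) = x"
      using x by (auto simp: compose_def fun_eq_iff gh PiE_iff extensional_def)
    ultimately have "g (oper A i (compose {..<arity A i} h x)) = oper A i x" using op[OF i] by simp
    then show ?thesis by (metis hg)
  qed
  ultimately have "h \<in> Aut" unfolding automorphisms_def by blast
  then show ?thesis using hg gh by (intro bexI[of _ h]) (auto simp: fun_eq_iff)
qed

lemma lin_inj_bij:
  assumes lin: "Vector_Spaces.linear (smult A) (smult A) f" and "rows_indep Bs Bs (\<lambda>k l. ep l (f k))"
  shows "bij f"
proof -
  have ind: "\<And>c k. (\<Sum>k\<in>Bs. c k *a f k) = 0 \<Longrightarrow> k \<in> Bs \<Longrightarrow> c k = 0"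
    using assms(2) unfolding rows_indep_vec by blast
  have "inj f"
  proof (rule injI)
    fix x y assume "f x = f y"
    have "f (x + (- 1) *a y) = f x + f ((- 1) *a y)" "f ((- 1) *a y) = (- 1) *a f y"
      using lin unfolding lin_iff by blast+
    then have z: "f (x - y) = 0" using \<open>f x = f y\<close> by simp
    have "ep b (x - y) = 0" if "b \<in> Bs" for b
      by (rule ind[OF _ that]) (use z lin_expand[OF lin, of "x - y"] in simp)
    then have "x - y = 0" by (rule ep_separate)
    then show "x = y" by simp
  qed
  then show ?thesis using vs.linear_inj_imp_surj[OF lin] by (simp add: bij_def)
qed

text \<open>Compatibility with the operations is a polynomial condition and passes to the closure;
  bijectivity is guaranteed by the nonvanishing of \<open>D\<close>.\<close>

lemma loc_closed_Aut: "loc_closed OmE CE Aut"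
  unfolding loc_closed_def
proof (intro conjI Aut_lin ballI)
  fix w assume w: "w \<in> Aut"
  have lin: "Vector_Spaces.linear (smult A) (smult A) w" and bij: "bij w"
    using w by (auto simp: automorphisms_def)
  have "rows_indep Bs Bs (\<lambda>k l. ep l (w k))"
    unfolding rows_indep_vec
  proof (intro allI impI ballI)
    fix c k assume c: "(\<Sum>k\<in>Bs. c k *a w k) = 0" and k: "k \<in> Bs"
    have "w (\<Sum>k\<in>Bs. c k *a k) = 0" using c lin_sum[OF lin, of c "\<lambda>k. k" Bs] by simp
    moreover have "w 0 = 0" using lin_sum[OF lin, of c "\<lambda>k. k" "{}"] by simp
    ultimately have "(\<Sum>k\<in>Bs. c k *a k) = 0" using bij by (metis bij_pointE)
    then show "c k = 0" using ep_comb[OF k, of c] lf_zero[OF ep_lf] by simp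
  qed
  then obtain D where D: "D \<in> PF CE" "D w \<noteq> 0"
    "\<And>f. f \<in> OmE \<Longrightarrow> D f \<noteq> 0 \<Longrightarrow> rows_indep Bs Bs (\<lambda>k l. ep l (f k))"
    using independent_open[OF Bs(1) polymap_CE[OF order_refl], of w "\<lambda>x. x"] lin by auto
  have "f \<in> Aut" if f: "f \<in> zclosure OmE CE Aut" "D f \<noteq> 0" for f
  proof -
    have fl: "f \<in> OmE" using f(1) by (simp add: zclosure_def)
    have "f (oper A i x) = oper A i (compose {..<arity A i} f x)"
      if i: "i \<in> opindex A" and x: "x \<in> tuples (arity A i) UNIV" for i x
    proof (rule lf_separate)
      fix \<phi> assume \<phi>: "\<phi> \<in> linear_functionals A"
      obtain p where p: "p \<in> PF CE" "\<forall>f\<in>OmE. \<phi> (f (oper A i x)) = p f"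
        using polymapD[OF polymap_CE[OF order_refl] \<phi>] by blast
      have "polymap OmE CE (\<lambda>f. oper A i (\<lambda>k\<in>{..<arity A i}. f (x k)))"
        by (intro polymap_oper[OF i] polymap_CE) auto
      from polymapD[OF this \<phi>] obtain q where q: "q \<in> PF CE"
        "\<forall>f\<in>OmE. \<phi> (oper A i (compose {..<arity A i} f x)) = q f" unfolding compose_def by blast
      have "p f - q f = 0"
      proof (rule zclosureD[OF f(1) pf_diff[OF p(1) q(1)]])
        fix g assume g: "g \<in> Aut"
        then have "g (oper A i x) = oper A i (compose {..<arity A i} g x)"
          using i x by (simp add: automorphisms_def)
        then show "p g - q g = 0" using p(2) q(2) g Aut_lin by (metis diff_self subsetD)
      qed
      then show "\<phi> (f (oper A i x)) = \<phi> (oper A i (compose {..<arity A i} f x))"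
        using p(2) q(2) fl by simp
    qed
    moreover have "bij f" using lin_inj_bij D(3)[OF fl f(2)] fl by blast
    ultimately show ?thesis using fl by (simp add: automorphisms_def)
  qed
  then show "\<exists>b\<in>PF CE. b w \<noteq> 0 \<and> (\<forall>x\<in>zclosure OmE CE Aut. b x \<noteq> 0 \<longrightarrow> x \<in> Aut)"
    using D(1,2) by blast
qed

lemma Aut0_group:
  shows "irr CE (Aut0 A)" "relclosed CE Aut (Aut0 A)" "id \<in> Aut0 A"
    "\<And>g h. g \<in> Aut0 A \<Longrightarrow> h \<in> Aut0 A \<Longrightarrow> g \<circ> h \<in> Aut0 A"
    "\<And>g. g \<in> Aut0 A \<Longrightarrow> \<exists>h\<in>Aut0 A. h \<circ> g = id \<and> g \<circ> h = id"
proof -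
  have trans: "\<exists>q\<in>PF CE. \<forall>h\<in>Aut. f (g \<circ> h) = q h" if g: "g \<in> Aut" and f: "f \<in> CE" for g f
  proof -
    obtain b c where bc: "f = (\<lambda>f. ep b (f c))" using f by (auto simp: CE_def)
    have "(\<lambda>v. ep b (g v)) \<in> linear_functionals A"
      using ep_lf[of b] g by (auto simp: lf_iff automorphisms_def lin_iff)
    from polymapD[OF polymap_CE[OF Aut_lin, of c] this] show ?thesis by (simp add: bc)
  qed
  note * = identity_component[OF finite_CE Aut_lin Aut_id Aut_comp Aut_inv trans Aut0_def[of A, unfolded End_eq]]
  show "irr CE (Aut0 A)" by (rule *(1))
  show "relclosed CE Aut (Aut0 A)" by (rule *(2))
  show "id \<in> Aut0 A" by (rule *(3))
  show "\<And>g h. g \<in> Aut0 A \<Longrightarrow> h \<in> Aut0 A \<Longrightarrow> g \<circ> h \<in> Aut0 A" by (rule *(4))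
  show "\<And>g. g \<in> Aut0 A \<Longrightarrow> \<exists>h\<in>Aut0 A. h \<circ> g = id \<and> g \<circ> h = id" by (rule *(5))
qed

end

subsection \<open>The family of translates of a subalgebra\<close>

locale translates = fd_multialgebra A
  for A :: "('k::alg_closed_field, 'a::ab_group_add, 'i) multialg" +
  fixes G :: "('a \<Rightarrow> 'a) set" and M :: "'a set" and r :: nat
  assumes G: "G = Aut0 A" and M: "subalgebra A M"
begin

lemma G_Aut: "G \<subseteq> Aut"
  using relclosed_subset[OF Aut0_group(2)] by (simp add: G)

lemma G_lin: "G \<subseteq> OmE"
  using G_Aut Aut_lin by blast

lemma G_linear: "g \<in> G \<Longrightarrow> Vector_Spaces.linear (smult A) (smult A) g"
  using G_lin by blast

lemma G_irr: "irr CE G"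
  using Aut0_group(1) by (simp add: G)

lemma G_id: "id \<in> G"
  using Aut0_group(3) by (simp add: G)

lemma G_comp: "g \<in> G \<Longrightarrow> h \<in> G \<Longrightarrow> g \<circ> h \<in> G"
  using Aut0_group(4) by (simp add: G)

lemma G_inv: "g \<in> G \<Longrightarrow> \<exists>h\<in>G. h \<circ> g = id \<and> g \<circ> h = id"
  using Aut0_group(5) by (simp add: G)

lemma G_bij: "g \<in> G \<Longrightarrow> bij g"
  using G_Aut by (auto simp: automorphisms_def)

lemma loc_closed_G: "loc_closed OmE CE G"
  using loc_closed_relclosed[OF loc_closed_Aut Aut0_group(2)] by (simp add: G)

lemma M_subspace: "vs.subspace M"
  using M by (rule subalgebra_subspace)

abbreviation "m \<equiv> vs.dim M"
abbreviation "N \<equiv> r * m"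
abbreviation "CP \<equiv> prod_coords CE (CV r)"
abbreviation "OmV \<equiv> tuples r (UNIV :: 'a set)"

lemma basis_M:
  "\<exists>\<mu> :: nat \<Rightarrow> 'a. (\<forall>k<m. \<mu> k \<in> M) \<and> inj_on \<mu> {..<m} \<and> vs.independent (\<mu> ` {..<m}) \<and> M \<subseteq> vs.span (\<mu> ` {..<m})"
proof -
  obtain B where B: "B \<subseteq> M" "vs.independent B" "M \<subseteq> vs.span B" "card B = m" by (rule vs.basis_exists)
  have "finite B" using B(2) by (rule vs.finiteI_independent)
  then obtain \<mu> where "bij_betw \<mu> {..<m} B"
    using ex_bij_betw_nat_finite[of B] B(4) by (auto simp: atLeast0LessThan)
  then show ?thesis using B by (intro exI[of _ \<mu>]) (auto simp: bij_betw_def)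
qed

definition mu :: "nat \<Rightarrow> 'a" where
  "mu = (SOME \<mu>. (\<forall>k<m. \<mu> k \<in> M) \<and> inj_on \<mu> {..<m} \<and> vs.independent (\<mu> ` {..<m}) \<and> M \<subseteq> vs.span (\<mu> ` {..<m}))"

lemma mu: "\<And>k. k < m \<Longrightarrow> mu k \<in> M" "inj_on mu {..<m}" "vs.independent (mu ` {..<m})" "M \<subseteq> vs.span (mu ` {..<m})"
  using someI_ex[OF basis_M] unfolding mu_def[symmetric] by blast+

text \<open>\<open>lam k\<close> for \<open>k < m\<close> are functionals restricting to the basis of the dual of \<open>M\<close> dual to \<open>mu\<close>.\<close>

definition lam :: "nat \<Rightarrow> 'a \<Rightarrow> 'k" where
  "lam k v = vs.representation (vs.extend_basis (mu ` {..<m})) v (mu k)"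

lemma lam_lf: "lam k \<in> linear_functionals A"
  unfolding lam_def[abs_def]
  by (rule lf_rep[OF vs.independent_extend_basis[OF mu(3)] vs.span_extend_basis[OF mu(3)]])

lemma lam_mu:
  assumes "k < m" "l < m"
  shows "lam k (mu l) = (if k = l then 1 else 0)"
proof -
  have "mu l \<in> vs.extend_basis (mu ` {..<m})" using vs.extend_basis_superset[OF mu(3)] assms by auto
  then show ?thesis
    using vs.representation_basis[OF vs.independent_extend_basis[OF mu(3)], of "mu l"] assms mu(2)
    by (auto simp: lam_def inj_on_def)
qed

lemma lam_comb: "k < m \<Longrightarrow> lam k (\<Sum>l<m. c l *a mu l) = c k"
  by (simp add: lf_sum[OF lam_lf] lam_mu if_distrib[of "\<lambda>x. _ * x"] cong: if_cong)

lemma M_comb: "(\<Sum>k<m. c k *a mu k) \<in> M"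
  using M_subspace mu(1) by (intro vs.subspace_sum vs.subspace_scale) auto

lemma M_expand:
  assumes "v \<in> M"
  shows "v = (\<Sum>k<m. lam k v *a mu k)"
proof -
  let ?B = "mu ` {..<m}"
  have "v = (\<Sum>b\<in>?B. vs.representation ?B v b *a b)"
    by (rule vs.sum_representation_eq[symmetric]) (use mu assms in auto)
  also have "\<dots> = (\<Sum>k<m. vs.representation ?B v (mu k) *a mu k)"
    using mu(2) by (simp add: sum.reindex)
  finally obtain c where c: "v = (\<Sum>k<m. c k *a mu k)"
    by (rule that[of "\<lambda>k. vs.representation ?B v (mu k)"])
  then have "lam k v = c k" if "k < m" for k using lam_comb[OF that, of c] by simp
  then show ?thesis using c by simp
qed

lemma image_M_expand:
  assumes "g \<in> G" "v \<in> g ` M"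
  shows "\<exists>c. v = (\<Sum>k<m. c k *a g (mu k))"
proof -
  obtain x where x: "x \<in> M" "v = g x" using assms(2) by blast
  have "g x = g (\<Sum>k<m. lam k x *a mu k)" using M_expand[OF x(1)] by simp
  then show ?thesis using x(2) lin_sum[OF G_linear[OF assms(1)]] by metis
qed

lemma image_M_comb: "g \<in> G \<Longrightarrow> (\<Sum>k<m. c k *a g (mu k)) \<in> g ` M"
  using M_comb[of c] lin_sum[OF G_linear, of g c mu "{..<m}"] by (metis image_eqI)

lemma subalgebra_image:
  assumes g: "g \<in> G"
  shows "subalgebra A (g ` M)"
  unfolding subalgebra_def
proof (intro conjI ballI)
  have lin: "g (x + y) = g x + g y" "g (c *a x) = c *a g x" for x y c
    using G_linear[OF g] unfolding lin_iff by blast+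
  show "vs.subspace (g ` M)"
    unfolding vs.subspace_def
  proof (intro conjI ballI allI)
    have "g 0 = 0" using lin(2)[of 0 0] by simp
    then show "0 \<in> g ` M" using vs.subspace_0[OF M_subspace] by (metis image_eqI)
    fix x y assume "x \<in> g ` M" "y \<in> g ` M"
    then obtain x' y' where xy: "x' \<in> M" "y' \<in> M" "x = g x'" "y = g y'" by blast
    have "x' + y' \<in> M" using vs.subspace_add[OF M_subspace] xy by blast
    then show "x + y \<in> g ` M" using xy lin(1) by (metis image_eqI)
  next
    fix c x assume "x \<in> g ` M"
    then obtain x' where x: "x' \<in> M" "x = g x'" by blast
    have "c *a x' \<in> M" using vs.subspace_scale[OF M_subspace] x by blast
    then show "c *a x \<in> g ` M" using x lin(2) by (metis image_eqI)
  qed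
  fix i x assume i: "i \<in> opindex A" and x: "x \<in> tuples (arity A i) (g ` M)"
  have "\<forall>k<arity A i. \<exists>v. v \<in> M \<and> x k = g v" using x by (auto simp: PiE_iff)
  then obtain x' where x': "\<And>k. k < arity A i \<Longrightarrow> x' k \<in> M \<and> x k = g (x' k)" by metis
  let ?x = "restrict x' {..<arity A i}"
  have xM: "?x \<in> tuples (arity A i) M" using x' by auto
  then have op: "oper A i ?x \<in> M" using M i by (simp add: subalgebra_def)
  have "compose {..<arity A i} g ?x = x"
    using x x' by (auto simp: compose_def fun_eq_iff PiE_iff extensional_def)
  moreover have "g (oper A i ?x) = oper A i (compose {..<arity A i} g ?x)"
  proof -
    have "?x \<in> tuples (arity A i) UNIV" "g \<in> Aut" using G_Aut g by auto
    then show ?thesis using i unfolding automorphisms_def by blast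
  qed
  ultimately have "g (oper A i ?x) = oper A i x" by simp
  then show "oper A i x \<in> g ` M" using op by (metis image_eqI)
qed

lemma mu_comb_zero: "(\<Sum>k<m. c k *a mu k) = 0 \<Longrightarrow> k < m \<Longrightarrow> c k = 0"
  using lam_comb[of k c] lf_zero[OF lam_lf] by simp

lemma image_mu_comb_zero:
  assumes g: "g \<in> G" and c: "(\<Sum>k<m. c k *a g (mu k)) = 0" "k < m"
  shows "c k = 0"
proof (rule mu_comb_zero[OF _ c(2)])
  have "g (\<Sum>k<m. c k *a mu k) = g 0"
    using c(1) lin_sum[OF G_linear[OF g], of c mu "{..<m}"] lin_sum[OF G_linear[OF g], of c mu "{}"] by simp
  then show "(\<Sum>k<m. c k *a mu k) = 0" using G_bij[OF g] by (metis bij_pointE)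
qed

lemma dim_image:
  assumes g: "g \<in> G"
  shows "vs.dim (g ` M) = m"
proof (rule antisym)
  have "g ` M \<subseteq> vs.span ((\<lambda>k. g (mu k)) ` {..<m})"
  proof
    fix v assume "v \<in> g ` M"
    then obtain c where c: "v = (\<Sum>k<m. c k *a g (mu k))" using image_M_expand[OF g] by blast
    show "v \<in> vs.span ((\<lambda>k. g (mu k)) ` {..<m})"
      unfolding c by (intro vs.span_sum vs.span_scale vs.span_base) auto
  qed
  then have "vs.dim (g ` M) \<le> card ((\<lambda>k. g (mu k)) ` {..<m})" by (rule vs.dim_le_card) simp
  then show "vs.dim (g ` M) \<le> m" using card_image_le[of "{..<m}" "\<lambda>k. g (mu k)"] by simp
  have "rows_indep {..<m} Bs (\<lambda>k l. ep l (g (mu k)))"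
    unfolding rows_indep_vec using image_mu_comb_zero[OF g] by auto
  note ind = rows_indep_independent[OF finite_lessThan this]
  have "(\<lambda>k. g (mu k)) ` {..<m} \<subseteq> g ` M" using mu(1) by auto
  from vs.independent_card_le_dim[OF this ind(2)] show "m \<le> vs.dim (g ` M)"
    using card_image[OF ind(1)] by simp
qed

section \<open>The incidence set and its projection\<close>

definition U :: "(nat \<Rightarrow> 'a) set" where "U = (\<Union>g\<in>G. tuples r (g ` M))"
text \<open>For \<open>M = M i\<close> this is the set \<open>X i\<close> of the final theorem, by
  \<open>Y_closure\<close>.\<close>

definition Y :: "(nat \<Rightarrow> 'a) set" where "Y = zclosure OmV (CV r) U"

text \<open>
  Recording \<open>g x\<close> instead of \<open>x\<close> makes the action of the stabilizer free of inverses, which are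
  not polynomial in the matrix coefficients.
\<close>

definition Wt :: "(('a \<Rightarrow> 'a) \<times> (nat \<Rightarrow> 'a)) set" where
  "Wt = {(g, y). g \<in> G \<and> y \<in> tuples r (g ` M)}"
abbreviation "S \<equiv> stab G M"

lemma U_OmV: "U \<subseteq> OmV"
  unfolding U_def by (auto simp: PiE_iff)

lemma U_Y: "U \<subseteq> Y"
  using U_OmV unfolding Y_def zclosure_def by auto

text \<open>The projection of \<open>Wt\<close> is dense in \<open>Y\<close>, in the form expected
  by \<open>dominant_pullback\<close> and \<open>alg_pullback\<close>.\<close>

lemma vanish_Y:
  assumes "p \<in> PF (CV r)" "\<And>w. w \<in> Wt \<Longrightarrow> p (snd w) = 0" "y \<in> Y"
  shows "p y = 0"
proof (rule zclosureD[OF _ assms(1)])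
  show "y \<in> zclosure OmV (CV r) U" using assms(3) by (simp add: Y_def)
  fix u assume "u \<in> U"
  then obtain g where "(g, u) \<in> Wt" by (auto simp: U_def Wt_def)
  then show "p u = 0" using assms(2) by force
qed

text \<open>Parametrizes \<open>Wt\<close> by \<open>G\<close> times affine \<open>N\<close>-space:
  entry \<open>j * m + k\<close> is the coefficient of \<open>g (mu k)\<close> in the
  \<open>j\<close>-th component.\<close>

definition Phi :: "('a \<Rightarrow> 'a) \<times> (nat \<Rightarrow> 'k) \<Rightarrow> ('a \<Rightarrow> 'a) \<times> (nat \<Rightarrow> 'a)" where
  "Phi w = (fst w, \<lambda>j\<in>{..<r}. \<Sum>k<m. snd w (j * m + k) *a fst w (mu k))"

lemma Wt_Phi: "Wt = Phi ` (G \<times> UNIV)"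
proof (intro equalityI subsetI)
  fix w assume "w \<in> Wt"
  then obtain g y where w: "w = (g, y)" "g \<in> G" "y \<in> tuples r (g ` M)" by (auto simp: Wt_def)
  have "\<forall>j<r. \<exists>c. y j = (\<Sum>k<m. c k *a g (mu k))"
    using image_M_expand[OF w(2)] w(3) by (auto simp: PiE_iff)
  then obtain c where c: "\<And>j. j < r \<Longrightarrow> y j = (\<Sum>k<m. c j k *a g (mu k))" by metis
  let ?c = "\<lambda>n. c (n div m) (n mod m)"
  have "?c (j * m + k) = c j k" if "k < m" for j k
  proof -
    have "(j * m + k) div m = j" by (rule div_nat_eqI) (use that in auto)
    then show ?thesis using that by simp
  qed
  then have "(\<Sum>k<m. ?c (j * m + k) *a g (mu k)) = (\<Sum>k<m. c j k *a g (mu k))" for j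
    by (intro sum.cong) simp_all
  then have "y = (\<lambda>j\<in>{..<r}. \<Sum>k<m. ?c (j * m + k) *a g (mu k))"
    using w(3) c by (simp add: fun_eq_iff PiE_iff extensional_def)
  then have "w = Phi (g, ?c)" using w(1) by (simp add: Phi_def)
  then show "w \<in> Phi ` (G \<times> UNIV)" using w(2) by blast
next
  fix w assume "w \<in> Phi ` (G \<times> UNIV)"
  then obtain g c where g: "g \<in> G" "w = Phi (g, c)" by auto
  have "(\<lambda>j\<in>{..<r}. \<Sum>k<m. c (j * m + k) *a g (mu k)) \<in> tuples r (g ` M)"
    by (rule restrict_PiE_iff[THEN iffD2]) (auto intro: image_M_comb[OF g(1)])
  then show "w \<in> Wt" using g by (simp add: Phi_def Wt_def)
qed

lemma Phi_pf:
  assumes "f \<in> CP"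
  shows "\<exists>q\<in>PF (prod_coords CE (vars N)). \<forall>w\<in>G \<times> UNIV. f (Phi w) = q w"
proof -
  consider e where "e \<in> CE" "f = (\<lambda>w. e (fst w))" | b j where "b \<in> Bs" "j < r" "f = (\<lambda>w. ep b (snd w j))"
    using assms unfolding prod_coords_def CV_def by auto
  then show ?thesis
  proof cases
    case 1
    then show ?thesis by (intro bexI[of _ "\<lambda>w. e (fst w)"] pf_fst pf_coord) (auto simp: Phi_def)
  next
    case 2
    have "\<forall>k. \<exists>q. q \<in> PF CE \<and> (\<forall>g\<in>OmE. ep b (g (mu k)) = q g)"
      using polymapD[OF polymap_CE[OF order_refl] ep_lf] by blast
    from choice[OF this] obtain q where q: "\<And>k. q k \<in> PF CE" "\<And>k g. g \<in> OmE \<Longrightarrow> ep b (g (mu k)) = q k g"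
      by blast
    have idx: "j * m + k < N" if "k < m" for k
    proof -
      have "j * m + k < Suc j * m" using that by simp
      also have "\<dots> \<le> N" using 2(2) by (intro mult_right_mono) auto
      finally show ?thesis .
    qed
    show ?thesis
    proof (intro bexI[of _ "\<lambda>w. \<Sum>k<m. snd w (j * m + k) * q k (fst w)"] ballI)
      show "(\<lambda>w. \<Sum>k<m. snd w (j * m + k) * q k (fst w)) \<in> PF (prod_coords CE (vars N))"
        by (intro pf_sum pf_mult pf_fst q pf_snd pf_vars_var idx) auto
      fix w :: "('a \<Rightarrow> 'a) \<times> (nat \<Rightarrow> 'k)" assume "w \<in> G \<times> UNIV"
      then have "fst w \<in> OmE" using G_lin by auto
      then have "ep b (fst w (mu k)) = q k (fst w)" for k by (rule q(2))
      then show "f (Phi w) = (\<Sum>k<m. snd w (j * m + k) * q k (fst w))"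
        using 2(2) by (simp add: 2(3) Phi_def lf_sum[OF ep_lf])
    qed
  qed
qed

lemma Wt_irr: "irr CP Wt"
  unfolding Wt_Phi by (rule irr_image[OF irr_prod[OF G_irr irr_affine[of N]] Phi_pf])

lemma finite_CP: "finite CP"
  by (intro finite_prod_coords finite_CE finite_CV)

text \<open>As \<open>Phi\<close> is onto \<open>Wt\<close>, a dominant family on \<open>Wt\<close>
  stays dominant on the parameter space.\<close>

lemma Wt_dominant_le:
  assumes f: "\<And>i. i < n \<Longrightarrow> f i \<in> PF CP" "dominant Wt n f"
  shows "n \<le> trdeg CE G + N"
proof -
  have "\<forall>i. \<exists>q. i < n \<longrightarrow> q \<in> PF (prod_coords CE (vars N)) \<and> (\<forall>w\<in>G \<times> UNIV. f i (Phi w) = q w)"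
    using pf_pull[of _ CP _ "G \<times> UNIV" Phi] f(1) Phi_pf by blast
  from choice[OF this] obtain q where q: "\<And>i. i < n \<Longrightarrow> q i \<in> PF (prod_coords CE (vars N))"
    "\<And>i w. i < n \<Longrightarrow> w \<in> G \<times> UNIV \<Longrightarrow> f i (Phi w) = q i w" by blast
  have "dominant (G \<times> UNIV) n (\<lambda>i w. f i (Phi w))"
    by (rule dominant_pullback[OF f(2,1)]) (auto simp: Wt_Phi)
  then have "dominant (G \<times> UNIV) n q" by (rule dominant_cong) (rule q(2))
  then show ?thesis by (intro dominant_prod_affine_le[OF G_irr finite_CE q(1)])
qed

lemma trans_CE:
  assumes "g \<in> OmE" "f \<in> PF CE"
  shows "\<exists>q\<in>PF CE. \<forall>h\<in>OmE. f (g \<circ> h) = q h"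
proof (rule pf_pull[OF assms(2)])
  fix f assume "f \<in> CE"
  then obtain b c where bc: "f = (\<lambda>f. ep b (f c))" by (auto simp: CE_def)
  have "(\<lambda>v. ep b (g v)) \<in> linear_functionals A"
    using ep_lf[of b] assms(1) by (auto simp: lf_iff lin_iff)
  from polymapD[OF polymap_CE[OF order_refl, of c] this]
  show "\<exists>q\<in>PF CE. \<forall>h\<in>OmE. f (g \<circ> h) = q h" by (simp add: bc)
qed

lemma trans_right_CE:
  assumes "h \<in> OmE" "f \<in> PF CE"
  shows "\<exists>q\<in>PF CE. \<forall>g\<in>OmE. f (g \<circ> h) = q g"
proof (rule pf_pull[OF assms(2)])
  fix f assume "f \<in> CE"
  then obtain b c where bc: "f = (\<lambda>f. ep b (f c))" by (auto simp: CE_def)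
  from polymapD[OF polymap_CE[OF order_refl, of "h c"] ep_lf[of b]]
  show "\<exists>q\<in>PF CE. \<forall>g\<in>OmE. f (g \<circ> h) = q g" by (simp add: bc)
qed

section \<open>The stabilizer and the dimension of the incidence set\<close>

lemma S_G: "S \<subseteq> G"
  by (auto simp: stab_def)

lemma S_id: "id \<in> S"
  using G_id by (simp add: stab_def)

text \<open>Elements of \<open>G\<close> preserve dimension, so mapping \<open>M\<close> into itself
  suffices. In this form the stabilizer is given by equations.\<close>

lemma stab_iff: "g \<in> S \<longleftrightarrow> g \<in> G \<and> (\<forall>x\<in>M. g x \<in> M)"
proof
  assume g: "g \<in> G \<and> (\<forall>x\<in>M. g x \<in> M)"
  have "g ` M = M"
  proof (rule vs.subspace_dim_equal[OF subalgebra_subspace[OF subalgebra_image] M_subspace])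
    show "m \<le> vs.dim (g ` M)" using g by (simp add: dim_image)
  qed (use g in auto)
  then show "g \<in> S" using g by (simp add: stab_def)
qed (auto simp: stab_def)

text \<open>The equations in \<open>?P\<close> express that functionals vanishing on
  \<open>M\<close> also vanish on \<open>g x\<close> for \<open>x\<close> in \<open>M\<close>; such
  functionals separate \<open>M\<close> from points outside.\<close>

lemma S_relclosed: "relclosed CE G S"
proof -
  let ?P = "{q \<in> PF CE. \<exists>\<phi>\<in>linear_functionals A. (\<forall>x\<in>M. \<phi> x = 0) \<and> (\<exists>x\<in>M. \<forall>f\<in>OmE. \<phi> (f x) = q f)}"
  have "S = {g \<in> G. \<forall>q\<in>?P. q g = 0}"
  proof (intro equalityI subsetI CollectI conjI ballI)
    fix g q assume g: "g \<in> S" and "q \<in> ?P"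
    then obtain \<phi> x where q: "\<forall>x\<in>M. \<phi> x = 0" "x \<in> M" "\<forall>f\<in>OmE. \<phi> (f x) = q f" by blast
    have "g x \<in> M" "g \<in> OmE" using g q(2) G_lin unfolding stab_iff by auto
    then show "q g = 0" using q by metis
  next
    fix g assume g: "g \<in> {g \<in> G. \<forall>q\<in>?P. q g = 0}"
    then have gO: "g \<in> OmE" using G_lin by blast
    have "g x \<in> M" if x: "x \<in> M" for x
    proof (rule ccontr)
      assume "g x \<notin> M"
      then obtain \<phi> where \<phi>: "\<phi> \<in> linear_functionals A" "\<forall>x\<in>M. \<phi> x = 0" "\<phi> (g x) \<noteq> 0"
        using lf_separate_subspace[OF M_subspace] by blast
      obtain q where q: "q \<in> PF CE" "\<forall>f\<in>OmE. \<phi> (f x) = q f"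
        using polymapD[OF polymap_CE[OF order_refl] \<phi>(1)] by blast
      then have "q \<in> ?P" using \<phi> x by blast
      then have "q g = 0" using g by blast
      then show False using \<phi>(3) q(2) gO by auto
    qed
    then show "g \<in> S" using g unfolding stab_iff by blast
  qed (use S_G in blast)
  then show ?thesis unfolding relclosed_def by (intro exI[of _ ?P]) auto
qed

lemma Wt_id: "x \<in> tuples r M \<Longrightarrow> (id, x) \<in> Wt"
  using G_id by (simp add: Wt_def)

lemma Wt_stab: "(g, y) \<in> Wt \<Longrightarrow> s \<in> S \<Longrightarrow> (g \<circ> s, y) \<in> Wt"
proof -
  assume "(g, y) \<in> Wt" "s \<in> S"
  moreover from this have "(g \<circ> s) ` M = g ` M"
    using image_comp[of g s M] by (simp add: stab_def)
  ultimately show ?thesis using G_comp S_G by (auto simp: Wt_def)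
qed

text \<open>
  The stabilizer acts on \<open>Wt\<close> by \<open>(g, y) \<mapsto> (g \<circ> s, y)\<close>, so functions of \<open>g\<close> which are
  independent on the stabilizer are independent of the functions of \<open>y\<close>.
\<close>

lemma trdeg_upper: "trdeg (CV r) Y + trdeg CE S \<le> trdeg CE G + N"
proof -
  let ?e = "trdeg (CV r) Y" and ?s = "trdeg CE S"
  have "(\<lambda>j\<in>{..<r}. 0) \<in> tuples r M" using vs.subspace_0[OF M_subspace] by auto
  then have WtU: "(id, \<lambda>j\<in>{..<r}. 0) \<in> Wt" by (rule Wt_id)
  then have "(\<lambda>j\<in>{..<r}. 0) \<in> U" unfolding U_def Wt_def by blast
  then have Yne: "Y \<noteq> {}" using U_Y by blast
  obtain y where y: "\<And>i. i < ?e \<Longrightarrow> y i \<in> PF (CV r)" "dominant Y ?e y"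
    using trdeg_ex[OF finite_CV Yne] by blast
  obtain u where u: "\<And>i. i < ?s \<Longrightarrow> u i \<in> PF CE" "dominant S ?s u"
    using trdeg_ex[OF finite_CE, of S] S_id by blast
  define F where "F i w = (if i < ?e then y i (snd w) else u (i - ?e) (fst w))"
    for i and w :: "('a \<Rightarrow> 'a) \<times> (nat \<Rightarrow> 'a)"
  have FPF: "F i \<in> PF CP" if "i < ?e + ?s" for i
  proof (cases "i < ?e")
    case True
    then have "F i = (\<lambda>w. y i (snd w))" by (auto simp: F_def)
    then show ?thesis using pf_snd[OF y(1)[OF True]] by simp
  next
    case False
    then have "F i = (\<lambda>w. u (i - ?e) (fst w))" by (auto simp: F_def)
    moreover have "i - ?e < ?s" using False that by simp
    ultimately show ?thesis using pf_fst[OF u(1), of "i - ?e"] by simp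
  qed
  have "dominant Wt (?e + ?s) F"
    unfolding dominant_def
  proof (intro ballI impI allI)
    fix P x assume P: "P \<in> PF (vars (?e + ?s))" "\<forall>w\<in>Wt. P (\<lambda>i. F i w) = 0"
    \<comment> \<open>Separates the variables for \<open>y\<close> from those for \<open>u\<close>.
      With \<open>v\<close> fixed, moving \<open>g\<close> along \<open>g \<circ> s\<close> changes
      only the factors \<open>q k\<close>, so the relation becomes a linear one among the rows
      \<open>?a k\<close>, with coefficients \<open>p k\<close>.\<close>
    obtain I :: "nat set" and p q where I: "finite I" "\<And>k. k \<in> I \<Longrightarrow> p k \<in> PF (vars ?e)"
      "\<And>k. k \<in> I \<Longrightarrow> q k \<in> PF (vars ?s)" "\<And>x. P x = (\<Sum>k\<in>I. p k x * q k (\<lambda>i. x (?e + i)))"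
      "rows_indep I UNIV q"
      using tensor_decomposition[OF P(1)] by blast
    let ?a = "\<lambda>k s g. q k (\<lambda>i. u i (g \<circ> s))"
    have ind: "rows_indep I S (\<lambda>k s. ?a k s id)"
      unfolding rows_indep_def
    proof (intro allI impI)
      fix c assume c: "\<forall>s\<in>S. (\<Sum>k\<in>I. c k * ?a k s id) = 0"
      have "(\<Sum>k\<in>I. c k * q k z) = 0" for z
      proof (rule dominantD[OF u(2), of "\<lambda>z. \<Sum>k\<in>I. c k * q k z" z])
        show "(\<lambda>z. \<Sum>k\<in>I. c k * q k z) \<in> PF (vars ?s)" by (intro pf_sum pf_mult pf_const I(3))
      qed (use c in simp)
      then show "\<forall>k\<in>I. c k = 0" using rows_indepD[OF I(5), of c] by blast
    qed
    have apf: "\<exists>f\<in>PF CE. \<forall>g\<in>OmE. ?a k s g = f g" if k: "k \<in> I" and s: "s \<in> S" for k s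
    proof -
      have sO: "s \<in> OmE" using s S_G G_lin by blast
      have "(\<lambda>g. q k (\<lambda>i. u i g)) \<in> PF CE" by (rule pf_vars_compose[OF I(3)[OF k] u(1)])
      from trans_right_CE[OF sO this] show ?thesis .
    qed
    have idO: "id \<in> OmE" using G_id G_lin by blast
    \<comment> \<open>At \<open>g = id\<close> the rows are independent because \<open>u\<close> is
      dominant on the stabilizer; this persists where \<open>D\<close> is nonzero.\<close>
    obtain D where D: "D \<in> PF CE" "D id \<noteq> 0" "\<And>g. g \<in> OmE \<Longrightarrow> D g \<noteq> 0 \<Longrightarrow> rows_indep I S (\<lambda>k s. ?a k s g)"
      using rows_indep_open[where a = ?a, OF I(1) apf idO ind] by blast
    have z: "p k (\<lambda>i. y i v) = 0" if k: "k \<in> I" and gv: "(g, v) \<in> Wt" and g: "D g \<noteq> 0" for k g v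
    proof -
      have gO: "g \<in> OmE" using gv G_lin by (auto simp: Wt_def)
      show ?thesis
      proof (rule rows_indepD[OF D(3)[OF gO g], where c = "\<lambda>k. p k (\<lambda>i. y i v)"])
        fix s assume s: "s \<in> S"
        have "P (\<lambda>i. F i (g \<circ> s, v)) = 0" using P(2) Wt_stab[OF gv s] by blast
        moreover have "p k (\<lambda>i. F i (g \<circ> s, v)) = p k (\<lambda>i. y i v)" if "k \<in> I" for k
          by (rule pf_vars_cong[OF I(2)[OF that]]) (simp add: F_def)
        moreover have "(\<lambda>i. F (?e + i) (g \<circ> s, v)) = (\<lambda>i. u i (g \<circ> s))" by (auto simp: F_def)
        ultimately show "(\<Sum>k\<in>I. p k (\<lambda>i. y i v) * ?a k s g) = 0" by (simp add: I(4))
      qed (rule k)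
    qed
    have "p k x = 0" if k: "k \<in> I" for k
    proof (rule dominantD[OF y(2) I(2)[OF k]])
      have pf: "(\<lambda>v. p k (\<lambda>i. y i v)) \<in> PF (CV r)" by (rule pf_vars_compose[OF I(2)[OF k] y(1)])
      fix v assume v: "v \<in> Y"
      show "p k (\<lambda>i. y i v) = 0"
      proof (rule vanish_Y[OF pf _ v])
        fix w assume w: "w \<in> Wt"
        show "p k (\<lambda>i. y i (snd w)) = 0"
        \<comment> \<open>The vanishing is known only where \<open>D g\<close> is nonzero;
          irreducibility of \<open>Wt\<close> removes this restriction.\<close>
        proof (rule irr_cancel[OF Wt_irr pf_fst[OF D(1)] pf_snd[OF pf] _ _ w])
          show "nz Wt (\<lambda>w. D (fst w))" using WtU D(2) by (force simp: nz_def)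
          show "D (fst w) * p k (\<lambda>i. y i (snd w)) = 0" if "w \<in> Wt" for w
            using z[OF k, of "fst w" "snd w"] that by auto
        qed
      qed
    qed
    then show "P x = 0" by (simp add: I(4))
  qed
  then show ?thesis using Wt_dominant_le[of "?e + ?s" F] FPF by simp
qed

lemma Wt_dominant_ex:
  "\<exists>F. (\<forall>i<trdeg CE G + N. F i \<in> PF CP) \<and> dominant Wt (trdeg CE G + N) F"
proof -
  let ?d = "trdeg CE G"
  obtain u where u: "\<And>i. i < ?d \<Longrightarrow> u i \<in> PF CE" "dominant G ?d u"
    using trdeg_ex[OF finite_CE, of G] G_id by blast
  define F where "F i w = (if i < ?d then u i (fst w) else lam ((i - ?d) mod m) (snd w ((i - ?d) div m)))"
    for i and w :: "('a \<Rightarrow> 'a) \<times> (nat \<Rightarrow> 'a)"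
  have FPF: "F i \<in> PF CP" if i: "i < ?d + N" for i
  proof (cases "i < ?d")
    case True
    then have "F i = (\<lambda>w. u i (fst w))" by (auto simp: F_def)
    then show ?thesis using pf_fst[OF u(1)[OF True]] by simp
  next
    case False
    then have "(i - ?d) div m < r" using i by (intro less_mult_imp_div_less) simp
    from polymapD[OF polymap_CV[OF this, of UNIV] lam_lf[of "(i - ?d) mod m"]]
    obtain q where q: "q \<in> PF (CV r)" "\<forall>x. lam ((i - ?d) mod m) (x ((i - ?d) div m)) = q x" by blast
    have "F i = (\<lambda>w. q (snd w))" using False q(2) by (auto simp: F_def)
    then show ?thesis using pf_snd[OF q(1)] by simp
  qed
  \<comment> \<open>\<open>T g v\<close> is \<open>v\<close> with its \<open>lam\<close>-components
    replaced by those of \<open>g v\<close>. As \<open>T id\<close> is the identity,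
    \<open>T g\<close> is invertible for generic \<open>g\<close>; as \<open>T g\<close> changes
    \<open>v\<close> only by elements of \<open>M\<close>, preimages of elements of \<open>M\<close>
    lie in \<open>M\<close>.\<close>
  define T where "T g v = v + (\<Sum>k<m. (lam k (g v) - lam k v) *a mu k)" for g v
  have polyT: "polymap OmE CE (\<lambda>g. T g v)" for v
    unfolding T_def
  proof (intro polymap_add polymap_const polymap_sum polymap_scale)
    fix k
    obtain q where "q \<in> PF CE" "\<forall>g\<in>OmE. lam k (g v) = q g"
      using polymapD[OF polymap_CE[OF order_refl] lam_lf] by blast
    then show "\<exists>q\<in>PF CE. \<forall>g\<in>OmE. lam k (g v) - lam k v = q g"
      by (intro bexI[of _ "\<lambda>g. q g - lam k v"] pf_diff pf_const) auto
  qed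
  have idO: "id \<in> OmE" using G_id G_lin by blast
  have indT: "rows_indep Bs Bs (\<lambda>k l. ep l (T id k))"
    using independent_rows_indep[OF Bs(2)] by (simp add: T_def)
  obtain D where D: "D \<in> PF CE" "D id \<noteq> 0"
    "\<And>g. g \<in> OmE \<Longrightarrow> D g \<noteq> 0 \<Longrightarrow> rows_indep Bs Bs (\<lambda>k l. ep l (T g k))"
    using independent_open[where v = "\<lambda>k g. T g k", OF Bs(1) polyT idO indT] by blast
  have surj: "\<exists>v\<in>g ` M. \<forall>k<m. lam k v = t k" if g: "g \<in> G" "D g \<noteq> 0" for g t
  proof -
    have lin: "g (x + y) = g x + g y" "g (c *a x) = c *a g x" for x y c
      using G_linear[OF g(1)] unfolding lin_iff by blast+
    have lf: "lam k (x + y) = lam k x + lam k y" "lam k (c *a x) = c * lam k x" for k x y c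
      using lam_lf[of k] unfolding lf_iff by blast+
    have "T g (x + y) = T g x + T g y" for x y
      by (simp add: T_def lin lf vs.scale_left_distrib vs.scale_left_diff_distrib sum.distrib sum_subtractf)
    moreover have "T g (c *a x) = c *a T g x" for c x
      by (simp add: T_def lin lf vs.scale_right_distrib vs.scale_sum_right vs.scale_left_diff_distrib
        vs.scale_right_diff_distrib)
    ultimately have "Vector_Spaces.linear (smult A) (smult A) (T g)" by (simp add: lin_iff)
    then have "bij (T g)" using lin_inj_bij D(3) g G_lin by blast
    then obtain v where v: "T g v = (\<Sum>k<m. t k *a mu k)" by (metis bij_pointE)
    have "v = (\<Sum>k<m. t k *a mu k) - (\<Sum>k<m. (lam k (g v) - lam k v) *a mu k)"
      using v by (simp add: T_def algebra_simps)
    then have vM: "v \<in> M"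
      by (rule ssubst[of _ _ "\<lambda>x. x \<in> M"]) (intro vs.subspace_diff M_subspace M_comb)
    have "T g v = (\<Sum>k<m. lam k v *a mu k) + (\<Sum>k<m. (lam k (g v) - lam k v) *a mu k)"
      using M_expand[OF vM] by (simp add: T_def)
    also have "\<dots> = (\<Sum>k<m. lam k (g v) *a mu k)"
      by (simp add: vs.scale_left_diff_distrib sum_subtractf)
    finally have "(\<Sum>k<m. lam k (g v) *a mu k) = (\<Sum>k<m. t k *a mu k)" using v by simp
    then have "lam k (g v) = t k" if "k < m" for k using lam_comb[OF that] by metis
    then show ?thesis using vM by blast
  qed
  have "dominant Wt (?d + N) F"
    unfolding dominant_def
  proof (intro ballI impI allI)
    fix P x assume P: "P \<in> PF (vars (?d + N))" "\<forall>w\<in>Wt. P (\<lambda>i. F i w) = 0"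
    \<comment> \<open>The last \<open>N\<close> entries are frozen at those of \<open>x\<close>,
      which leaves a relation in the functions \<open>u\<close> alone.\<close>
    let ?c = "\<lambda>(z :: nat \<Rightarrow> 'k) i. if i < ?d then z i else x i"
    have cpf: "(\<lambda>w. P (?c (f w))) \<in> PF C" if "\<And>i. i < ?d \<Longrightarrow> (\<lambda>w. f w i) \<in> PF C"
      for f :: "'z \<Rightarrow> nat \<Rightarrow> 'k" and C
    proof (rule pf_vars_compose[OF P(1), of "\<lambda>i w. ?c (f w) i"])
      fix i show "(\<lambda>w. ?c (f w) i) \<in> PF C" using that by (cases "i < ?d") (auto intro: pf_const)
    qed
    have z: "P (?c (\<lambda>i. u i g)) = 0" if g: "g \<in> G" "D g \<noteq> 0" for g
    proof -
      have "\<forall>j. \<exists>v. v \<in> g ` M \<and> (\<forall>k<m. lam k v = x (?d + (j * m + k)))"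
      proof
        fix j
        show "\<exists>v. v \<in> g ` M \<and> (\<forall>k<m. lam k v = x (?d + (j * m + k)))"
          using surj[OF g, of "\<lambda>k. x (?d + (j * m + k))"] by blast
      qed
      from choice[OF this] obtain v where
        "\<forall>j. v j \<in> g ` M \<and> (\<forall>k<m. lam k (v j) = x (?d + (j * m + k)))" ..
      then have v: "\<And>j. v j \<in> g ` M" "\<And>j k. k < m \<Longrightarrow> lam k (v j) = x (?d + (j * m + k))"
        by auto
      have "(g, \<lambda>j\<in>{..<r}. v j) \<in> Wt" using g(1) v(1) by (auto simp: Wt_def)
      then have "P (\<lambda>i. F i (g, \<lambda>j\<in>{..<r}. v j)) = 0" using P(2) by blast
      moreover have "P (\<lambda>i. F i (g, \<lambda>j\<in>{..<r}. v j)) = P (?c (\<lambda>i. u i g))"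
      proof (rule pf_vars_cong[OF P(1)])
        fix i assume i: "i < ?d + N"
        show "F i (g, \<lambda>j\<in>{..<r}. v j) = ?c (\<lambda>i. u i g) i"
        proof (cases "i < ?d")
          case False
          then have "i - ?d < N" using i by simp
          moreover from this have "m > 0" by (cases "m = 0") auto
          ultimately have j: "(i - ?d) div m < r" "(i - ?d) mod m < m"
            by (auto intro: less_mult_imp_div_less)
          have "?d + ((i - ?d) div m * m + (i - ?d) mod m) = i"
            using False by (simp only: div_mult_mod_eq)
          then show ?thesis using False j(1) v(2)[OF j(2), of "(i - ?d) div m"] by (simp only: F_def) simp
        qed (simp add: F_def)
      qed
      ultimately show ?thesis by simp
    qed
    have pfg: "(\<lambda>g. P (?c (\<lambda>i. u i g))) \<in> PF CE" by (rule cpf) (simp add: u(1))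
    have zG: "P (?c (\<lambda>i. u i g)) = 0" if "g \<in> G" for g
      by (rule irr_cancel[OF G_irr D(1) pfg _ _ that]) (use G_id D(2) z in \<open>auto simp: nz_def\<close>)
    have "P (?c x) = 0"
    proof (rule dominantD[OF u(2), of "\<lambda>z. P (?c z)" x])
      show "(\<lambda>z. P (?c z)) \<in> PF (vars ?d)" by (rule cpf) (rule pf_vars_var)
    qed (rule zG)
    moreover have "?c x = x" by auto
    ultimately show "P x = 0" by simp
  qed
  then show ?thesis using FPF by blast
qed

end

section \<open>Fibres of the projection\<close>

context translates
begin

lemma Wt_Y: "(g, y) \<in> Wt \<Longrightarrow> y \<in> Y"
  using U_Y unfolding Wt_def U_def by blast

lemma finite_fibre:
  assumes "\<And>z. z \<in> CV r \<Longrightarrow> finite (R z)"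
  shows "finite {y \<in> OmV. \<forall>z\<in>CV r. z y \<in> R z}"
proof -
  let ?F = "{y \<in> OmV. \<forall>z\<in>CV r. z y \<in> R z}" and ?f = "\<lambda>y. \<lambda>z\<in>CV r. z y"
  have "inj_on ?f ?F"
  proof (rule inj_onI)
    fix x y assume xy: "x \<in> ?F" "y \<in> ?F" "?f x = ?f y"
    have "x j = y j" if j: "j < r" for j
    proof (rule ep_separate[of "x j - y j", simplified])
      fix b assume b: "b \<in> Bs"
      then have "(\<lambda>x. ep b (x j)) \<in> CV r" using j by (auto simp: CV_def)
      then have "ep b (x j) = ep b (y j)" using xy(3) by (metis restrict_apply')
      moreover have "ep b (x j - y j) = ep b (x j) - ep b (y j)"
        using vs.representation_diff[OF Bs(2), of "y j" "x j"] Bs(3) by (simp add: ep_def)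
      ultimately show "ep b (x j - y j) = 0" by simp
    qed
    moreover have "x j = y j" if "\<not> j < r" for j
      using xy(1,2) that by (simp add: PiE_iff extensional_def)
    ultimately show "x = y" by blast
  qed
  moreover have "?f ` ?F \<subseteq> Pi\<^sub>E (CV r) R" by auto
  then have "finite (?f ` ?F)"
    by (rule finite_subset) (intro finite_PiE finite_CV assms)
  ultimately show ?thesis by (intro finite_imageD[of ?f ?F])
qed

lemma loc_closed_Wt:
  assumes "b \<in> PF CE" "\<forall>x\<in>zclosure OmE CE G. b x \<noteq> 0 \<longrightarrow> x \<in> G"
    and w: "w \<in> zclosure (OmE \<times> OmV) CP Wt" "b (fst w) \<noteq> 0"
  shows "w \<in> Wt"
proof -
  obtain g y where gy: "w = (g, y)" by (cases w)
  have O: "g \<in> OmE" "y \<in> OmV" using w(1) gy by (auto simp: zclosure_def)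
  have "g \<in> zclosure OmE CE G"
    unfolding zclosure_def
  proof (intro CollectI conjI ballI impI)
    show "Vector_Spaces.linear (smult A) (smult A) g" using O(1) by simp
    fix p assume p: "p \<in> PF CE" "\<forall>w\<in>G. p w = 0"
    have "p (fst w) = 0" by (rule zclosureD[OF w(1) pf_fst[OF p(1)]]) (use p(2) in \<open>auto simp: Wt_def\<close>)
    then show "p g = 0" using gy by simp
  qed
  then have g: "g \<in> G" using assms(2) w(2) gy by auto
  have "y j \<in> g ` M" if j: "j < r" for j
  proof (rule ccontr)
    assume yj: "y j \<notin> g ` M"
    let ?v = "\<lambda>k w. if k < m then fst w (mu k) else snd w j"
    have ind: "rows_indep {..m} Bs (\<lambda>k l. ep l (?v k w))"
      unfolding rows_indep_vec
    proof (intro allI impI)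
      fix c assume "(\<Sum>k\<le>m. c k *a ?v k w) = 0"
      then have c: "(\<Sum>k<m. c k *a g (mu k)) + c m *a y j = 0"
        by (simp add: gy lessThan_Suc_atMost[symmetric])
      have cm: "c m = 0"
      proof (rule ccontr)
        assume cm: "c m \<noteq> 0"
        have "c m *a y j = - (\<Sum>k<m. c k *a g (mu k))" using c by (simp add: eq_neg_iff_add_eq_0 add.commute)
        also have "- (\<Sum>k<m. c k *a g (mu k)) \<in> g ` M"
          by (intro vs.subspace_neg image_M_comb[OF g] subalgebra_subspace[OF subalgebra_image[OF g]])
        finally have "inverse (c m) *a (c m *a y j) \<in> g ` M"
          by (rule vs.subspace_scale[OF subalgebra_subspace[OF subalgebra_image[OF g]]])
        moreover have "inverse (c m) *a (c m *a y j) = y j" using cm by simp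
        ultimately show False using yj by metis
      qed
      then have "c k = 0" if "k < m" for k using image_mu_comb_zero[OF g _ that, of c] c by simp
      then show "\<forall>k\<in>{..m}. c k = 0" using cm by (auto simp: le_less)
    qed
    have poly: "polymap (OmE \<times> OmV) CP (?v k)" for k
    proof (cases "k < m")
      case True
      have "polymap (OmE \<times> OmV) CP (\<lambda>w. fst w (mu k))"
      proof (rule polymap_pull[where h = "\<lambda>f. f (mu k)" and k = fst, OF polymap_CE[OF order_refl]])
        show "fst x \<in> OmE" if "x \<in> OmE \<times> OmV" for x using that by (simp add: mem_Times_iff)
        show "(\<lambda>w. f (fst w)) \<in> PF CP" if "f \<in> CE" for f by (rule pf_fst[OF pf_coord[OF that]])
      qed
      then show ?thesis using True by simp
    next
      case False
      have "polymap (OmE \<times> OmV) CP (\<lambda>w. snd w j)"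
      proof (rule polymap_pull[where h = "\<lambda>x. x j" and k = snd, OF polymap_CV[OF j, of UNIV]])
        show "(\<lambda>w. f (snd w)) \<in> PF CP" if "f \<in> CV r" for f by (rule pf_snd[OF pf_coord[OF that]])
      qed simp
      then show ?thesis using False by simp
    qed
    have wO: "w \<in> OmE \<times> OmV" using O gy by simp
    obtain D where D: "D \<in> PF CP" "D w \<noteq> 0"
      "\<forall>x\<in>OmE \<times> OmV. D x \<noteq> 0 \<longrightarrow> rows_indep {..m} Bs (\<lambda>k l. ep l (?v k x))"
      using independent_open[where v = ?v, OF finite_atMost poly wO ind] by (elim bexE conjE) (rule that)
    have "D w = 0"
    proof (rule zclosureD[OF w(1) D(1)], rule ccontr)
      fix x assume x: "x \<in> Wt" "D x \<noteq> 0"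
      then have g': "fst x \<in> G" "snd x \<in> tuples r (fst x ` M)"
        unfolding Wt_def by (simp_all add: case_prod_beta)
      from g'(2) have "snd x j \<in> fst x ` M" by (rule PiE_mem) (use j in simp)
      then obtain c where c: "snd x j = (\<Sum>k<m. c k *a fst x (mu k))" using image_M_expand[OF g'(1)] by blast
      have xO: "x \<in> OmE \<times> OmV"
        using g' G_lin by (simp add: mem_Times_iff PiE_iff subset_iff)
      have "rows_indep {..m} Bs (\<lambda>k l. ep l (?v k x))" by (rule D(3)[rule_format, OF xO x(2)])
      then have *: "(\<Sum>k\<le>m. d k *a ?v k x) = 0 \<longrightarrow> (\<forall>k\<in>{..m}. d k = 0)" for d
        unfolding rows_indep_vec by blast
      have "(\<Sum>k\<le>m. (if k < m then c k else - 1) *a ?v k x) = 0"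
        by (simp add: c lessThan_Suc_atMost[symmetric])
      then show False using *[of "\<lambda>k. if k < m then c k else - 1"] by (auto dest: bspec[of _ _ m])
    qed
    then show False using D(2) by simp
  qed
  then have "y \<in> tuples r (g ` M)" using O(2) by (auto simp: PiE_iff)
  then show ?thesis using g gy by (simp add: Wt_def)
qed

text \<open>
  Extend a transcendence basis of \<open>Y\<close> to one of \<open>Wt\<close> by coordinates of \<open>g\<close>. Over a generic value of the
  basis of \<open>Y\<close> there are only finitely many \<open>y\<close>, each with fibre in a coset of the stabilizer, and
  the added coordinates still have dense image on the union of these fibres.
\<close>

lemma trdeg_lower:
  assumes x0: "x0 \<in> tuples r M" "generated A (x0 ` {..<r}) = M"
  shows "trdeg CE G + N \<le> trdeg (CV r) Y + trdeg CE S"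
proof -
  let ?e = "trdeg (CV r) Y" and ?s = "trdeg CE S"
  have x0W: "(id, x0) \<in> Wt" by (rule Wt_id[OF x0(1)])
  then have "x0 \<in> U" unfolding U_def Wt_def by blast
  then have Yne: "Y \<noteq> {}" using U_Y by blast
  have x0O: "x0 \<in> OmV" using x0(1) by (auto simp: PiE_iff)
  obtain y where y: "\<And>i. i < ?e \<Longrightarrow> y i \<in> PF (CV r)" "dominant Y ?e y"
    using trdeg_ex[OF finite_CV Yne] by blast
  have domy: "dominant Wt ?e (\<lambda>i w. y i (snd w))"
    by (rule dominant_pullback[OF y(2,1)]) (auto intro: vanish_Y)
  let ?T = "(\<lambda>f w. f (fst w)) ` CE :: (('a \<Rightarrow> 'a) \<times> (nat \<Rightarrow> 'a) \<Rightarrow> 'k) set"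
  have finT: "finite ?T" using finite_CE by simp
  have Wne: "Wt \<noteq> {}" using x0W by blast
  obtain L h where h: "?e \<le> L" "\<forall>i<?e. h i = (\<lambda>w. y i (snd w))" "\<forall>i. ?e \<le> i \<and> i < L \<longrightarrow> h i \<in> ?T"
    "dominant Wt L h" "\<forall>t\<in>?T. alg Wt (h ` {..<L}) t"
    using extend_dominant[OF Wne finT domy] by blast
  have hPF: "h i \<in> PF CP" if "i < L" for i
  proof (cases "i < ?e")
    case True
    then show ?thesis using h(2) pf_snd[OF y(1)[OF True]] by simp
  next
    case False
    then have "h i \<in> ?T" using h(3) that by simp
    then show ?thesis by (auto simp: prod_coords_def intro!: pf_coord)
  qed
  have algY: "alg Y (y ` {..<?e}) z" if "z \<in> CV r" for z
    by (rule trdeg_alg[OF finite_CV y]) (use that in \<open>auto intro: pf_coord\<close>)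
  have yh: "(\<lambda>w. y i (snd w)) \<in> PF (h ` {..<L})" if "i < ?e" for i
  proof (rule pf_coord)
    show "(\<lambda>w. y i (snd w)) \<in> h ` {..<L}" using that h(1,2) by (intro image_eqI[of _ _ i]) auto
  qed
  have "trdeg CE G + N \<le> card (h ` {..<L})"
  proof -
    obtain F where F: "\<And>i. i < trdeg CE G + N \<Longrightarrow> F i \<in> PF CP" "dominant Wt (trdeg CE G + N) F"
      using Wt_dominant_ex by blast
    show ?thesis
    proof (rule steinitz[OF Wt_irr finite_CP _ _ _ F])
      show "finite (h ` {..<L})" by simp
      show "h ` {..<L} \<subseteq> PF CP" using hPF by auto
      fix z assume "z \<in> CP"
      then consider "z \<in> ?T" | z' where "z' \<in> CV r" "z = (\<lambda>w. z' (snd w))"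
        unfolding prod_coords_def by auto
      then show "alg Wt (h ` {..<L}) z"
      proof cases
        case 2
        show ?thesis unfolding 2(2)
        proof (rule alg_pullback[OF algY[OF 2(1)]])
          show "snd w \<in> Y" if "w \<in> Wt" for w using that Wt_Y[of "fst w" "snd w"] by simp
          show "(\<lambda>w. f (snd w)) \<in> PF (h ` {..<L})" if "f \<in> y ` {..<?e}" for f
            using that yh by auto
          fix p v assume p: "p \<in> PF (y ` {..<?e})" "\<And>w. w \<in> Wt \<Longrightarrow> p (snd w) = 0" "v \<in> Y"
          have "p \<in> PF (CV r)" by (rule pf_hull[OF p(1)]) (use y(1) in auto)
          then show "p v = 0" using p(2,3) by (rule vanish_Y)
        qed
      qed (use h(5) in blast)
    qed
  qed
  also have "\<dots> \<le> L" using card_image_le[of "{..<L}" h] by simp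
  finally have DL: "trdeg CE G + N \<le> L" .
  define q where "q = L - ?e"
  have "q \<le> ?s"
  proof (rule ccontr)
    assume nq: "\<not> q \<le> ?s"
    have "\<forall>i. \<exists>f. i < q \<longrightarrow> f \<in> CE \<and> h (?e + i) = (\<lambda>w. f (fst w))"
    proof
      fix i
      show "\<exists>f. i < q \<longrightarrow> f \<in> CE \<and> h (?e + i) = (\<lambda>w. f (fst w))"
      proof (cases "i < q")
        case True
        then have "h (?e + i) \<in> ?T" using h(3) by (simp add: q_def)
        then show ?thesis by blast
      qed blast
    qed
    from choice[OF this] obtain f where f: "\<And>i. i < q \<Longrightarrow> f i \<in> CE"
      "\<And>i. i < q \<Longrightarrow> h (?e + i) = (\<lambda>w. f i (fst w))" by blast
    obtain b1 where b1: "b1 \<in> PF CE" "b1 id \<noteq> 0" "\<forall>x\<in>zclosure OmE CE G. b1 x \<noteq> 0 \<longrightarrow> x \<in> G"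
      using loc_closed_G G_id unfolding loc_closed_def by blast
    obtain b3 where b3: "b3 \<in> PF (CV r)" "b3 x0 \<noteq> 0"
      "\<And>x. x \<in> OmV \<Longrightarrow> b3 x \<noteq> 0 \<Longrightarrow> m \<le> vs.dim (generated A (x ` {..<r}))"
      using generated_dim_open[OF x0O] x0(2) by auto
    let ?b = "\<lambda>w. b1 (fst w) * b3 (snd w)"
    have bPF: "?b \<in> PF CP" by (intro pf_mult pf_fst pf_snd b1 b3)
    have bnz: "nz Wt ?b" using x0W b1(2) b3(2) by (force simp: nz_def)
    have chart: "\<exists>x\<in>OmE \<times> OmV. \<forall>z\<in>CP. z x = c z" for c
    proof -
      obtain x1 where x1: "x1 \<in> OmE" "\<forall>z\<in>CE. z x1 = c (\<lambda>w. z (fst w))"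
        using chart_CE[of "\<lambda>z. c (\<lambda>w. z (fst w))"] by blast
      obtain x2 where x2: "x2 \<in> OmV" "\<forall>z\<in>CV r. z x2 = c (\<lambda>w. z (snd w))"
        using chart_CV[of r "\<lambda>z. c (\<lambda>w. z (snd w))"] by blast
      show ?thesis using x1 x2 by (intro bexI[of _ "(x1, x2)"]) (auto simp: prod_coords_def)
    qed
    have lc: "w \<in> Wt" if "w \<in> zclosure (OmE \<times> OmV) CP Wt" "?b w \<noteq> 0" for w
      using loc_closed_Wt[OF b1(1,3) that(1)] that(2) by simp
    obtain H c0 where H: "H \<in> PF (vars L)" "H c0 \<noteq> 0"
      "\<And>c. H c \<noteq> 0 \<Longrightarrow> \<exists>w\<in>Wt. ?b w \<noteq> 0 \<and> (\<forall>i<L. h i w = c i)"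
      using dominant_image_open[OF Wt_irr finite_CP chart hPF h(4) bPF bnz lc] by blast
    have "\<forall>z. \<exists>Q i. z \<in> CV r \<longrightarrow> polyfam (vars ?e) Q \<and> (\<exists>x. coeff (Q x) i \<noteq> 0) \<and>
       (\<forall>v\<in>Y. poly (Q (\<lambda>i. y i v)) (z v) = 0)"
    proof
      fix z
      show "\<exists>Q i. z \<in> CV r \<longrightarrow> polyfam (vars ?e) Q \<and> (\<exists>x. coeff (Q x) i \<noteq> 0) \<and>
         (\<forall>v\<in>Y. poly (Q (\<lambda>i. y i v)) (z v) = 0)"
      proof (cases "z \<in> CV r")
        case True
        obtain P v0 where P: "polyfam (y ` {..<?e}) P" "v0 \<in> Y" "P v0 \<noteq> 0" "\<forall>v\<in>Y. poly (P v) (z v) = 0"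
          using algY[OF True] unfolding alg_def by blast
        obtain Q where Q: "polyfam (vars ?e) Q" "\<And>v. P v = Q (\<lambda>i. y i v)"
          by (rule polyfam_lift[OF P(1)]) (rule that, assumption+)
        obtain i where "coeff (Q (\<lambda>i. y i v0)) i \<noteq> 0" using P(3) Q(2) by (auto simp: poly_eq_iff)
        then show ?thesis using Q P(4) by auto
      qed blast
    qed
    from choice2[OF this] obtain Q i where Qi: "\<And>z. z \<in> CV r \<Longrightarrow> polyfam (vars ?e) (Q z)"
      "\<And>z. z \<in> CV r \<Longrightarrow> \<exists>x. coeff (Q z x) (i z) \<noteq> 0"
      "\<And>z v. z \<in> CV r \<Longrightarrow> v \<in> Y \<Longrightarrow> poly (Q z (\<lambda>i. y i v)) (z v) = 0" by blast
    let ?a = "\<lambda>z x. coeff (Q z x) (i z)"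
    have aPF: "?a z \<in> PF (vars L)" if "z \<in> CV r" for z
      using pf_vars_mono[OF polyfam_coeff[OF Qi(1)[OF that]] h(1)] .
    have "\<exists>c. \<forall>P\<in>insert H (?a ` CV r). P c \<noteq> 0"
    proof (rule pf_vars_prod_nonzero[of _ "\<lambda>P. P" L])
      fix P assume "P \<in> insert H (?a ` CV r)"
      then show "P \<in> PF (vars L)" "\<exists>a. P a \<noteq> 0" using aPF Qi(2) H(1,2) by blast+
    qed (simp add: finite_CV)
    \<comment> \<open>At \<open>c\<close> the map \<open>h\<close> attains the value, and the
      relations for the coordinates of \<open>y\<close> remain nonzero polynomials. The latter makes
      \<open>Yc\<close> finite.\<close>
    then obtain c where c: "\<forall>P\<in>insert H (?a ` CV r). P c \<noteq> 0" ..
    then have cH: "H c \<noteq> 0" and ca: "\<And>z. z \<in> CV r \<Longrightarrow> ?a z c \<noteq> 0" by simp_all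
    define Yc where "Yc = {v \<in> Y. \<forall>i<?e. y i v = c i}"
    have "finite Yc"
    proof (rule finite_subset)
      show "finite {v \<in> OmV. \<forall>z\<in>CV r. z v \<in> {t. poly (Q z c) t = 0}}"
      proof (rule finite_fibre)
        fix z assume "z \<in> CV r"
        then have "?a z c \<noteq> 0" by (rule ca)
        then have "Q z c \<noteq> 0" by auto
        then show "finite {t. poly (Q z c) t = 0}" by (rule poly_roots_finite)
      qed
      show "Yc \<subseteq> {v \<in> OmV. \<forall>z\<in>CV r. z v \<in> {t. poly (Q z c) t = 0}}"
      proof (intro subsetI CollectI conjI ballI)
        fix v assume v: "v \<in> Yc"
        then show "v \<in> OmV" by (simp add: Yc_def Y_def zclosure_def)
        fix z assume z: "z \<in> CV r"
        have "Q z (\<lambda>i. y i v) = Q z c"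
          by (rule polyfam_vars_cong[OF Qi(1)[OF z]]) (use v in \<open>simp add: Yc_def\<close>)
        then show "poly (Q z c) (z v) = 0" using Qi(3)[OF z, of v] v by (simp add: Yc_def)
      qed
    qed
    \<comment> \<open>If \<open>v\<close> generates \<open>g\<close> M\<open>, then\<close>g
      \<open>M\<close> is determined by \<open>v\<close>, so all such \<open>g\<close> lie in one
      coset of the stabilizer. Pulled back along left translation by \<open>g0\<close>, the
      \<open>q\<close> functions \<open>f i\<close> exceed the transcendence degree of the
      stabilizer and hence satisfy a relation.\<close>
    have fibre: "\<exists>P. P \<in> PF (vars q) \<and> (\<exists>x. P x \<noteq> 0) \<and>
       (\<forall>g. (g, v) \<in> Wt \<longrightarrow> b3 v \<noteq> 0 \<longrightarrow> P (\<lambda>i. f i g) = 0)" for v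
    proof (cases "b3 v \<noteq> 0 \<and> (\<exists>g0. (g0, v) \<in> Wt)")
      case False
      then show ?thesis by (intro exI[of _ "\<lambda>_. 1"]) (auto intro: pf_const)
    next
      case True
      then obtain g0 where g0: "(g0, v) \<in> Wt" by blast
      have gG: "g \<in> G" "v \<in> tuples r (g ` M)" if "(g, v) \<in> Wt" for g
        using that by (auto simp: Wt_def)
      have gen: "generated A (v ` {..<r}) = g ` M" if g: "(g, v) \<in> Wt" for g
      proof (rule vs.subspace_dim_equal)
        show "vs.subspace (generated A (v ` {..<r}))"
          by (rule subalgebra_subspace[OF subalgebra_generated])
        have sa: "subalgebra A (g ` M)" by (rule subalgebra_image[OF gG(1)[OF g]])
        then show "vs.subspace (g ` M)" by (rule subalgebra_subspace)
        show "generated A (v ` {..<r}) \<subseteq> g ` M"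
          by (rule generated_minimal[OF sa]) (use gG(2)[OF g] in auto)
        have "v \<in> OmV" using gG(2)[OF g] by (auto simp: PiE_iff)
        then show "vs.dim (g ` M) \<le> vs.dim (generated A (v ` {..<r}))"
          using b3(3)[of v] True dim_image[OF gG(1)[OF g]] by simp
      qed
      obtain h0 where h0: "h0 \<in> G" "h0 \<circ> g0 = id" "g0 \<circ> h0 = id" using G_inv[OF gG(1)[OF g0]] by blast
      have inS: "h0 \<circ> g \<in> S" if g: "(g, v) \<in> Wt" for g
      proof -
        have "g ` M = g0 ` M" using gen[OF g] gen[OF g0] by simp
        then have "(h0 \<circ> g) ` M = (h0 \<circ> g0) ` M" by (metis image_comp)
        then show ?thesis using G_comp[OF h0(1) gG(1)[OF g]] h0(2) by (simp add: stab_def)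
      qed
      have g0O: "g0 \<in> OmE" using gG(1)[OF g0] G_lin by blast
      have "\<forall>i. \<exists>u. i < q \<longrightarrow> u \<in> PF CE \<and> (\<forall>s\<in>OmE. f i (g0 \<circ> s) = u s)"
        using trans_CE[OF g0O pf_coord[OF f(1)]] by blast
      from choice[OF this] obtain u where u: "\<And>i. i < q \<Longrightarrow> u i \<in> PF CE"
        "\<And>i s. i < q \<Longrightarrow> s \<in> OmE \<Longrightarrow> f i (g0 \<circ> s) = u i s" by blast
      have "\<not> dominant S q u" using trdeg_ge[OF finite_CE, of q u S] u(1) nq by blast
      then obtain P where P: "P \<in> PF (vars q)" "\<forall>s\<in>S. P (\<lambda>i. u i s) = 0" "\<exists>x. P x \<noteq> 0"
        unfolding dominant_def by blast
      have "P (\<lambda>i. f i g) = 0" if g: "(g, v) \<in> Wt" for g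
      proof -
        have sO: "h0 \<circ> g \<in> OmE" using inS[OF g] S_G G_lin by blast
        have geq: "g0 \<circ> (h0 \<circ> g) = g" using h0(3) by (metis comp_assoc id_comp)
        have "P (\<lambda>i. f i g) = P (\<lambda>i. u i (h0 \<circ> g))"
          by (rule pf_vars_cong[OF P(1)]) (use u(2)[OF _ sO] geq in simp)
        then show ?thesis using P(2) inS[OF g] by simp
      qed
      then show ?thesis using P by blast
    qed
    then have "\<forall>v. \<exists>P. P \<in> PF (vars q) \<and> (\<exists>x. P x \<noteq> 0) \<and>
       (\<forall>g. (g, v) \<in> Wt \<longrightarrow> b3 v \<noteq> 0 \<longrightarrow> P (\<lambda>i. f i g) = 0)" by blast
    from choice[OF this] obtain P where P: "\<And>v. P v \<in> PF (vars q)" "\<And>v. \<exists>x. P v x \<noteq> 0"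
      "\<And>v g. (g, v) \<in> Wt \<Longrightarrow> b3 v \<noteq> 0 \<Longrightarrow> P v (\<lambda>i. f i g) = 0" by blast
    \<comment> \<open>The values of the \<open>y i\<close> stay at \<open>c\<close>, and the last
      \<open>q\<close> values are chosen off the zeros of \<open>H\<close> and of the finitely many
      \<open>P v\<close> with \<open>v\<close> in \<open>Yc\<close>. The point of \<open>Wt\<close>
      attaining them lies over \<open>Yc\<close>, where the relation \<open>P v\<close> must
      nevertheless hold.\<close>
    let ?j = "\<lambda>c' i. if i < ?e then c i else c' (i - ?e)"
    have Hj1: "(\<lambda>c'. H (?j c')) \<in> PF (vars q)"
    proof (rule pf_vars_compose[OF H(1), of "\<lambda>i c'. ?j c' i"])
      fix i assume "i < L"
      then show "(\<lambda>c'. ?j c' i) \<in> PF (vars q)"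
        by (cases "i < ?e") (auto intro!: pf_const pf_vars_var simp: q_def)
    qed
    have Hj2: "H (?j (\<lambda>i. c (?e + i))) \<noteq> 0"
    proof -
      have "?j (\<lambda>i. c (?e + i)) = c" by auto
      then show ?thesis using cH by simp
    qed
    have Hj: "\<exists>x. H (?j x) \<noteq> 0" by (rule exI) (rule Hj2)
    have "\<exists>c'. \<forall>R\<in>insert (\<lambda>c'. H (?j c')) (P ` Yc). R c' \<noteq> 0"
    proof (rule pf_vars_prod_nonzero[of _ "\<lambda>R. R" q])
      fix R assume "R \<in> insert (\<lambda>c'. H (?j c')) (P ` Yc)"
      then show "R \<in> PF (vars q)" "\<exists>x. R x \<noteq> 0" using Hj Hj1 P(1,2) by auto
    qed (simp add: \<open>finite Yc\<close>)
    then obtain c' where "\<forall>R\<in>insert (\<lambda>c'. H (?j c')) (P ` Yc). R c' \<noteq> 0" ..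
    then have "H (?j c') \<noteq> 0" and c': "\<And>v. v \<in> Yc \<Longrightarrow> P v c' \<noteq> 0" by simp_all
    from H(3)[OF this(1)] obtain g v where w: "(g, v) \<in> Wt" "b3 v \<noteq> 0" "\<forall>i<L. h i (g, v) = ?j c' i" by auto
    have "v \<in> Yc"
    proof -
      have "v \<in> Y" using w(1) by (rule Wt_Y)
      moreover have "y k v = c k" if "k < ?e" for k
        using w(3)[rule_format, of k] h(1,2) that by simp
      ultimately show ?thesis by (simp add: Yc_def)
    qed
    then have "P v c' \<noteq> 0" by (rule c')
    moreover have "P v (\<lambda>i. f i g) = P v c'"
    proof (rule pf_vars_cong[OF P(1)])
      fix k assume k: "k < q"
      then show "f k g = c' k" using w(3)[rule_format, of "?e + k"] f(2)[OF k] by (simp add: q_def)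
    qed
    ultimately show False using P(3)[OF w(1,2)] by simp
  qed
  then show ?thesis using DL by (simp add: q_def)
qed

end

subsection \<open>Irreducible components and dimension of the non-generating locus\<close>

text \<open>Every irreducible subset is contained in some \<open>X i\<close>, so maximality can be
  tested inside the family.\<close>

lemma irreducible_components_Union:
  fixes C :: "('x \<Rightarrow> 'k::field) set"
  assumes WOm: "W \<subseteq> Om" and fin: "finite I" and W: "W = (\<Union>i\<in>I. X i)"
    and X: "\<And>i. i \<in> I \<Longrightarrow> relclosed C W (X i) \<and> irr C (X i)"
  shows "irreducible_components (subtopology (zariski_topology Om C) W) =
    {X i | i. i \<in> I \<and> (\<forall>j\<in>I. X i \<subseteq> X j \<longrightarrow> X j = X i)}"
proof -
  have cover: "\<exists>i\<in>I. T \<subseteq> X i" if "T \<subseteq> W" "irr C T" for T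
  proof -
    have "\<exists>E\<in>X ` I. T \<subseteq> E"
      by (rule irr_subset_Union[OF that(2) _ _ that(1)]) (use fin X W that(1) in auto)
    then show ?thesis by blast
  qed
  have sub: "X i \<subseteq> W" if "i \<in> I" for i using W that by blast
  show ?thesis
    unfolding irreducible_components_def irreduciblein_irr[OF WOm]
  proof (intro equalityI subsetI)
    fix T assume "T \<in> {T. (T \<subseteq> W \<and> irr C T) \<and> (\<forall>T'. (T' \<subseteq> W \<and> irr C T') \<and> T \<subseteq> T' \<longrightarrow> T' = T)}"
    then have T: "T \<subseteq> W" "irr C T" "\<And>T'. T' \<subseteq> W \<Longrightarrow> irr C T' \<Longrightarrow> T \<subseteq> T' \<Longrightarrow> T' = T" by blast+
    obtain i where i: "i \<in> I" "T \<subseteq> X i" using cover[OF T(1,2)] by blast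
    have Xi: "X i = T" using T(3)[OF sub[OF i(1)]] X[OF i(1)] i(2) by blast
    have "X j = X i" if "j \<in> I" "X i \<subseteq> X j" for j
      using T(3)[OF sub[OF that(1)]] X[OF that(1)] that(2) Xi by simp
    then show "T \<in> {X i | i. i \<in> I \<and> (\<forall>j\<in>I. X i \<subseteq> X j \<longrightarrow> X j = X i)}" using i(1) Xi by blast
  next
    fix T assume "T \<in> {X i | i. i \<in> I \<and> (\<forall>j\<in>I. X i \<subseteq> X j \<longrightarrow> X j = X i)}"
    then obtain i where i: "i \<in> I" "\<And>j. j \<in> I \<Longrightarrow> X i \<subseteq> X j \<Longrightarrow> X j = X i" "T = X i" by blast
    have "T' = T" if T': "T' \<subseteq> W" "irr C T'" "T \<subseteq> T'" for T'
    proof -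
      obtain j where j: "j \<in> I" "T' \<subseteq> X j" using cover[OF T'(1,2)] by blast
      then have "X j = X i" using i(2)[OF j(1)] i(3) T'(3) by blast
      then show ?thesis using j(2) T'(3) i(3) by blast
    qed
    then show "T \<in> {T. (T \<subseteq> W \<and> irr C T) \<and> (\<forall>T'. (T' \<subseteq> W \<and> irr C T') \<and> T \<subseteq> T' \<longrightarrow> T' = T)}"
      using i sub X by blast
  qed
qed

lemma closure_of_zariski:
  assumes "U \<subseteq> Om"
  shows "zariski_topology Om C closure_of U = zclosure Om C U"
proof (rule closure_of_unique)
  show "U \<subseteq> zclosure Om C U" using assms unfolding zclosure_def by blast
  have "zclosure Om C U = zero_locus Om {p \<in> PF C. \<forall>w\<in>U. p w = 0}"
    unfolding zclosure_def zero_locus_def by auto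
  then show "closedin (zariski_topology Om C) (zclosure Om C U)"
    unfolding closedin_zariski by (intro exI[of _ "{p \<in> PF C. \<forall>w\<in>U. p w = 0}"]) auto
  fix T assume T: "U \<subseteq> T" "closedin (zariski_topology Om C) T"
  then obtain P where "P \<subseteq> PF C" "T = zero_locus Om P" unfolding closedin_zariski by blast
  then show "zclosure Om C U \<subseteq> T" using T(1) unfolding zclosure_def zero_locus_def by blast
qed

lemma irr_zclosure:
  assumes "irr C U" "U \<subseteq> Om"
  shows "irr C (zclosure Om C U)"
  unfolding irr_def
proof (intro conjI ballI impI)
  have sub: "U \<subseteq> zclosure Om C U" using assms(2) unfolding zclosure_def by blast
  then show "zclosure Om C U \<noteq> {}" using irr_nonempty[OF assms(1)] by blast
  fix p q assume pq: "p \<in> PF C" "q \<in> PF C" "\<forall>w\<in>zclosure Om C U. p w * q w = 0"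
  then have "(\<forall>w\<in>U. p w = 0) \<or> (\<forall>w\<in>U. q w = 0)" using assms(1) sub unfolding irr_def by blast
  then show "(\<forall>w\<in>zclosure Om C U. p w = 0) \<or> (\<forall>w\<in>zclosure Om C U. q w = 0)"
    using zclosureD pq(1,2) by (metis (full_types))
qed

lemma relclosed_zclosure: "relclosed C Om (zclosure Om C U)"
  unfolding relclosed_def zclosure_def by (intro exI[of _ "{p \<in> PF C. \<forall>w\<in>U. p w = 0}"]) auto

lemma zclosure_minimal:
  assumes "relclosed C Om E" "U \<subseteq> E"
  shows "zclosure Om C U \<subseteq> E"
proof -
  obtain P where P: "P \<subseteq> PF C" "E = {w \<in> Om. \<forall>p\<in>P. p w = 0}" using assms(1) by (elim relclosedE)
  show ?thesis
  proof
    fix x assume x: "x \<in> zclosure Om C U"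
    then have "p x = 0" if "p \<in> P" for p
      by (rule zclosureD) (use that P assms(2) in auto)
    then show "x \<in> E" using x P(2) by (auto simp: zclosure_def)
  qed
qed

lemma relclosed_between: "relclosed C Om E \<Longrightarrow> E \<subseteq> W \<Longrightarrow> W \<subseteq> Om \<Longrightarrow> relclosed C W E"
proof -
  assume "relclosed C Om E" "E \<subseteq> W" "W \<subseteq> Om"
  from this(1) obtain P where "P \<subseteq> PF C" "E = {w \<in> Om. \<forall>p\<in>P. p w = 0}" by (elim relclosedE)
  with \<open>E \<subseteq> W\<close> \<open>W \<subseteq> Om\<close> show ?thesis unfolding relclosed_def by (intro exI[of _ P]) auto
qed

lemma loc_closed_closed:
  assumes "relclosed C Om W"
  shows "loc_closed Om C W"
  unfolding loc_closed_def
proof (intro conjI ballI)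
  show "W \<subseteq> Om" using assms by (rule relclosed_subset)
  fix w assume "w \<in> W"
  show "\<exists>b\<in>PF C. b w \<noteq> 0 \<and> (\<forall>x\<in>zclosure Om C W. b x \<noteq> 0 \<longrightarrow> x \<in> W)"
    using zclosure_minimal[OF assms order_refl] by (intro bexI[of _ "\<lambda>_. 1"] pf_const) auto
qed

context translates
begin

lemma irr_U: "irr (CV r) U"
proof -
  have "U = snd ` Wt"
  proof (intro equalityI subsetI)
    fix y assume "y \<in> U"
    then obtain g where "(g, y) \<in> Wt" unfolding U_def Wt_def by blast
    then show "y \<in> snd ` Wt" by (rule image_eqI[rotated]) simp
  next
    fix y assume "y \<in> snd ` Wt"
    then obtain g where "g \<in> G" "y \<in> tuples r (g ` M)" unfolding Wt_def by auto
    then show "y \<in> U" unfolding U_def by blast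
  qed
  moreover have "irr (CV r) (snd ` Wt)"
  proof (rule irr_image[OF Wt_irr])
    fix f assume "f \<in> CV r"
    then show "\<exists>q\<in>PF CP. \<forall>w\<in>Wt. f (snd w) = q w"
      by (intro bexI[of _ "\<lambda>w. f (snd w)"] pf_snd pf_coord) auto
  qed
  ultimately show ?thesis by simp
qed

lemma irr_Y: "irr (CV r) Y"
  unfolding Y_def by (rule irr_zclosure[OF irr_U U_OmV])

lemma Y_closure: "Y = V A r closure_of (\<Union>g\<in>G. tuples r (g ` M))"
  unfolding Y_def V_eq U_def[symmetric] by (rule closure_of_zariski[OF U_OmV, symmetric])

lemma group_dim_G: "group_dim A G = ereal (real (trdeg CE G))"
  unfolding group_dim_def End_eq
  by (rule krull_dim_trdeg[OF finite_CE chart_CE loc_closed_G]) (use G_id in blast)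

lemma group_dim_S: "group_dim A S = ereal (real (trdeg CE S))"
  unfolding group_dim_def End_eq
  by (rule krull_dim_trdeg[OF finite_CE chart_CE loc_closed_relclosed[OF loc_closed_G S_relclosed]])
     (use S_id in blast)

lemma U_nongenerating:
  assumes "M \<noteq> UNIV"
  shows "U \<subseteq> {x \<in> OmV. generated A (x ` {..<r}) \<noteq> UNIV}"
proof
  fix x assume x: "x \<in> U"
  then obtain g where g: "g \<in> G" "x \<in> tuples r (g ` M)" unfolding U_def by blast
  have "generated A (x ` {..<r}) \<subseteq> g ` M"
    by (rule generated_minimal[OF subalgebra_image[OF g(1)]]) (use g(2) in auto)
  moreover have "g ` M \<noteq> UNIV"
  proof
    assume "g ` M = UNIV"
    then have "M = UNIV" using G_bij[OF g(1)] by (metis bij_def inj_image_eq_iff)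
    then show False using assms by simp
  qed
  ultimately show "x \<in> {x \<in> OmV. generated A (x ` {..<r}) \<noteq> UNIV}" using x U_OmV by blast
qed

end

theorem theorem1p3:
  fixes A :: "('k::alg_closed_field, 'a::ab_group_add, 'i) multialg"
    and r t :: nat
    and G :: "('a \<Rightarrow> 'a) set"
    and M :: "nat \<Rightarrow> 'a set"
    and X :: "nat \<Rightarrow> (nat \<Rightarrow> 'a) set"
    and d :: "nat \<Rightarrow> ereal"
  assumes "multialgebra A" and "fin_dim A"
    and G: "G = Aut0 A"
    and maximal: "\<And>i. i \<in> {1..t} \<Longrightarrow> maximal_subalgebra A (M i)"
    and orbits: "bij_betw (\<lambda>i. orbit G (M i)) {1..t} (orbit G ` {S. maximal_subalgebra A S})"
    and X: "\<And>i. i \<in> {1..t} \<Longrightarrow> X i = V A r closure_of (\<Union>g\<in>G. tuples r (g ` M i))"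
    and d: "\<And>i. i \<in> {1..t} \<Longrightarrow>
              d i = ereal (real (r * vector_space.dim (smult A) (M i))) - group_dim A (stab G (M i))"
  shows "irreducible_components (Z A r) =
           {X i | i. i \<in> {1..t} \<and> (\<forall>j\<in>{1..t}. X i \<subseteq> X j \<longrightarrow> X j = X i)}
       \<and> krull_dim (Z A r) \<le> group_dim A G + Max (d ` {1..t})
       \<and> ((\<exists>i\<in>{1..t}. d i = Max (d ` {1..t}) \<and> generated_by A r (M i)) \<longrightarrow>
           krull_dim (Z A r) = group_dim A G + Max (d ` {1..t}))"
proof -
  interpret fd: fd_multialgebra A using assms(1,2) by unfold_locales
  have tr: "translates A G (M i)" if "i \<in> {1..t}" for i
    using maximal[OF that] G by unfold_locales (auto simp: maximal_subalgebra_def)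
  let ?I = "{1..t}" and ?OmV = "tuples r (UNIV :: 'a set)" and ?C = "fd.CV r"
  define W where "W = {x \<in> ?OmV. generated A (x ` {..<r}) \<noteq> UNIV}"
  define U where "U i = (\<Union>g\<in>G. tuples r (g ` M i))" for i
  have WOm: "W \<subseteq> ?OmV" by (auto simp: W_def)
  have Wcl: "relclosed ?C ?OmV W" unfolding W_def by (rule fd.relclosed_nongenerating)
  have ZW: "Z A r = subtopology (zariski_topology ?OmV ?C) W"
    by (simp add: Z_def fd.V_eq W_def)
  have XY: "X i = translates.Y A G (M i) r" if "i \<in> ?I" for i
    using X[OF that] translates.Y_closure[OF tr[OF that]] by simp
  have UW: "U i \<subseteq> W" if "i \<in> ?I" for i
    using translates.U_nongenerating[OF tr[OF that], of r] maximal[OF that]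
    by (simp add: U_def W_def translates.U_def[OF tr[OF that]] maximal_subalgebra_def)
  have Xz: "X i = zclosure ?OmV ?C (U i)" if "i \<in> ?I" for i
    using XY[OF that] by (simp add: translates.Y_def[OF tr[OF that]] translates.U_def[OF tr[OF that]] U_def)
  have XW: "X i \<subseteq> W" if "i \<in> ?I" for i
    unfolding Xz[OF that] by (rule zclosure_minimal[OF Wcl UW[OF that]])
  have UX: "U i \<subseteq> X i" if "i \<in> ?I" for i
    using UW[OF that] WOm unfolding Xz[OF that] zclosure_def by blast
  have Xirr: "irr ?C (X i)" if "i \<in> ?I" for i
    unfolding XY[OF that] by (rule translates.irr_Y[OF tr[OF that]])
  have Xcl: "relclosed ?C W (X i)" if "i \<in> ?I" for i
    unfolding Xz[OF that] by (rule relclosed_between[OF relclosed_zclosure _ WOm]) (use XW[OF that] Xz[OF that] in simp)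
  have Gid: "id \<in> G" using fd.Aut0_group(3) by (simp add: G)
  have WX: "W = (\<Union>i\<in>?I. X i)"
  proof
    show "W \<subseteq> (\<Union>i\<in>?I. X i)"
    proof
      fix x assume x: "x \<in> W"
      then obtain N where N: "maximal_subalgebra A N" "generated A (x ` {..<r}) \<subseteq> N"
        using fd.proper_subalgebra_maximal[OF fd.subalgebra_generated] unfolding W_def by blast
      have "orbit G N \<in> (\<lambda>i. orbit G (M i)) ` ?I"
        using N(1) bij_betw_imp_surj_on[OF orbits] by blast
      then obtain i where i: "i \<in> ?I" "orbit G N = orbit G (M i)" by blast
      have "id ` N \<in> orbit G N" unfolding orbit_def using Gid by blast
      then obtain g where g: "g \<in> G" "N = g ` M i" using i(2) unfolding orbit_def by auto
      have "x j \<in> N" if "j < r" for j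
        using N(2) fd.generated_inc[of "x j" "x ` {..<r}"] that by blast
      then have "x \<in> tuples r (g ` M i)" using x g(2) by (auto simp: W_def PiE_iff)
      then have "x \<in> U i" using g(1) unfolding U_def by blast
      then show "x \<in> (\<Union>i\<in>?I. X i)" using UX[OF i(1)] i(1) by blast
    qed
  qed (use XW in blast)
  have comps: "irreducible_components (Z A r) =
      {X i | i. i \<in> ?I \<and> (\<forall>j\<in>?I. X i \<subseteq> X j \<longrightarrow> X j = X i)}"
    unfolding ZW by (rule irreducible_components_Union[OF WOm _ WX]) (use Xcl Xirr in auto)
  show ?thesis
  proof (cases "t = 0")
    \<comment> \<open>Without maximal subalgebras \<open>W\<close> is empty and its dimension is
      minus infinity. The bound then holds whatever \<open>Max {}\<close> is, and the premise of the
      equality is false.\<close>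
    case True
    then have "W = {}" using WX by simp
    then have "krull_dim (Z A r) = - \<infinity>"
      unfolding ZW krull_dim_def irreduciblein_irr[OF WOm]
      by (auto simp: bot_ereal_def[symmetric] dest: irr_nonempty)
    then show ?thesis using comps True by simp
  next
    case False
    then have one: "1 \<in> ?I" by simp
    define D where "D = trdeg fd.CE G"
    define s where "s i = trdeg fd.CE (stab G (M i))" for i
    define x where "x i = trdeg ?C (X i)" for i
    define n where "n i = r * vector_space.dim (smult A) (M i)" for i
    have gd: "group_dim A G = ereal (real D)"
      using translates.group_dim_G[OF tr[OF one]] by (simp add: D_def)
    have di: "d i = ereal (real (n i) - real (s i))" if "i \<in> ?I" for i
      using d[OF that] translates.group_dim_S[OF tr[OF that]] by (simp add: s_def n_def)
    have up: "x i + s i \<le> D + n i" if "i \<in> ?I" for i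
      using translates.trdeg_upper[OF tr[OF that], of r] XY[OF that]
      by (simp add: x_def s_def D_def n_def)
    have low: "D + n i \<le> x i + s i" if i: "i \<in> ?I" "generated_by A r (M i)" for i
    proof -
      obtain x0 where "x0 \<in> tuples r (M i)" "generated A (x0 ` {..<r}) = M i"
        using i(2) unfolding generated_by_def by blast
      from translates.trdeg_lower[OF tr[OF i(1)] this] show ?thesis
        using XY[OF i(1)] by (simp add: x_def s_def D_def n_def)
    qed
    have Wne: "W \<noteq> {}" using XW[OF one] irr_nonempty[OF Xirr[OF one]] by blast
    have kW: "krull_dim (Z A r) = ereal (real (trdeg ?C W))"
      unfolding ZW by (rule krull_dim_trdeg[OF fd.finite_CV fd.chart_CV loc_closed_closed[OF Wcl] Wne])
    have "\<exists>i\<in>?I. trdeg ?C W \<le> x i"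
    proof -
      \<comment> \<open>A maximal dominant family on \<open>W\<close> is dominant already on one of
        the finitely many \<open>X i\<close>, so the dimension of \<open>W\<close> is bounded by
        that of a single member.\<close>
      obtain f where f: "\<And>i. i < trdeg ?C W \<Longrightarrow> f i \<in> PF ?C" "dominant W (trdeg ?C W) f"
        using trdeg_ex[OF fd.finite_CV Wne] by blast
      have "\<exists>T\<in>X ` ?I. dominant T (trdeg ?C W) f"
        by (rule dominant_Union) (use f(2) WX in auto)
      then obtain i where i: "i \<in> ?I" "dominant (X i) (trdeg ?C W) f" by blast
      then show ?thesis unfolding x_def using trdeg_ge[OF fd.finite_CV f(1) i(2)] by blast
    qed
    then obtain i where i: "i \<in> ?I" "trdeg ?C W \<le> x i" by blast
    have Max_ge: "d j \<le> Max (d ` ?I)" if "j \<in> ?I" for j using that by simp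
    have le: "krull_dim (Z A r) \<le> group_dim A G + Max (d ` ?I)"
    proof -
      have "real (trdeg ?C W) \<le> real D + (real (n i) - real (s i))" using i(2) up[OF i(1)] by linarith
      then have "krull_dim (Z A r) \<le> group_dim A G + d i" by (simp add: kW gd di[OF i(1)])
      also have "\<dots> \<le> group_dim A G + Max (d ` ?I)" by (intro add_left_mono Max_ge i(1))
      finally show ?thesis .
    qed
    have ge: "group_dim A G + d j \<le> krull_dim (Z A r)" if j: "j \<in> ?I" "generated_by A r (M j)" for j
    proof -
      obtain f where f: "\<And>i. i < x j \<Longrightarrow> f i \<in> PF ?C" "dominant (X j) (x j) f"
        using trdeg_ex[OF fd.finite_CV irr_nonempty[OF Xirr[OF j(1)]]] unfolding x_def by blast
      have "x j \<le> trdeg ?C W"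
        by (rule trdeg_ge[OF fd.finite_CV f(1) dominant_subset[OF f(2) XW[OF j(1)]]])
      then have "real D + (real (n j) - real (s j)) \<le> real (trdeg ?C W)" using low[OF j] by linarith
      then show ?thesis by (simp add: kW gd di[OF j(1)])
    qed
    show ?thesis
    proof (intro conjI comps le impI, elim bexE conjE)
      fix j assume j: "j \<in> ?I" "d j = Max (d ` ?I)" "generated_by A r (M j)"
      show "krull_dim (Z A r) = group_dim A G + Max (d ` ?I)"
        using le ge[OF j(1,3)] unfolding j(2) by (rule antisym)
    qed
  qed
qed

end
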